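(* Let $\Lambda$ be a finite or countably infinite set with at least two elements and let $A=(A_{x,y})_{x,y\in\Lambda}$ be the conservative generator of a continuous-time Markov chain $(X_t)_{t\in[0,\infty)}$ on $\Lambda$. Fix a finite subset $R$ of $\Lambda$ and sites $a,b\in R$. Then, for every $T>0$ and every bounded measurable function $F\colon \mathcal{M}^+_T(R)\to\mathbb{R}$, $$\mathbb{E}_a\big[F(\ell_T)\,\mathbf{1}_{\{X_T=b\}}\mathbf{1}_{\{R_T=R\}}\big]=\int_{\mathcal{M}^+_T(R)}F(l)\,\rho^{(R)}_{ab}(l)\,\sigma_T(\mathrm{d}l),$$ where, for $l\in\mathcal{M}^+_T(R)$, $$\rho^{(R)}_{ab}(l)=\operatorname{det}^{(R)}_{ab}\big(-A+\partial_l\big)\int_{[0,2\pi]^R}\exp\Big(\sum_{x,y\in R}A_{x,y}\sqrt{l_x}\sqrt{l_y}\,\mathrm{e}^{\mathrm{i}(\theta_x-\theta_y)}\Big)\prod_{x\in R}\frac{\mathrm{d}\theta_x}{2\pi}.$$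
   Context: Conservative generator ($Q$-matrix): $A_{x,y}\ge 0$ for $x\ne y$ and $\sum_{y\in\Lambda}A_{x,y}=0$ for every $x$. Under $\mathbb{P}_a$, with expectation $\mathbb{E}_a$, the chain (with right-continuous paths) starts at $X_0=a$. Local times: $\ell_T(x)=\int_0^T\mathbf{1}_{\{X_s=x\}}\,\mathrm{d}s$ for $x\in\Lambda$, $T>0$. Range: $R_T=\operatorname{supp}(\ell_T)=\{X_s\colon s\in[0,T]\}$. On $\{R_T=R\}$, $F(\ell_T)$ means $F$ evaluated at $(\ell_T(x))_{x\in R}$. $\mathcal{M}^+_T(R)=\{l\colon R\to(0,\infty)\mid\sum_{x\in R}l(x)=T\}$, and we write $l_x=l(x)$. The measure $\sigma_T$ on $\mathcal{M}^+_T(R)$ is the Lebesgue measure defined by disintegration: $\int_{(0,\infty)^R}F(l)\,\mathrm{d}^Rl=\int_0^\infty\mathrm{d}T\int_{\mathcal{M}^+_T(R)}\sigma_T(\mathrm{d}l)\,F(l)$ for $F\colon(0,\infty)^R\to\mathbb{R}$ bounded and continuous with compact support (equivalently, $\sigma_T$ is Lebesgue measure in the coordinates $(l_x)_{x\in R\setminus\{x_0\}}$ for any fixed $x_0\in R$; if $|R|=1$ it is the unit mass at the single point). For a matrix $M=(M_{x,y})_{x,y\in\Lambda}$ and $a,b\in R$, $\det^{(R)}_{ab}(M)$ denotes the $(b,a)$ cofactor of the $R\times R$-submatrix of $M$, i.e. the determinant of the matrix $(\mathbf{1}_{x\ne b}M_{x,y}\mathbf{1}_{y\ne a}+\mathbf{1}_{x=b,\,y=a})_{x,y\in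 R}$. $\partial_l$ is the diagonal matrix with $(x,x)$-entry $\partial_{l_x}$ (partial derivative with respect to $l_x$), so $\det^{(R)}_{ab}(M+\partial_l)$ is a linear differential operator with constant coefficients; in the formula for $\rho^{(R)}_{ab}$ it acts on the integral regarded as a function of $l\in(0,\infty)^R$, and the result is then evaluated at $l\in\mathcal{M}^+_T(R)$. *)

theory Defs
  imports "HOL-Probability.Probability"
begin

section \<open>Continuous-time Markov chains\<close>

definition conservative_generator :: "('a \<Rightarrow> 'a \<Rightarrow> real) \<Rightarrow> bool" where
  "conservative_generator A \<longleftrightarrow>
     (\<forall>x y. x \<noteq> y \<longrightarrow> 0 \<le> A x y) \<and> (\<forall>x. ((\<lambda>y. A x y) has_sum 0) UNIV)"

text \<open>
  The family \<open>P a\<close>, \<open>a \<in> \<Lambda>\<close>, of laws of a time-homogeneous Markov chain whose state space \<open>\<Lambda>\<close> is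
  the countable type \<open>'a\<close>; the transition function is \<open>t \<mapsto> P x (X\<^sub>t = y)\<close>, and \<open>A\<close> is its derivative
  at \<open>0\<close>. The process is defined for all times \<open>t \<ge> 0\<close> (the values \<open>X t\<close> with \<open>t < 0\<close> are
  irrelevant), and right-continuity refers to the discrete topology on \<open>\<Lambda>\<close>. Nothing is assumed
  about left limits or about explosion.
\<close>
locale continuous_time_markov_chain =
  fixes A :: "'a :: countable \<Rightarrow> 'a \<Rightarrow> real"
    and P :: "'a \<Rightarrow> 'w measure"
    and X :: "real \<Rightarrow> 'w \<Rightarrow> 'a"
  assumes prob_space: "prob_space (P a)"
    and same_sets: "sets (P a) = sets (P a')"
    and measurable_X: "0 \<le> t \<Longrightarrow> X t \<in> measurable (P a) (count_space UNIV)"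
    and right_continuous:
      "\<omega> \<in> space (P a) \<Longrightarrow> 0 \<le> t \<Longrightarrow> eventually (\<lambda>s. X s \<omega> = X t \<omega>) (at_right t)"
    and start: "AE \<omega> in P a. X 0 \<omega> = a"
    and markov_property:
      "0 \<le> u 0 \<Longrightarrow> (\<And>i. i \<le> n \<Longrightarrow> u i < u (Suc i)) \<Longrightarrow>
         measure (P a) {\<omega> \<in> space (P a). \<forall>i\<le>Suc n. X (u i) \<omega> = x i} =
         measure (P a) {\<omega> \<in> space (P a). \<forall>i\<le>n. X (u i) \<omega> = x i} *
         measure (P (x n)) {\<omega> \<in> space (P (x n)). X (u (Suc n) - u n) \<omega> = x (Suc n)}"
    and generator:
      "((\<lambda>t. measure (P y) {\<omega> \<in> space (P y). X t \<omega> = z}) has_real_derivative A y z)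
         (at 0 within {0..})"

definition local_time :: "(real \<Rightarrow> 'w \<Rightarrow> 'a) \<Rightarrow> real \<Rightarrow> 'w \<Rightarrow> 'a \<Rightarrow> real" where
  "local_time X T \<omega> x = (LINT s:{0..T}|lborel. indicator {x} (X s \<omega>))"

text \<open>
  For a right-continuous chain this is almost surely equal to \<open>{X\<^sub>s \<omega> | 0 \<le> s \<le> T}\<close>: the two sets can
  differ only if the chain jumps exactly at time \<open>T\<close>.
\<close>
definition local_time_range :: "(real \<Rightarrow> 'w \<Rightarrow> 'a) \<Rightarrow> real \<Rightarrow> 'w \<Rightarrow> 'a set" where
  "local_time_range X T \<omega> = {x. local_time X T \<omega> x \<noteq> 0}"


section \<open>Functions of given total mass\<close>

text \<open>Functions on \<open>R\<close> are represented by functions on \<open>'a\<close> that are \<open>undefined\<close> outside \<open>R\<close>.\<close>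

definition mass_simplex :: "'a set \<Rightarrow> real \<Rightarrow> ('a \<Rightarrow> real) set" where
  "mass_simplex R T = {l \<in> R \<rightarrow>\<^sub>E {0<..}. (\<Sum>x\<in>R. l x) = T}"

definition mass_simplex_borel :: "'a set \<Rightarrow> real \<Rightarrow> ('a \<Rightarrow> real) measure" where
  "mass_simplex_borel R T = restrict_space (\<Pi>\<^sub>M x\<in>R. borel) (mass_simplex R T)"

text \<open>
  Lebesgue measure in the coordinates \<open>(l\<^sub>x)\<close>, \<open>x \<in> R - {x0}\<close>, where \<open>x0 \<in> R\<close>. The disintegration
  of Lebesgue measure on \<open>(0,\<infinity>)\<^sup>R\<close> is \<open>simplex_measure_disintegration\<close> below.
\<close>
definition simplex_measure :: "'a set \<Rightarrow> 'a \<Rightarrow> real \<Rightarrow> ('a \<Rightarrow> real) measure" where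
  "simplex_measure R x0 T =
     distr (restrict_space (\<Pi>\<^sub>M x\<in>R - {x0}. lborel)
              {l. (\<forall>x\<in>R - {x0}. 0 < l x) \<and> (\<Sum>x\<in>R - {x0}. l x) < T})
           (mass_simplex_borel R T)
           (\<lambda>l. l(x0 := T - (\<Sum>x\<in>R - {x0}. l x)))"


section \<open>The density\<close>

definition partial_deriv :: "'a \<Rightarrow> (('a \<Rightarrow> real) \<Rightarrow> complex) \<Rightarrow> ('a \<Rightarrow> real) \<Rightarrow> complex" where
  "partial_deriv x f l = vector_derivative (\<lambda>t. f (l(x := t))) (at (l x))"

text \<open>The entries of the operator-valued matrix \<open>- A + \<partial>\<^sub>l\<close>.\<close>
definition generator_diff_op ::
  "('a \<Rightarrow> 'a \<Rightarrow> real) \<Rightarrow> 'a \<Rightarrow> 'a \<Rightarrow> (('a \<Rightarrow> real) \<Rightarrow> complex) \<Rightarrow> ('a \<Rightarrow> real) \<Rightarrow> complex" where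
  "generator_diff_op A x y f l =
     - complex_of_real (A x y) * f l + (if x = y then partial_deriv x f l else 0)"

text \<open>
  The matrix \<open>1\<^bsub>x \<noteq> b\<^esub> M\<^sub>x\<^sub>y 1\<^bsub>y \<noteq> a\<^esub> + 1\<^bsub>x = b, y = a\<^esub>\<close> for operator-valued entries: the scalars \<open>1\<close> and
  \<open>0\<close> become the identity and the zero operator.
\<close>
definition cofactor_matrix ::
  "'a \<Rightarrow> 'a \<Rightarrow> ('a \<Rightarrow> 'a \<Rightarrow> (('a \<Rightarrow> real) \<Rightarrow> complex) \<Rightarrow> ('a \<Rightarrow> real) \<Rightarrow> complex) \<Rightarrow>
   'a \<Rightarrow> 'a \<Rightarrow> (('a \<Rightarrow> real) \<Rightarrow> complex) \<Rightarrow> ('a \<Rightarrow> real) \<Rightarrow> complex" where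
  "cofactor_matrix a b M x y =
     (if x \<noteq> b \<and> y \<noteq> a then M x y
      else if x = b \<and> y = a then (\<lambda>f. f)
      else (\<lambda>f l. 0))"

text \<open>
  Leibniz expansion of the determinant of the matrix above, products of entries being compositions
  of operators. The factors are composed in the order of some enumeration of \<open>R\<close>; the order is
  immaterial for the smooth functions to which the operator is applied, because their partial
  derivatives commute.
\<close>
definition det_op ::
  "'a set \<Rightarrow> 'a \<Rightarrow> 'a \<Rightarrow> ('a \<Rightarrow> 'a \<Rightarrow> (('a \<Rightarrow> real) \<Rightarrow> complex) \<Rightarrow> ('a \<Rightarrow> real) \<Rightarrow> complex) \<Rightarrow>
   (('a \<Rightarrow> real) \<Rightarrow> complex) \<Rightarrow> ('a \<Rightarrow> real) \<Rightarrow> complex" where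
  "det_op R a b M f l =
     (\<Sum>p | p permutes R. of_int (sign p) *
        foldr (\<lambda>x. cofactor_matrix a b M x (p x)) (SOME xs. distinct xs \<and> set xs = R) f l)"

definition angle_integral :: "('a \<Rightarrow> 'a \<Rightarrow> real) \<Rightarrow> 'a set \<Rightarrow> ('a \<Rightarrow> real) \<Rightarrow> complex" where
  "angle_integral A R l =
     (LINT \<theta>|(\<Pi>\<^sub>M x\<in>R. uniform_measure lborel {0..2 * pi}).
        exp (\<Sum>x\<in>R. \<Sum>y\<in>R. complex_of_real (A x y * sqrt (l x) * sqrt (l y)) *
               exp (\<i> * complex_of_real (\<theta> x - \<theta> y))))"

definition local_time_density ::
  "('a \<Rightarrow> 'a \<Rightarrow> real) \<Rightarrow> 'a set \<Rightarrow> 'a \<Rightarrow> 'a \<Rightarrow> ('a \<Rightarrow> real) \<Rightarrow> complex" where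
  "local_time_density A R a b = det_op R a b (generator_diff_op A) (angle_integral A R)"


section \<open>Disintegration of Lebesgue measure\<close>

lemma measurable_simplex_chart:
  fixes R :: "'a set"
  assumes "finite R" "x0 \<in> R"
  shows "(\<lambda>l. l(x0 := T - (\<Sum>x\<in>R - {x0}. l x))) \<in>
    measurable (restrict_space (\<Pi>\<^sub>M x\<in>R - {x0}. lborel)
              {l. (\<forall>x\<in>R - {x0}. 0 < l x) \<and> (\<Sum>x\<in>R - {x0}. l x) < T})
           (mass_simplex_borel R T)"
  unfolding mass_simplex_borel_def
proof (rule measurable_restrict_space2)
  have ins: "insert x0 (R - {x0}) = R" using assms by auto
  have c: "(\<lambda>l. T - (\<Sum>x\<in>R - {x0}. l x)) \<in> borel_measurable (\<Pi>\<^sub>M x\<in>R - {x0}. (lborel :: real measure))"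
    by measurable
  have "(\<lambda>l. l(x0 := T - (\<Sum>x\<in>R - {x0}. l x))) \<in>
     measurable (\<Pi>\<^sub>M x\<in>R - {x0}. lborel) (\<Pi>\<^sub>M x\<in>insert x0 (R - {x0}). borel)"
    by (rule measurable_fun_upd[where J = "R - {x0}"])
       (use c in \<open>auto simp: measurable_cong_sets[OF sets_PiM_cong[OF refl sets_lborel] refl]
          cong: measurable_cong_sets\<close>)
  then show "(\<lambda>l. l(x0 := T - (\<Sum>x\<in>R - {x0}. l x))) \<in>
     measurable (restrict_space (\<Pi>\<^sub>M x\<in>R - {x0}. lborel)
       {l. (\<forall>x\<in>R - {x0}. 0 < l x) \<and> (\<Sum>x\<in>R - {x0}. l x) < T}) (\<Pi>\<^sub>M x\<in>R. borel)"
    unfolding ins by (rule measurable_restrict_space1)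
  show "(\<lambda>l. l(x0 := T - (\<Sum>x\<in>R - {x0}. l x))) \<in>
     space (restrict_space (\<Pi>\<^sub>M x\<in>R - {x0}. lborel)
       {l. (\<forall>x\<in>R - {x0}. 0 < l x) \<and> (\<Sum>x\<in>R - {x0}. l x) < T}) \<rightarrow> mass_simplex R T"
    using assms
    by (auto simp: mass_simplex_def space_restrict_space space_PiM PiE_def extensional_def
        sum.remove[of R x0])
qed

lemma simplex_measure_disintegration:
  fixes R :: "'a set" and F :: "('a \<Rightarrow> real) \<Rightarrow> ennreal"
  assumes "finite R" "x0 \<in> R" and F [measurable]: "F \<in> borel_measurable (\<Pi>\<^sub>M x\<in>R. borel)"
  shows "(\<integral>\<^sup>+l. F l * indicator {l. \<forall>x\<in>R. 0 < l x} l \<partial>(\<Pi>\<^sub>M x\<in>R. lborel)) =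
         (\<integral>\<^sup>+T. (\<integral>\<^sup>+l. F l \<partial>simplex_measure R x0 T) * indicator {0<..} T \<partial>lborel)"
proof -
  define I where "I = R - {x0}"
  have I: "finite I" "x0 \<notin> I" and ins: "insert x0 I = R" using assms by (auto simp: I_def)
  define B where "B = (\<Pi>\<^sub>M x\<in>I. (lborel :: real measure))"
  define S where "S l = (\<Sum>x\<in>I. l x)" for l :: "'a \<Rightarrow> real"
  have sets_B: "sets B = sets (\<Pi>\<^sub>M x\<in>I. (borel :: real measure))"
    unfolding B_def by (rule sets_PiM_cong) auto
  interpret product_sigma_finite "\<lambda>_::'a. lborel :: real measure"
    by unfold_locales
  interpret I: finite_product_sigma_finite "\<lambda>_::'a. lborel :: real measure" I
    by unfold_locales (rule I)
  interpret B: sigma_finite_measure B unfolding B_def by (rule sigma_finite) (rule I)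
  interpret pair_sigma_finite B "lborel :: real measure" ..
  have comp [measurable]: "(\<lambda>l. l x) \<in> borel_measurable B" if "x \<in> I" for x
    using measurable_component_singleton[OF that, of "\<lambda>_. borel"]
    by (simp add: measurable_cong_sets[OF sets_B refl])
  have S [measurable]: "S \<in> borel_measurable B"
    unfolding S_def by measurable
  have pos [measurable]: "Measurable.pred B (\<lambda>l. \<forall>x\<in>I. 0 < l x)"
    by (rule pred_intros_finite) (use I in auto)
  have upd: "(\<lambda>z. (fst z)(x0 := snd z)) \<in> measurable (B \<Otimes>\<^sub>M borel) (\<Pi>\<^sub>M x\<in>R. borel)"
    by (rule measurable_fun_upd[where J = I])
       (use ins sets_B in \<open>auto cong: measurable_cong_sets\<close>)
  have FU: "(\<lambda>z. F ((fst z)(x0 := snd z))) \<in> borel_measurable (B \<Otimes>\<^sub>M borel)"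
    by (rule measurable_compose[OF upd F])
  have FU': "(\<lambda>z. F ((g z)(x0 := h z))) \<in> borel_measurable M"
    if "g \<in> measurable M B" "h \<in> borel_measurable M" for g h and M :: "'c measure"
    using measurable_compose[OF measurable_Pair[OF that] FU] by simp
  have inner: "(\<integral>\<^sup>+l. F l \<partial>simplex_measure R x0 T) =
      (\<integral>\<^sup>+l. F (l(x0 := T - S l)) * indicator {l. (\<forall>x\<in>I. 0 < l x) \<and> S l < T} l \<partial>B)" for T
  proof -
    have "F \<in> borel_measurable (mass_simplex_borel R T)"
      unfolding mass_simplex_borel_def by (rule measurable_restrict_space1) (rule F)
    then show ?thesis
      unfolding simplex_measure_def
      by (subst nn_integral_distr[OF measurable_simplex_chart[OF assms(1,2)]])
         (auto simp: nn_integral_restrict_space I_def[symmetric] B_def[symmetric] S_def[symmetric])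
  qed
  have "(\<integral>\<^sup>+l. F l * indicator {l. \<forall>x\<in>R. 0 < l x} l \<partial>(\<Pi>\<^sub>M x\<in>R. lborel)) =
      (\<integral>\<^sup>+l. (\<integral>\<^sup>+y. F (l(x0 := y)) * indicator {l. \<forall>x\<in>R. 0 < l x} (l(x0 := y)) \<partial>lborel) \<partial>B)"
    unfolding ins[symmetric] B_def
  proof (rule product_nn_integral_insert[OF I])
    have sets_R: "sets (\<Pi>\<^sub>M x\<in>R. (lborel :: real measure)) = sets (\<Pi>\<^sub>M x\<in>R. (borel :: real measure))"
      by (rule sets_PiM_cong) auto
    have "Measurable.pred (\<Pi>\<^sub>M x\<in>R. (borel :: real measure)) (\<lambda>l. \<forall>x\<in>R. 0 < l x)"
      by (rule pred_intros_finite) (use assms(1) in auto)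
    then show "(\<lambda>l. F l * indicator {l. \<forall>x\<in>insert x0 I. 0 < l x} l) \<in>
        borel_measurable (\<Pi>\<^sub>M x\<in>insert x0 I. lborel)"
      by (simp add: ins measurable_cong_sets[OF sets_R refl])
  qed
  also have "\<dots> = (\<integral>\<^sup>+l. (\<integral>\<^sup>+T. F (l(x0 := T - S l)) *
      indicator {l. (\<forall>x\<in>I. 0 < l x) \<and> S l < T} l * indicator {0<..} T \<partial>lborel) \<partial>B)"
  proof (rule nn_integral_cong)
    fix l assume l: "l \<in> space B"
    have nonneg: "0 \<le> S l" if "\<forall>x\<in>I. 0 < l x"
      unfolding S_def using that by (intro sum_nonneg) (auto intro: less_imp_le)
    have upd_l: "(\<lambda>y. F (l(x0 := y))) \<in> borel_measurable borel"
      by (rule FU') (use l in auto)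
    have "(\<integral>\<^sup>+y. F (l(x0 := y)) * indicator {l. \<forall>x\<in>R. 0 < l x} (l(x0 := y)) \<partial>lborel) =
        (\<integral>\<^sup>+y. F (l(x0 := y)) * indicator {y. (\<forall>x\<in>I. 0 < l x) \<and> 0 < y} y \<partial>lborel)"
      using I unfolding ins[symmetric] by (intro nn_integral_cong) (auto simp: indicator_def)
    also have "\<dots> = (\<integral>\<^sup>+T. F (l(x0 := T - S l)) *
        indicator {y. (\<forall>x\<in>I. 0 < l x) \<and> 0 < y} (T - S l) \<partial>lborel)"
      using upd_l by (subst nn_integral_real_affine[where c = 1 and t = "- S l"]) auto
    also have "\<dots> = (\<integral>\<^sup>+T. F (l(x0 := T - S l)) *
        indicator {l. (\<forall>x\<in>I. 0 < l x) \<and> S l < T} l * indicator {0<..} T \<partial>lborel)"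
      by (intro nn_integral_cong) (use nonneg in \<open>auto simp: indicator_def\<close>)
    finally show "(\<integral>\<^sup>+y. F (l(x0 := y)) * indicator {l. \<forall>x\<in>R. 0 < l x} (l(x0 := y)) \<partial>lborel) =
        (\<integral>\<^sup>+T. F (l(x0 := T - S l)) *
          indicator {l. (\<forall>x\<in>I. 0 < l x) \<and> S l < T} l * indicator {0<..} T \<partial>lborel)" .
  qed
  also have "\<dots> = (\<integral>\<^sup>+T. (\<integral>\<^sup>+l. F (l(x0 := T - S l)) *
      indicator {l. (\<forall>x\<in>I. 0 < l x) \<and> S l < T} l * indicator {0<..} T \<partial>B) \<partial>lborel)"
  proof (rule Fubini'[symmetric])
    have "(\<lambda>z. F ((fst z)(x0 := snd z - S (fst z)))) \<in> borel_measurable (B \<Otimes>\<^sub>M lborel)"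
      by (rule FU') measurable
    then show "(\<lambda>(l, T). F (l(x0 := T - S l)) *
        indicator {l. (\<forall>x\<in>I. 0 < l x) \<and> S l < T} l * indicator {0<..} T)
        \<in> borel_measurable (B \<Otimes>\<^sub>M lborel)"
      unfolding split_beta' indicator_def by measurable
  qed
  also have "\<dots> = (\<integral>\<^sup>+T. (\<integral>\<^sup>+l. F l \<partial>simplex_measure R x0 T) * indicator {0<..} T \<partial>lborel)"
    unfolding inner by (intro nn_integral_cong) (auto simp: indicator_def)
  finally show ?thesis .
qed

end

theory Submission
  imports Defs "HOL-Complex_Analysis.Complex_Residues"
begin

text \<open>
  Write \<open>z\<^sub>x = exp (- \<i> \<theta>\<^sub>x)\<close> for a point of the torus, \<open>w\<^sub>x = \<Sum>\<^sub>y A\<^sub>x\<^sub>y z\<^sub>y / z\<^sub>x\<close> and \<open>N = diag w - A\<close>. The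
  angular integral of the density is the torus mean of the exponential of a Laurent polynomial,
  taken at the radii \<open>\<surd>l\<^sub>x\<close>. Circle means of functions holomorphic on the punctured plane do not
  depend on the radius, so it equals the torus mean of \<open>exp (\<Sum>\<^sub>x l\<^sub>x w\<^sub>x)\<close>
  (\<open>angle_integral_eq_torus_mean\<close>). In this form the partial derivative in \<open>l\<^sub>x\<close> multiplies the integrand
  by \<open>w\<^sub>x\<close>, hence the operator-valued cofactor turns into a numerical one, and the density is the torus
  mean of \<open>cof\<^sub>a\<^sub>b(N) exp (\<Sum>\<^sub>x l\<^sub>x w\<^sub>x)\<close> (\<open>local_time_density_eq\<close>).

  Everything then rests on \<open>N z = 0\<close>. Since \<open>N\<close> is singular, \<open>\<Sum>\<^sub>c cof\<^sub>a\<^sub>c(N) N\<^sub>c\<^sub>b = 0\<close>, which says that the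
  densities \<open>\<rho>\<^sub>a\<^sub>c\<close> satisfy \<open>\<partial>\<rho>\<^sub>a\<^sub>b/\<partial>l\<^sub>b = \<Sum>\<^sub>c \<rho>\<^sub>a\<^sub>c A\<^sub>c\<^sub>b\<close> (\<open>cofactor_mean_transport\<close>): while the chain sits in \<open>b\<close>, only
  \<open>l\<^sub>b\<close> grows. At \<open>l\<^sub>b = 0\<close> the integrand is an entire function of \<open>z\<^sub>b\<close>, so the mean value property
  replaces \<open>z\<^sub>b\<close> by \<open>0\<close>, and expanding the cofactor along column \<open>b\<close> expresses the boundary value by the
  densities of the range \<open>R - {b}\<close> (\<open>cofactor_mean_boundary\<close>): the chain has just entered \<open>b\<close> for the
  first time. Integrated over the simplices, these two identities say that the total masses of the
  densities with ranges contained in a finite set \<open>S\<close> solve the forward equation of the chain killed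
  outside \<open>S\<close> (\<open>killed_kernel_forward_equation\<close>). Replacing \<open>A\<close> by \<open>A - diag V\<close> multiplies the densities
  by \<open>exp (- \<Sum>\<^sub>x V\<^sub>x l\<^sub>x)\<close> and leaves \<open>N\<close> unchanged, so the same statement covers their Laplace
  transforms.

  On the side of the process, the chain observed on the grid of mesh \<open>T/n\<close> is governed by powers of a
  matrix that agrees with \<open>1 + (T/n) (A - diag V)\<close> up to \<open>o(1/n)\<close>; these powers converge to the
  solution of the forward equation (\<open>mesh_mean_limit\<close>), and Riemann sums of the right-continuous paths
  converge to the local times, which gives \<open>feynman_kac\<close>. The event of staying in \<open>S\<close> is the disjoint
  union of the events of having range \<open>U\<close>, \<open>U \<subseteq> S\<close>; an induction over \<open>S\<close> separates these
  contributions (\<open>range_mass_eq\<close>). So both sides of the theorem have the same Laplace transform in the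
  local times, and Laplace transforms determine integrals (\<open>laplace_transforms_determine\<close>).
\<close>

section \<open>Determinants and cofactors over a finite index set\<close>

definition set_det :: "'a set \<Rightarrow> ('a \<Rightarrow> 'a \<Rightarrow> complex) \<Rightarrow> complex" where
  "set_det S M = (\<Sum>p | p permutes S. of_int (sign p) * (\<Prod>x\<in>S. M x (p x)))"

text \<open>
  The \<open>(c, a)\<close> cofactor: the Leibniz sum over the permutations that send the deleted row \<open>c\<close> to the
  deleted column \<open>a\<close>, which carries the sign along.
\<close>
definition cofactor :: "'a set \<Rightarrow> 'a \<Rightarrow> 'a \<Rightarrow> ('a \<Rightarrow> 'a \<Rightarrow> complex) \<Rightarrow> complex" where
  "cofactor S a c M =
     (\<Sum>p | p permutes S \<and> p c = a. of_int (sign p) * (\<Prod>x\<in>S - {c}. M x (p x)))"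

text \<open>
  Cramer's rule. A permutation contributes to exactly one of the cofactors on the left, the one of the
  row that it sends to \<open>a\<close>; so the sum is the determinant with column \<open>a\<close> replaced by column \<open>b\<close>.
\<close>
lemma cofactor_cramer:
  assumes "finite S" "a \<in> S"
  shows "(\<Sum>c\<in>S. cofactor S a c M * M c b) = set_det S (\<lambda>x y. M x (if y = a then b else y))"
proof -
  define g where "g p c = of_int (sign p) * (\<Prod>x\<in>S - {c}. M x (p x)) * M c b" for p c
  have "(\<Sum>c\<in>S. cofactor S a c M * M c b) = (\<Sum>c\<in>S. \<Sum>p\<in>{p\<in>{p. p permutes S}. p c = a}. g p c)"
    by (simp add: cofactor_def g_def sum_distrib_right)
  also have "\<dots> = (\<Sum>p\<in>{p. p permutes S}. \<Sum>c\<in>{c\<in>S. p c = a}. g p c)"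
    by (rule sum.swap_restrict) (use assms finite_permutations in auto)
  also have "\<dots> = set_det S (\<lambda>x y. M x (if y = a then b else y))"
    unfolding set_det_def
  proof (rule sum.cong[OF refl])
    fix p assume "p \<in> {p. p permutes S}"
    then have p: "p permutes S" by simp
    define c where "c = inv p a"
    have pc: "p c = a" and cS: "c \<in> S"
      using p assms by (auto simp: c_def permutes_inverses permutes_in_image permutes_inv)
    have uniq: "x = c" if "p x = a" for x
      using that p by (auto simp: c_def permutes_inverses)
    have "{c\<in>S. p c = a} = {c}" using pc cS uniq by blast
    moreover have "(\<Prod>x\<in>S - {c}. M x (if p x = a then b else p x)) = (\<Prod>x\<in>S - {c}. M x (p x))"
    proof (rule prod.cong[OF refl])
      fix x assume "x \<in> S - {c}"
      then have "p x \<noteq> a" using uniq[of x] by blast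
      then show "M x (if p x = a then b else p x) = M x (p x)" by simp
    qed
    then have "(\<Prod>x\<in>S. M x (if p x = a then b else p x)) = M c b * (\<Prod>x\<in>S - {c}. M x (p x))"
      using assms cS pc by (subst prod.remove[of _ c]) auto
    ultimately show "(\<Sum>c\<in>{c\<in>S. p c = a}. g p c) =
        of_int (sign p) * (\<Prod>x\<in>S. M x (if p x = a then b else p x))"
      by (simp add: g_def)
  qed
  finally show ?thesis .
qed

lemma set_det_identical_columns:
  assumes "finite S" "a \<in> S" "b \<in> S" "a \<noteq> b"
  shows "set_det S (\<lambda>x y. M x (if y = a then b else y)) = 0"
proof -
  define f where "f p = of_int (sign p) * (\<Prod>x\<in>S. M x (if p x = a then b else p x))" for p
  define t where "t = Transposition.transpose a b"
  have t: "t permutes S" unfolding t_def by (rule permutes_swap_id) (use assms in auto)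
  have tt: "t \<circ> (t \<circ> p) = p" for p :: "'a \<Rightarrow> 'a" by (auto simp: t_def fun_eq_iff)
  \<comment> \<open>Composition with the transposition of \<open>a\<close> and \<open>b\<close> pairs off terms of opposite sign.\<close>
  have "sum f {p. p permutes S} = (\<Sum>p | p permutes S. f (t \<circ> p))"
    by (rule sum.reindex_bij_witness[where i = "\<lambda>p. t \<circ> p" and j = "\<lambda>p. t \<circ> p"])
       (use t tt in \<open>auto intro: permutes_compose\<close>)
  also have "\<dots> = (\<Sum>p | p permutes S. - f p)"
  proof (rule sum.cong[OF refl])
    fix p assume "p \<in> {p. p permutes S}"
    then have p: "p permutes S" by simp
    have "sign (t \<circ> p) = - sign p"
      using permutes_imp_permutation[OF assms(1) p] permutes_imp_permutation[OF assms(1) t] assms(4)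
      by (subst sign_compose) (auto simp: t_def sign_swap_id)
    then show "f (t \<circ> p) = - f p"
      using assms(4) unfolding f_def
      by (auto simp: t_def Transposition.transpose_def intro!: prod.cong split: if_splits)
  qed
  also have "\<dots> = - sum f {p. p permutes S}" by (rule sum_negf)
  finally show ?thesis by (simp add: set_det_def f_def)
qed

text \<open>
  Off the diagonal of \<open>adj M * M\<close> two columns coincide. The diagonal entry is then forced to vanish
  too, because \<open>adj M * M\<close> annihilates the kernel vector \<open>z\<close>, whose entry at \<open>a\<close> is not zero.
\<close>
lemma cofactor_row_orthogonal:
  assumes "finite S" "a \<in> S" "b \<in> S" "z a \<noteq> 0"
    and ker: "\<And>x. x \<in> S \<Longrightarrow> (\<Sum>y\<in>S. M x y * z y) = 0"
  shows "(\<Sum>c\<in>S. cofactor S a c M * M c b) = 0"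
proof -
  define K where "K b = (\<Sum>c\<in>S. cofactor S a c M * M c b)" for b
  have off: "K b = 0" if "b \<in> S" "b \<noteq> a" for b
    unfolding K_def using assms that by (subst cofactor_cramer) (auto intro: set_det_identical_columns)
  have "(\<Sum>b\<in>S. K b * z b) = (\<Sum>c\<in>S. cofactor S a c M * (\<Sum>b\<in>S. M c b * z b))"
    unfolding K_def sum_distrib_right sum_distrib_left by (subst sum.swap) (simp add: mult.assoc)
  also have "\<dots> = 0" using ker by simp
  also have "(\<Sum>b\<in>S. K b * z b) = K a * z a"
    using assms off by (subst sum.remove[of _ a]) auto
  finally have "K a = 0" using assms by simp
  with off assms(3) show ?thesis unfolding K_def by blast
qed

lemma set_det_eq_0:
  assumes "finite S" "a \<in> S" "z a \<noteq> 0"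
    and "\<And>x. x \<in> S \<Longrightarrow> (\<Sum>y\<in>S. M x y * z y) = 0"
  shows "set_det S M = 0"
proof -
  have "(\<lambda>x y. M x (if y = a then a else y)) = M" by (auto simp: fun_eq_iff)
  then show ?thesis
    using cofactor_cramer[OF assms(1,2), of M a] cofactor_row_orthogonal[OF assms(1,2,2,3,4)] by simp
qed

lemma cofactor_diagonal:
  assumes "finite S" "b \<in> S"
  shows "cofactor S b b M = set_det (S - {b}) M"
proof -
  have "{p. p permutes S \<and> p b = b} = {p. p permutes (S - {b})}"
  proof (intro set_eqI iffI; clarsimp)
    fix p assume p: "p permutes S" "p b = b"
    then show "p permutes (S - {b})" by (auto intro: permutes_superset[OF p(1)])
  next
    fix p assume p: "p permutes (S - {b})"
    show "p permutes S \<and> p b = b"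
      using permutes_subset[OF p Diff_subset] permutes_not_in[OF p, of b] by simp
  qed
  then show ?thesis by (simp add: cofactor_def set_det_def)
qed

text \<open>
  A permutation with \<open>b \<mapsto> a\<close> and \<open>c \<mapsto> b\<close> becomes, after composition with the transposition of \<open>b\<close>
  and \<open>c\<close>, one that fixes \<open>b\<close> and sends \<open>c\<close> to \<open>a\<close>; this costs the sign.
\<close>
lemma cofactor_expand_column:
  assumes "finite S" "a \<in> S" "b \<in> S" "a \<noteq> b"
  shows "cofactor S a b M = - (\<Sum>c\<in>S - {b}. M c b * cofactor (S - {b}) a c M)"
proof -
  define g where "g p = of_int (sign p) * (\<Prod>x\<in>S - {b}. M x (p x))" for p
  define h where "h q c = of_int (sign q) * (\<Prod>x\<in>S - {b} - {c}. M x (q x))" for q c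
  have "cofactor S a b M = sum g {p. p permutes S \<and> p b = a}"
    by (simp add: cofactor_def g_def)
  also have "\<dots> = (\<Sum>p | p permutes S \<and> p b = a. \<Sum>c | c \<in> S - {b} \<and> p c = b. g p)"
  proof (rule sum.cong[OF refl])
    fix p assume "p \<in> {p. p permutes S \<and> p b = a}"
    then have p: "p permutes S" "p b = a" by auto
    have "inv p b \<noteq> b" using p assms by (metis permutes_inverses(1))
    then have "{c. c \<in> S - {b} \<and> p c = b} = {inv p b}"
      using p assms by (auto simp: permutes_inverses permutes_in_image permutes_inv inv_f_eq permutes_inj)
    then show "g p = (\<Sum>c | c \<in> S - {b} \<and> p c = b. g p)" by simp
  qed
  also have "\<dots> = (\<Sum>c\<in>S - {b}. \<Sum>p\<in>{p\<in>{p. p permutes S \<and> p b = a}. p c = b}. g p)"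
    by (rule sum.swap_restrict)
       (use assms finite_subset[OF _ finite_permutations[OF assms(1)], of "{p. p permutes S \<and> p b = a}"] in auto)
  also have "\<dots> = (\<Sum>c\<in>S - {b}. - (M c b * cofactor (S - {b}) a c M))"
  proof (rule sum.cong[OF refl])
    fix c assume c: "c \<in> S - {b}"
    \<comment> \<open>The bijection \<open>p \<mapsto> p \<circ> (b c)\<close> onto the permutations of \<open>S - {b}\<close> that send \<open>c\<close> to \<open>a\<close>.\<close>
    define t where "t = Transposition.transpose b c"
    have t: "t permutes S" unfolding t_def by (rule permutes_swap_id) (use assms c in auto)
    have tt: "(p \<circ> t) \<circ> t = p" for p :: "'a \<Rightarrow> 'a" by (auto simp: t_def fun_eq_iff)
    have "(\<Sum>p\<in>{p\<in>{p. p permutes S \<and> p b = a}. p c = b}. g p) =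
          (\<Sum>q | q permutes (S - {b}) \<and> q c = a. - (M c b * h q c))"
    proof (rule sum.reindex_bij_witness[where i = "\<lambda>q. q \<circ> t" and j = "\<lambda>p. p \<circ> t"])
      fix p assume "p \<in> {p\<in>{p. p permutes S \<and> p b = a}. p c = b}"
      then have p: "p permutes S" "p b = a" "p c = b" by auto
      have q: "p \<circ> t permutes S" using p t by (auto intro: permutes_compose)
      have "(p \<circ> t) b = b" using p by (simp add: t_def)
      then have "p \<circ> t permutes (S - {b})" using q by (auto intro: permutes_superset[OF q])
      then show "p \<circ> t \<in> {q. q permutes (S - {b}) \<and> q c = a}" using p by (simp add: t_def)
      show "p \<circ> t \<circ> t = p" by (rule tt)
      have sg: "sign (p \<circ> t) = - sign p"
        using permutes_imp_permutation[OF assms(1) p(1)] permutes_imp_permutation[OF assms(1) t] c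
        by (subst sign_compose) (auto simp: t_def sign_swap_id)
      have "(\<Prod>x\<in>S - {b}. M x (p x)) = M c b * (\<Prod>x\<in>S - {b} - {c}. M x ((p \<circ> t) x))"
        using c assms p by (subst prod.remove[of _ c]) (auto simp: t_def Transposition.transpose_def intro!: prod.cong)
      then show "- (M c b * h (p \<circ> t) c) = g p"
        unfolding h_def g_def sg by simp
    next
      fix q assume "q \<in> {q. q permutes (S - {b}) \<and> q c = a}"
      then have q: "q permutes (S - {b})" "q c = a" by auto
      have qS: "q permutes S" using q permutes_subset by blast
      have qb: "q b = b" using permutes_not_in[OF q(1), of b] by simp
      show "q \<circ> t \<in> {p\<in>{p. p permutes S \<and> p b = a}. p c = b}"
        using qS qb q t by (auto simp: t_def intro: permutes_compose)
      show "q \<circ> t \<circ> t = q" by (rule tt)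
    qed
    also have "\<dots> = - (M c b * cofactor (S - {b}) a c M)"
      by (simp add: cofactor_def h_def sum_negf sum_distrib_left)
    finally show "(\<Sum>p\<in>{p\<in>{p. p permutes S \<and> p b = a}. p c = b}. g p) =
       - (M c b * cofactor (S - {b}) a c M)" .
  qed
  finally show ?thesis by (simp add: sum_negf)
qed

section \<open>Bounded measurable functions\<close>

text \<open>
  All integrands over the torus and over simplices are built from coordinates by sums, products and
  exponentials, and all the measures are finite; closure of this class under these operations takes
  care of integrability.
\<close>
definition bounded_measurable :: "'b measure \<Rightarrow> ('b \<Rightarrow> complex) \<Rightarrow> bool" where
  "bounded_measurable M f \<longleftrightarrow> f \<in> borel_measurable M \<and> (\<exists>C. \<forall>x\<in>space M. norm (f x) \<le> C)"

named_theorems bm_intros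

lemma bounded_measurableI:
  "f \<in> borel_measurable M \<Longrightarrow> (\<And>x. x \<in> space M \<Longrightarrow> norm (f x) \<le> C) \<Longrightarrow> bounded_measurable M f"
  by (auto simp: bounded_measurable_def)

lemma bounded_measurable_measurable [measurable_dest]:
  "bounded_measurable M f \<Longrightarrow> f \<in> borel_measurable M"
  by (simp add: bounded_measurable_def)

lemma bounded_measurableE:
  assumes "bounded_measurable M f"
  obtains C where "0 \<le> C" "\<And>x. x \<in> space M \<Longrightarrow> norm (f x) \<le> C"
proof -
  from assms obtain C where "\<forall>x\<in>space M. norm (f x) \<le> C" by (auto simp: bounded_measurable_def)
  then have "norm (f x) \<le> max 0 C" if "x \<in> space M" for x using that by fastforce
  then show ?thesis using that[of "max 0 C"] by simp
qed

lemma bm_const [bm_intros]: "bounded_measurable M (\<lambda>_. c)"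
  by (rule bounded_measurableI[where C = "norm c"]) auto

lemma bm_add [bm_intros]:
  assumes "bounded_measurable M f" "bounded_measurable M g"
  shows "bounded_measurable M (\<lambda>x. f x + g x)"
proof -
  obtain C where C: "0 \<le> C" "\<And>x. x \<in> space M \<Longrightarrow> norm (f x) \<le> C" using bounded_measurableE[OF assms(1)] by blast
  obtain D where D: "0 \<le> D" "\<And>x. x \<in> space M \<Longrightarrow> norm (g x) \<le> D" using bounded_measurableE[OF assms(2)] by blast
  note assms[THEN bounded_measurable_measurable, measurable]
  show ?thesis
    by (rule bounded_measurableI[where C = "C + D"]) (measurable, use C D norm_triangle_mono in blast)
qed

lemma bm_mult [bm_intros]:
  assumes "bounded_measurable M f" "bounded_measurable M g"
  shows "bounded_measurable M (\<lambda>x. f x * g x)"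
proof -
  obtain C where C: "0 \<le> C" "\<And>x. x \<in> space M \<Longrightarrow> norm (f x) \<le> C" using bounded_measurableE[OF assms(1)] by blast
  obtain D where D: "0 \<le> D" "\<And>x. x \<in> space M \<Longrightarrow> norm (g x) \<le> D" using bounded_measurableE[OF assms(2)] by blast
  note assms[THEN bounded_measurable_measurable, measurable]
  show ?thesis
    by (rule bounded_measurableI[where C = "C * D"]) (measurable, use C D in \<open>simp add: norm_mult mult_mono\<close>)
qed

lemma bm_uminus [bm_intros]: "bounded_measurable M f \<Longrightarrow> bounded_measurable M (\<lambda>x. - f x)"
  using bm_mult[OF bm_const[of M "-1"]] by simp

lemma bm_diff [bm_intros]:
  "bounded_measurable M f \<Longrightarrow> bounded_measurable M g \<Longrightarrow> bounded_measurable M (\<lambda>x. f x - g x)"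
  using bm_add[of M f "\<lambda>x. - g x"] bm_uminus[of M g] by simp

lemma bm_sum [bm_intros]:
  "(\<And>i. i \<in> I \<Longrightarrow> bounded_measurable M (f i)) \<Longrightarrow> bounded_measurable M (\<lambda>x. \<Sum>i\<in>I. f i x)"
  by (induction I rule: infinite_finite_induct) (auto intro: bm_intros)

lemma bm_prod [bm_intros]:
  "(\<And>i. i \<in> I \<Longrightarrow> bounded_measurable M (f i)) \<Longrightarrow> bounded_measurable M (\<lambda>x. \<Prod>i\<in>I. f i x)"
  by (induction I rule: infinite_finite_induct) (auto intro: bm_intros)

lemma bm_exp [bm_intros]:
  assumes "bounded_measurable M f"
  shows "bounded_measurable M (\<lambda>x. exp (f x))"
proof -
  obtain C where C: "0 \<le> C" "\<And>x. x \<in> space M \<Longrightarrow> norm (f x) \<le> C" using bounded_measurableE[OF assms(1)] by blast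
  note assms[THEN bounded_measurable_measurable, measurable]
  show ?thesis
    by (rule bounded_measurableI[where C = "exp C"])
       (measurable, use C norm_exp order_trans in \<open>metis exp_le_cancel_iff\<close>)
qed

lemma bm_if [bm_intros]:
  "bounded_measurable M f \<Longrightarrow> bounded_measurable M g \<Longrightarrow> bounded_measurable M (\<lambda>x. if P then f x else g x)"
  by (cases P) auto

lemma bm_integrable:
  assumes "finite_measure M" "bounded_measurable M f"
  shows "integrable M f"
proof -
  obtain C where "0 \<le> C" "\<And>x. x \<in> space M \<Longrightarrow> norm (f x) \<le> C" using bounded_measurableE[OF assms(2)] by blast
  then show ?thesis
    using bounded_measurable_measurable[OF assms(2)]
    by (intro finite_measure.integrable_const_bound[OF assms(1), of _ C]) auto
qed

text \<open>
  The remainder \<open>exp (h w) - 1 - h w\<close> is \<open>O(h\<^sup>2)\<close> uniformly in the integration variable because \<open>w\<close> is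
  bounded.
\<close>
lemma has_vector_derivative_integral_exp:
  fixes q w :: "'b \<Rightarrow> complex" and t :: real
  assumes fin: "finite_measure M" and q: "bounded_measurable M q" and w: "bounded_measurable M w"
  shows "((\<lambda>t. \<integral>x. q x * exp (of_real t * w x) \<partial>M) has_vector_derivative
          (\<integral>x. q x * w x * exp (of_real t * w x) \<partial>M)) (at t)"
proof -
  interpret finite_measure M by fact
  define g where "g x = q x * exp (of_real t * w x)" for x
  have g: "bounded_measurable M g" unfolding g_def by (intro bm_intros q w)
  obtain C where C: "0 \<le> C" "\<And>x. x \<in> space M \<Longrightarrow> norm (w x) \<le> C" using bounded_measurableE[OF w] by blast
  obtain D where D: "0 \<le> D" "\<And>x. x \<in> space M \<Longrightarrow> norm (g x) \<le> D" using bounded_measurableE[OF g] by blast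
  define K where "K = D * (exp C * C\<^sup>2) * measure M (space M)"
  define f where "f t = (\<integral>x. q x * exp (of_real t * w x) \<partial>M)" for t :: real
  define f' where "f' = (\<integral>x. q x * w x * exp (of_real t * w x) \<partial>M)"
  have bound: "norm (f (t + h) - f t - h *\<^sub>R f') \<le> K * h\<^sup>2" if h: "\<bar>h\<bar> \<le> 1" for h
  proof -
    let ?r = "\<lambda>x. g x * (exp (of_real h * w x) - (1 + of_real h * w x))"
    have i1: "integrable M (\<lambda>x. q x * exp (of_real s * w x))" for s :: real
      by (intro bm_integrable[OF fin] bm_intros q w)
    have i2: "integrable M (\<lambda>x. of_real h * (q x * w x * exp (of_real t * w x)))"
      by (intro bm_integrable[OF fin] bm_intros q w)
    have ir: "integrable M ?r" by (intro bm_integrable[OF fin] bm_intros g w)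
    have "f (t + h) - f t - h *\<^sub>R f' = (\<integral>x. q x * exp (of_real (t + h) * w x) \<partial>M) -
        (\<integral>x. q x * exp (of_real t * w x) \<partial>M) - (\<integral>x. of_real h * (q x * w x * exp (of_real t * w x)) \<partial>M)"
      unfolding f_def f'_def by (simp add: scaleR_conv_of_real)
    also have "\<dots> = (\<integral>x. ?r x \<partial>M)"
      by (subst Bochner_Integration.integral_diff[symmetric], rule i1, rule i1,
          subst Bochner_Integration.integral_diff[symmetric],
          intro Bochner_Integration.integrable_diff i1, rule i2)
         (simp add: g_def exp_add algebra_simps)
    finally have eq: "f (t + h) - f t - h *\<^sub>R f' = (\<integral>x. ?r x \<partial>M)" .
    have "norm (\<integral>x. ?r x \<partial>M) \<le> (\<integral>x. D * (exp C * C\<^sup>2) * h\<^sup>2 \<partial>M)"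
    proof (rule order_trans[OF integral_norm_bound integral_mono])
      show "integrable M (\<lambda>x. norm (?r x))" using ir by (rule integrable_norm)
      fix x assume x: "x \<in> space M"
      let ?z = "of_real h * w x"
      have "norm (exp ?z - (\<Sum>k\<le>1. ?z ^ k / fact k)) \<le> exp \<bar>Re ?z\<bar> * norm ?z ^ Suc 1 / fact 1"
        by (rule Taylor_exp)
      then have "norm (exp ?z - (1 + ?z)) \<le> exp \<bar>Re ?z\<bar> * (norm ?z)\<^sup>2"
        by (simp add: power2_eq_square)
      also have "\<dots> \<le> exp C * (C\<^sup>2 * h\<^sup>2)"
      proof (rule mult_mono)
        have "\<bar>Re ?z\<bar> \<le> \<bar>h\<bar> * norm (w x)" by (metis abs_Re_le_cmod norm_mult norm_of_real)
        also have "\<dots> \<le> 1 * C" using h C(2)[OF x] by (intro mult_mono) auto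
        finally show "exp \<bar>Re ?z\<bar> \<le> exp C" by simp
        have "(norm (w x))\<^sup>2 \<le> C\<^sup>2" using C(2)[OF x] by (simp add: power_mono)
        then show "(norm ?z)\<^sup>2 \<le> C\<^sup>2 * h\<^sup>2"
          by (subst mult.commute) (simp add: norm_mult power_mult_distrib mult_left_mono)
      qed auto
      finally have "norm (exp ?z - (1 + ?z)) \<le> exp C * (C\<^sup>2 * h\<^sup>2)" .
      then have "norm (g x) * norm (exp ?z - (1 + ?z)) \<le> D * (exp C * (C\<^sup>2 * h\<^sup>2))"
        using D by (intro mult_mono) (auto simp: x)
      then show "norm (?r x) \<le> D * (exp C * C\<^sup>2) * h\<^sup>2" by (simp add: norm_mult mult.assoc)
    qed simp
    then show ?thesis unfolding eq K_def by (simp add: algebra_simps)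
  qed
  have "((\<lambda>h. norm (f (t + h) - f t - h *\<^sub>R f') / norm h) \<longlongrightarrow> 0) (at 0)"
  proof (rule Lim_null_comparison)
    have "\<forall>\<^sub>F h in at 0. \<bar>h\<bar> \<le> (1::real)"
      by (auto simp: eventually_at intro!: exI[of _ 1])
    then show "\<forall>\<^sub>F h in at 0. norm (norm (f (t + h) - f t - h *\<^sub>R f') / norm h) \<le> K * \<bar>h\<bar>"
    proof eventually_elim
      case (elim h)
      show ?case
      proof (cases "h = 0")
        case False
        then show ?thesis using bound[OF elim]
          by (simp add: divide_le_eq power2_eq_square mult.assoc)
      qed (use C D in \<open>simp add: K_def\<close>)
    qed
    show "((\<lambda>h. K * \<bar>h\<bar>) \<longlongrightarrow> 0) (at 0)" by (auto intro!: tendsto_eq_intros)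
  qed
  then have "(f has_vector_derivative f') (at t)"
    unfolding has_vector_derivative_def has_derivative_at
    by (auto intro: bounded_linear_scaleR_left)
  then show ?thesis unfolding f_def f'_def .
qed

section \<open>Means over circles and tori\<close>

abbreviation circle_measure :: "real measure" where
  "circle_measure \<equiv> uniform_measure lborel {0..2 * pi}"

text \<open>
  The sign of the exponent makes the Laurent monomial \<open>z\<^sub>y / z\<^sub>x\<close> equal to \<open>exp (\<i> (\<theta>\<^sub>x - \<theta>\<^sub>y))\<close>.
\<close>
definition phase :: "('a \<Rightarrow> real) \<Rightarrow> 'a \<Rightarrow> complex" where
  "phase \<theta> x = exp (- (\<i> * of_real (\<theta> x)))"

lemma prob_space_circle: "prob_space circle_measure"
  by (rule prob_space_uniform_measure) auto

lemma integral_circle: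
  fixes f :: "real \<Rightarrow> complex"
  assumes [measurable]: "f \<in> borel_measurable borel"
  shows "(\<integral>t. f t \<partial>circle_measure) = (\<integral>t. indicator {0..2*pi} t *\<^sub>R f t \<partial>lborel) / (2 * pi)"
proof -
  have "circle_measure = density lborel (\<lambda>t. ennreal (indicator {0..2*pi} t / (2*pi)))"
    unfolding uniform_measure_def
    by (intro density_cong) (auto simp: divide_ennreal ennreal_indicator[symmetric] simp del: ennreal_indicator split: split_indicator)
  then have "(\<integral>t. f t \<partial>circle_measure) = (\<integral>t. (indicator {0..2*pi} t / (2*pi)) *\<^sub>R f t \<partial>lborel)"
    by (simp add: integral_density)
  also have "\<dots> = (\<integral>t. (1 / (2*pi)) *\<^sub>R (indicator {0..2*pi} t *\<^sub>R f t) \<partial>lborel)"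
    by (intro Bochner_Integration.integral_cong) auto
  also have "\<dots> = (\<integral>t. indicator {0..2*pi} t *\<^sub>R f t \<partial>lborel) / (2 * pi)"
    by (subst integral_scaleR_right) (simp add: scaleR_conv_of_real field_simps)
  finally show ?thesis .
qed

lemma circle_mean_contour:
  fixes r :: real
  assumes "continuous_on (sphere 0 r) g" "0 < r"
  shows "(\<integral>t. g (r * exp (- (\<i> * of_real t))) \<partial>circle_measure) =
         contour_integral (circlepath 0 r) (\<lambda>z. g z / z) / (2 * pi * \<i>)"
proof -
  have cont: "continuous_on A (\<lambda>t. g (r * cis t))" for A
    by (rule continuous_on_compose2[OF assms(1)])
       (use assms(2) in \<open>auto intro!: continuous_intros simp: norm_mult\<close>)
  have cont': "continuous_on A (\<lambda>t. g (r * exp (- (\<i> * of_real t))))" for A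
    by (rule continuous_on_compose2[OF assms(1)])
       (use assms(2) in \<open>auto intro!: continuous_intros simp: norm_mult\<close>)
  have "(\<integral>t. g (r * exp (- (\<i> * of_real t))) \<partial>circle_measure) =
        (\<integral>t. indicator {0..2*pi} t *\<^sub>R g (r * exp (- (\<i> * of_real t))) \<partial>lborel) / (2 * pi)"
    by (rule integral_circle) (use borel_measurable_continuous_onI[OF cont'] in simp)
  \<comment> \<open>The phase runs clockwise; the reflection \<open>2 \<pi> - t\<close> restores the orientation of the circle.\<close>
  also have "(\<integral>t. indicator {0..2*pi} t *\<^sub>R g (r * exp (- (\<i> * of_real t))) \<partial>lborel) =
     (\<integral>t. indicator {0..2*pi} (2*pi + (-1) * t) *\<^sub>R g (r * exp (- (\<i> * of_real (2*pi + (-1) * t)))) \<partial>lborel)"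
    by (subst lborel_integral_real_affine[of "-1" _ "2*pi"]) simp_all
  also have "\<dots> = (LINT t:{0..2*pi}|lborel. g (r * cis t))"
    unfolding set_lebesgue_integral_def
  proof (intro Bochner_Integration.integral_cong refl)
    fix t :: real
    have "exp (- (\<i> * of_real (2*pi + (-1) * t))) = exp (\<i> * of_real t) * exp (- (\<i> * of_real (2*pi)))"
      by (simp add: exp_add[symmetric] algebra_simps)
    also have "exp (- (\<i> * of_real (2*pi))) = 1"
      by (simp add: exp_minus exp_two_pi_i' mult.commute mult.left_commute)
    finally show "indicator {0..2*pi} (2*pi + (-1) * t) *\<^sub>R g (r * exp (- (\<i> * of_real (2*pi + (-1) * t)))) =
        indicator {0..2*pi} t *\<^sub>R g (r * cis t)"
      by (auto simp: cis_conv_exp indicator_def)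
  qed
  also have "\<dots> = integral {0..2*pi} (\<lambda>t. g (r * cis t))"
    by (rule set_borel_integral_eq_integral)
       (use borel_integrable_compact[of "{0..2*pi}", OF _ cont] in \<open>simp add: set_integrable_def scaleR_conv_of_real indicator_scaleR_eq_if\<close>)
  also have "\<dots> = contour_integral (circlepath 0 r) (\<lambda>z. g z / z) / \<i>"
  proof -
    have "contour_integral (circlepath 0 r) (\<lambda>z. g z / z) =
        integral {0..2*pi} (\<lambda>t. g (r * cis t) * \<i>)"
      unfolding circlepath_def using assms(2)
      by (subst contour_integral_part_circlepath_eq) (auto intro!: integral_cong)
    then show ?thesis by (simp add: field_simps)
  qed
  finally show ?thesis by (simp add: field_simps)
qed

text \<open>
  The mean over a circle around \<open>0\<close> is a contour integral of \<open>g z / z\<close>, and concentric circles are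
  homotopic in the punctured plane.
\<close>
lemma circle_mean_radius:
  fixes r :: real
  assumes "g holomorphic_on - {0}" "0 < r"
  shows "(\<integral>t. g (r * exp (- (\<i> * of_real t))) \<partial>circle_measure) =
         (\<integral>t. g (exp (- (\<i> * of_real t))) \<partial>circle_measure)"
proof -
  have cont: "continuous_on (sphere 0 s) g" if "0 < s" for s
    using assms(1) that
    by (intro holomorphic_on_imp_continuous_on holomorphic_on_subset[OF assms(1)]) auto
  have holo: "(\<lambda>z. g z / z) holomorphic_on (UNIV - {0})"
    using assms(1) by (intro holomorphic_intros) (auto simp: Compl_eq_Diff_UNIV)
  have "contour_integral (circlepath 0 r) (\<lambda>z. g z / z) = contour_integral (circlepath 0 1) (\<lambda>z. g z / z)"
  proof (cases "r \<le> 1")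
    case True
    then show ?thesis
      using contour_integral_circlepath_eq(3)[OF open_UNIV holo, of r 1] assms(2) by simp
  next
    case False
    then show ?thesis
      using contour_integral_circlepath_eq(3)[OF open_UNIV holo, of 1 r] by simp
  qed
  then show ?thesis
    using circle_mean_contour[OF cont[OF assms(2)] assms(2)] circle_mean_contour[OF cont[of 1]] by simp
qed

lemma circle_mean_entire:
  assumes "g holomorphic_on UNIV"
  shows "(\<integral>t. g (exp (- (\<i> * of_real t))) \<partial>circle_measure) = g 0"
proof -
  have cont: "continuous_on A g" for A
    using assms holomorphic_on_imp_continuous_on continuous_on_subset by blast
  have "((\<lambda>u. g u / (u - 0)) has_contour_integral (2 * of_real pi * \<i> * g 0)) (circlepath 0 1)"
    by (rule Cauchy_integral_circlepath) (use assms cont holomorphic_on_subset in auto)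
  then have "contour_integral (circlepath 0 1) (\<lambda>z. g z / z) = 2 * of_real pi * \<i> * g 0"
    by (simp add: contour_integral_unique)
  then show ?thesis using circle_mean_contour[OF cont, of 1] by simp
qed

abbreviation torus :: "'a set \<Rightarrow> ('a \<Rightarrow> real) measure" where
  "torus S \<equiv> \<Pi>\<^sub>M x\<in>S. circle_measure"

definition torus_mean :: "'a set \<Rightarrow> (('a \<Rightarrow> complex) \<Rightarrow> complex) \<Rightarrow> complex" where
  "torus_mean S f = (\<integral>\<theta>. f (phase \<theta>) \<partial>torus S)"

lemma product_sigma_finite_circle: "product_sigma_finite (\<lambda>_::'a. circle_measure)"
  unfolding product_sigma_finite_def
  using prob_space_imp_sigma_finite[OF prob_space_circle] by blast

lemma finite_measure_torus: "finite_measure (torus S)"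
proof -
  interpret prob_space "torus S" by (rule prob_space_PiM) (rule prob_space_circle)
  show ?thesis by unfold_locales
qed

lemma norm_phase [simp]: "norm (phase \<theta> x) = 1"
  by (simp add: phase_def)

lemma phase_nonzero [simp]: "phase \<theta> x \<noteq> 0"
  by (simp add: phase_def)

lemma bm_phase_quotient [bm_intros]:
  assumes "x \<in> S" "y \<in> S"
  shows "bounded_measurable (torus S) (\<lambda>\<theta>. phase \<theta> y / phase \<theta> x)"
proof (rule bounded_measurableI[where C = 1])
  have [measurable]: "(\<lambda>\<theta>. \<theta> i) \<in> borel_measurable (torus S)" if "i \<in> S" for i
    using measurable_component_singleton[OF that, of "\<lambda>_. circle_measure"]
    by (simp cong: measurable_cong_sets)
  show "(\<lambda>\<theta>. phase \<theta> y / phase \<theta> x) \<in> borel_measurable (torus S)"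
    unfolding phase_def using assms by measurable
qed (simp add: norm_divide)

lemma phase_upd: "phase (\<theta>(b := t)) = (phase \<theta>)(b := exp (- (\<i> * of_real t)))"
  by (auto simp: phase_def fun_eq_iff)

lemma torus_mean_remove:
  assumes "finite S" "b \<in> S" and f: "bounded_measurable (torus S) (\<lambda>\<theta>. f (phase \<theta>))"
  shows "torus_mean S f =
    torus_mean (S - {b}) (\<lambda>z. \<integral>t. f (z(b := exp (- (\<i> * of_real t)))) \<partial>circle_measure)"
proof -
  have ins: "insert b (S - {b}) = S" using assms by auto
  have "integrable (torus (insert b (S - {b}))) (\<lambda>\<theta>. f (phase \<theta>))"
    unfolding ins by (rule bm_integrable[OF finite_measure_torus f])
  from product_sigma_finite.product_integral_insert[OF product_sigma_finite_circle _ _ this]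
  show ?thesis
    using assms(1) unfolding ins by (simp add: torus_mean_def phase_upd)
qed

text \<open>
  By Fubini's theorem the coordinate \<open>b\<close> can be averaged first, and the mean of an entire function over
  a circle is its value at the centre.
\<close>
lemma torus_mean_entire:
  assumes "finite S" "b \<in> S" and f: "bounded_measurable (torus S) (\<lambda>\<theta>. f (phase \<theta>))"
    and holo: "\<And>z. (\<lambda>\<zeta>. f (z(b := \<zeta>))) holomorphic_on UNIV"
  shows "torus_mean S f = torus_mean (S - {b}) (\<lambda>z. f (z(b := 0)))"
proof -
  have "torus_mean S f =
      torus_mean (S - {b}) (\<lambda>z. \<integral>t. f (z(b := exp (- (\<i> * of_real t)))) \<partial>circle_measure)"
    by (rule torus_mean_remove[OF assms(1,2) f])
  also have "(\<lambda>z. \<integral>t. f (z(b := exp (- (\<i> * of_real t)))) \<partial>circle_measure) = (\<lambda>z. f (z(b := 0)))"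
    using circle_mean_entire[OF holo] by (simp add: fun_eq_iff)
  finally show ?thesis .
qed

lemma torus_mean_scale:
  fixes r :: real
  assumes "finite S" "b \<in> S" "0 < r" and f: "bounded_measurable (torus S) (\<lambda>\<theta>. f (phase \<theta>))"
    and f': "bounded_measurable (torus S) (\<lambda>\<theta>. f ((phase \<theta>)(b := r * phase \<theta> b)))"
    and holo: "\<And>z. (\<lambda>\<zeta>. f (z(b := \<zeta>))) holomorphic_on - {0}"
  shows "torus_mean S (\<lambda>z. f (z(b := r * z b))) = torus_mean S f"
proof -
  have "torus_mean S (\<lambda>z. f (z(b := r * z b))) =
      torus_mean (S - {b}) (\<lambda>z. \<integral>t. f (z(b := r * exp (- (\<i> * of_real t)))) \<partial>circle_measure)"
    using torus_mean_remove[where f = "\<lambda>z. f (z(b := r * z b))", OF assms(1,2) f']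
    by (simp only: fun_upd_upd fun_upd_same)
  also have "\<dots> = torus_mean (S - {b}) (\<lambda>z. \<integral>t. f (z(b := exp (- (\<i> * of_real t)))) \<partial>circle_measure)"
    using circle_mean_radius[OF holo assms(3)] by simp
  also have "\<dots> = torus_mean S f"
    by (rule torus_mean_remove[OF assms(1,2) f, symmetric])
  finally show ?thesis .
qed

lemma torus_mean_cong:
  "(\<And>\<theta>. f (phase \<theta>) = g (phase \<theta>)) \<Longrightarrow> torus_mean S f = torus_mean S g"
  unfolding torus_mean_def by simp

lemma torus_mean_sum:
  assumes "\<And>i. i \<in> I \<Longrightarrow> bounded_measurable (torus S) (\<lambda>\<theta>. f i (phase \<theta>))"
  shows "torus_mean S (\<lambda>z. \<Sum>i\<in>I. f i z) = (\<Sum>i\<in>I. torus_mean S (f i))"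
  unfolding torus_mean_def
  by (rule Bochner_Integration.integral_sum) (intro bm_integrable[OF finite_measure_torus] assms)

lemma torus_mean_mult: "torus_mean S (\<lambda>z. c * f z) = c * torus_mean S f"
  unfolding torus_mean_def by simp

section \<open>The rate matrix on the torus\<close>

text \<open>
  With \<open>z\<^sub>x = exp (- \<i> \<theta>\<^sub>x)\<close>, the exponent of the angular integral at \<open>l = (1, \<dots>, 1)\<close> is \<open>\<Sum>\<^sub>x rate\<^sub>x\<close>; the
  formula makes sense, and is used, also off the torus. A division by \<open>z\<^sub>x = 0\<close> yields \<open>0\<close>, so that
  the rate of \<open>x \<noteq> b\<close> stays an entire function of \<open>z\<^sub>b\<close> whatever the other coordinates are.
\<close>
definition rate :: "'a set \<Rightarrow> ('a \<Rightarrow> 'a \<Rightarrow> real) \<Rightarrow> ('a \<Rightarrow> complex) \<Rightarrow> 'a \<Rightarrow> complex" where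
  "rate S B z x = (\<Sum>y\<in>S. of_real (B x y) * (z y / z x))"

definition rate_matrix ::
  "'a set \<Rightarrow> ('a \<Rightarrow> 'a \<Rightarrow> real) \<Rightarrow> ('a \<Rightarrow> complex) \<Rightarrow> 'a \<Rightarrow> 'a \<Rightarrow> complex" where
  "rate_matrix S B z x y = (if x = y then rate S B z x else 0) - of_real (B x y)"

lemma bm_rate [bm_intros]:
  "x \<in> S \<Longrightarrow> bounded_measurable (torus S) (\<lambda>\<theta>. rate S B (phase \<theta>) x)"
  unfolding rate_def by (intro bm_intros)

lemma bm_rate_matrix [bm_intros]:
  "x \<in> S \<Longrightarrow> bounded_measurable (torus S) (\<lambda>\<theta>. rate_matrix S B (phase \<theta>) x y)"
  unfolding rate_matrix_def by (intro bm_intros)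

lemma bm_cofactor [bm_intros]:
  "bounded_measurable (torus S) (\<lambda>\<theta>. cofactor S a c (rate_matrix S B (phase \<theta>)))"
  unfolding cofactor_def by (intro bm_intros) auto

text \<open>
  The rate was defined so that the row sums weighted with \<open>z\<close> cancel. The vanishing of the determinant
  of the rate matrix, and with it every identity satisfied by the density, comes from this kernel vector.
\<close>
lemma rate_matrix_kernel:
  assumes "finite S" "x \<in> S" "z x \<noteq> 0"
  shows "(\<Sum>y\<in>S. rate_matrix S B z x y * z y) = 0"
proof -
  have "(\<Sum>y\<in>S. rate_matrix S B z x y * z y) =
      (\<Sum>y\<in>S. (if x = y then rate S B z x else 0) * z y) - (\<Sum>y\<in>S. of_real (B x y) * z y)"
    by (simp add: rate_matrix_def algebra_simps sum_subtractf)
  also have "(\<Sum>y\<in>S. (if x = y then rate S B z x else 0) * z y) = rate S B z x * z x"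
    using assms by (simp add: if_distrib[of "\<lambda>u. u * _"] sum.delta' cong: if_cong)
  also have "\<dots> = (\<Sum>y\<in>S. of_real (B x y) * z y)"
    using assms by (simp add: rate_def sum_distrib_right)
  finally show ?thesis by simp
qed

text \<open>
  The relation \<open>adj N * N = 0\<close>, with the diagonal part of \<open>N\<close> moved to the left.
\<close>
lemma cofactor_rate_eigen:
  assumes "finite S" "a \<in> S" "b \<in> S" and z: "\<And>x. z x \<noteq> 0"
  shows "cofactor S a b (rate_matrix S B z) * rate S B z b =
         (\<Sum>c\<in>S. of_real (B c b) * cofactor S a c (rate_matrix S B z))"
proof -
  have "0 = (\<Sum>c\<in>S. cofactor S a c (rate_matrix S B z) * rate_matrix S B z c b)"
    by (rule cofactor_row_orthogonal[OF assms(1-3) z rate_matrix_kernel[OF assms(1) _ z], symmetric])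
  also have "\<dots> = (\<Sum>c\<in>S. cofactor S a c (rate_matrix S B z) * (if c = b then rate S B z c else 0)) -
      (\<Sum>c\<in>S. of_real (B c b) * cofactor S a c (rate_matrix S B z))"
    by (simp add: rate_matrix_def algebra_simps sum_subtractf)
  also have "(\<Sum>c\<in>S. cofactor S a c (rate_matrix S B z) * (if c = b then rate S B z c else 0)) =
      cofactor S a b (rate_matrix S B z) * rate S B z b"
    using assms by (subst sum.remove[of _ b]) auto
  finally show ?thesis by simp
qed

section \<open>The density as a torus mean\<close>

text \<open>
  For radii \<open>c\<^sub>x > 0\<close> consider the mean of the exponential of \<open>\<Sum>\<^sub>x\<^sub>y l\<^sub>x A\<^sub>x\<^sub>y (c\<^sub>y z\<^sub>y) / (c\<^sub>x z\<^sub>x)\<close>. At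
  \<open>c\<^sub>x = \<surd>l\<^sub>x\<close> this is the angular integral with its symmetric weights \<open>\<surd>l\<^sub>x \<surd>l\<^sub>y\<close>, at \<open>c\<^sub>x = 1\<close> it is the
  right-hand side, whose exponent is linear in \<open>l\<close>. The radii are changed one coordinate at a time.
\<close>
lemma angle_integral_eq_torus_mean:
  assumes R: "finite R" and l: "\<And>x. x \<in> R \<Longrightarrow> 0 < l x"
  shows "angle_integral A R l = torus_mean R (\<lambda>z. exp (\<Sum>x\<in>R. of_real (l x) * rate R A z x))"
proof -
  define E where "E c z = exp (\<Sum>x\<in>R. \<Sum>y\<in>R. of_real (l x * A x y * (c y / c x)) * (z y / z x))"
    for c :: "'a \<Rightarrow> real" and z :: "'a \<Rightarrow> complex"
  define c where "c U x = (if x \<in> U then sqrt (l x) else 1)" for U x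
  have bmE: "bounded_measurable (torus R) (\<lambda>\<theta>. E d (phase \<theta>))" for d
    unfolding E_def by (intro bm_intros)
  have holo: "(\<lambda>\<zeta>. E d (z(b := \<zeta>))) holomorphic_on - {0}" for d z b
  proof -
    have "(\<lambda>\<zeta>. (z(b := \<zeta>)) y / (z(b := \<zeta>)) x) holomorphic_on - {0}" for x y
      by (cases "x = b"; cases "y = b") (auto intro!: holomorphic_intros simp del: divide_self_if)
    note quotient = this
    show ?thesis unfolding E_def by (rule quotient | rule holomorphic_intros)+
  qed
  have "torus_mean R (E (c U)) = torus_mean R (E (c {}))" if "U \<subseteq> R" for U
    using finite_subset[OF that R] that
  proof (induction U rule: finite_induct)
    case (insert b U)
    have rpos: "0 < sqrt (l b)" using l insert.prems by simp
    \<comment> \<open>Enlarging \<open>U\<close> by \<open>b\<close> amounts to dilating the circle of \<open>b\<close> by \<open>\<surd>l\<^sub>b\<close>.\<close>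
    have step: "E (c U) (z(b := sqrt (l b) * z b)) = E (c (insert b U)) z"
      for z :: "'a \<Rightarrow> complex"
    proof -
      have "of_real (l x * A x y * (c U y / c U x)) *
            ((z(b := sqrt (l b) * z b)) y / (z(b := sqrt (l b) * z b)) x) =
            of_real (l x * A x y * (c (insert b U) y / c (insert b U) x)) * (z y / z x)" for x y
        using rpos insert.hyps(2) by (cases "x = b"; cases "y = b") (auto simp: c_def)
      then show ?thesis unfolding E_def by (intro arg_cong[where f = exp] sum.cong refl)
    qed
    have "torus_mean R (\<lambda>z. E (c U) (z(b := sqrt (l b) * z b))) = torus_mean R (E (c U))"
    proof (rule torus_mean_scale[OF R _ rpos bmE _ holo])
      show "bounded_measurable (torus R) (\<lambda>\<theta>. E (c U) ((phase \<theta>)(b := sqrt (l b) * phase \<theta> b)))"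
        unfolding step by (rule bmE)
    qed (use insert.prems in auto)
    then show ?case using insert unfolding step by simp
  qed simp
  from this[of R] have eq: "torus_mean R (E (c R)) = torus_mean R (E (c {}))" by simp
  have "angle_integral A R l = torus_mean R (E (c R))"
    unfolding angle_integral_def torus_mean_def
  proof (rule arg_cong[where f = "integral\<^sup>L _"], rule ext)
    fix \<theta> :: "'a \<Rightarrow> real"
    have "complex_of_real (A x y * sqrt (l x) * sqrt (l y)) * exp (\<i> * complex_of_real (\<theta> x - \<theta> y)) =
        of_real (l x * A x y * (c R y / c R x)) * (phase \<theta> y / phase \<theta> x)" if "x \<in> R" "y \<in> R" for x y
    proof -
      have "l x * A x y * (c R y / c R x) = A x y * (l x / sqrt (l x)) * sqrt (l y)"
        using that by (simp add: c_def)
      also have "l x / sqrt (l x) = sqrt (l x)" using l[OF that(1)] by (simp add: real_div_sqrt)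
      finally have "l x * A x y * (c R y / c R x) = A x y * sqrt (l x) * sqrt (l y)" .
      moreover have "phase \<theta> y / phase \<theta> x = exp (\<i> * complex_of_real (\<theta> x - \<theta> y))"
        unfolding phase_def exp_diff[symmetric] by (simp add: algebra_simps)
      ultimately show ?thesis by simp
    qed
    then show "exp (\<Sum>x\<in>R. \<Sum>y\<in>R. complex_of_real (A x y * sqrt (l x) * sqrt (l y)) *
        exp (\<i> * complex_of_real (\<theta> x - \<theta> y))) = E (c R) (phase \<theta>)"
      unfolding E_def by (intro arg_cong[where f = exp] sum.cong refl) auto
  qed
  also have "\<dots> = torus_mean R (\<lambda>z. exp (\<Sum>x\<in>R. of_real (l x) * rate R A z x))"
    unfolding eq
    by (intro torus_mean_cong) (simp add: E_def c_def rate_def sum_distrib_left mult.assoc)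
  finally show ?thesis .
qed

definition exp_mean ::
  "'a set \<Rightarrow> ('a \<Rightarrow> 'a \<Rightarrow> real) \<Rightarrow> (('a \<Rightarrow> complex) \<Rightarrow> complex) \<Rightarrow> ('a \<Rightarrow> real) \<Rightarrow> complex" where
  "exp_mean S B q l = torus_mean S (\<lambda>z. q z * exp (\<Sum>x\<in>S. of_real (l x) * rate S B z x))"

abbreviation bm_torus :: "'a set \<Rightarrow> (('a \<Rightarrow> complex) \<Rightarrow> complex) \<Rightarrow> bool" where
  "bm_torus S q \<equiv> bounded_measurable (torus S) (\<lambda>\<theta>. q (phase \<theta>))"

text \<open>
  Differentiation in \<open>l\<^sub>x\<close> is multiplication of the integrand by the rate of \<open>x\<close>: the operator calculus of
  the density becomes pointwise algebra on the torus.
\<close>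
lemma exp_mean_has_vector_derivative:
  assumes S: "finite S" "x \<in> S" and q: "bm_torus S q"
  shows "((\<lambda>t. exp_mean S B q (l(x := t))) has_vector_derivative
    exp_mean S B (\<lambda>z. q z * rate S B z x) (l(x := u))) (at u)"
proof -
  define r where "r \<theta> = exp (\<Sum>y\<in>S - {x}. of_real (l y) * rate S B (phase \<theta>) y)" for \<theta>
  have r: "bounded_measurable (torus S) r" unfolding r_def by (intro bm_intros) auto
  have split: "exp (\<Sum>y\<in>S. of_real ((l(x := t)) y) * rate S B (phase \<theta>) y) =
      r \<theta> * exp (of_real t * rate S B (phase \<theta>) x)" for t \<theta>
  proof -
    have "(\<Sum>y\<in>S - {x}. of_real ((l(x := t)) y) * rate S B (phase \<theta>) y) =
        (\<Sum>y\<in>S - {x}. of_real (l y) * rate S B (phase \<theta>) y)"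
      by (rule sum.cong) auto
    then show ?thesis
      using S by (subst sum.remove[of _ x]) (auto simp: exp_add r_def mult.commute)
  qed
  have "((\<lambda>t. \<integral>\<theta>. q (phase \<theta>) * r \<theta> * exp (of_real t * rate S B (phase \<theta>) x) \<partial>torus S) has_vector_derivative
      (\<integral>\<theta>. q (phase \<theta>) * r \<theta> * rate S B (phase \<theta>) x * exp (of_real u * rate S B (phase \<theta>) x) \<partial>torus S))
      (at u)"
    by (rule has_vector_derivative_integral_exp[OF finite_measure_torus]) (intro bm_intros q r S)+
  also have "(\<lambda>t. \<integral>\<theta>. q (phase \<theta>) * r \<theta> * exp (of_real t * rate S B (phase \<theta>) x) \<partial>torus S) =
      (\<lambda>t. exp_mean S B q (l(x := t)))"
    unfolding exp_mean_def torus_mean_def split by (simp add: mult.assoc)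
  also have "(\<integral>\<theta>. q (phase \<theta>) * r \<theta> * rate S B (phase \<theta>) x * exp (of_real u * rate S B (phase \<theta>) x) \<partial>torus S) =
      exp_mean S B (\<lambda>z. q z * rate S B z x) (l(x := u))"
    unfolding exp_mean_def torus_mean_def split by (simp add: algebra_simps)
  finally show ?thesis .
qed

text \<open>
  The function \<open>f\<close> need only agree with the mean on the open orthant, as the angular integral does; a
  partial derivative at a point of the orthant does not see anything else.
\<close>
lemma partial_deriv_exp_mean:
  assumes S: "finite S" "x \<in> S" and q: "bm_torus S q"
    and f: "\<And>l. (\<And>y. y \<in> S \<Longrightarrow> 0 < l y) \<Longrightarrow> f l = exp_mean S B q l"
    and l: "\<And>y. y \<in> S \<Longrightarrow> 0 < l y"
  shows "partial_deriv x f l = exp_mean S B (\<lambda>z. q z * rate S B z x) l"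
proof -
  have "((\<lambda>t. exp_mean S B q (l(x := t))) has_vector_derivative
      exp_mean S B (\<lambda>z. q z * rate S B z x) l) (at (l x))"
    using exp_mean_has_vector_derivative[OF S q, of B l "l x"] by simp
  then have "((\<lambda>t. f (l(x := t))) has_vector_derivative exp_mean S B (\<lambda>z. q z * rate S B z x) l) (at (l x))"
    by (rule has_vector_derivative_transform_within_open[where S = "{0<..}"])
       (use l S in \<open>auto intro!: f[symmetric]\<close>)
  then show ?thesis unfolding partial_deriv_def by (rule vector_derivative_at)
qed

lemma exp_mean_add:
  assumes "bm_torus S q" "bm_torus S q'"
  shows "exp_mean S B (\<lambda>z. q z + q' z) l = exp_mean S B q l + exp_mean S B q' l"
  unfolding exp_mean_def torus_mean_def distrib_right
  by (rule Bochner_Integration.integral_add; rule bm_integrable[OF finite_measure_torus]; intro bm_intros assms)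

lemma exp_mean_mult: "exp_mean S B (\<lambda>z. c * q z) l = c * exp_mean S B q l"
  unfolding exp_mean_def by (simp add: mult.assoc torus_mean_mult)

lemma exp_mean_sum:
  assumes "\<And>i. i \<in> I \<Longrightarrow> bm_torus S (q i)"
  shows "exp_mean S B (\<lambda>z. \<Sum>i\<in>I. q i z) l = (\<Sum>i\<in>I. exp_mean S B (q i) l)"
  unfolding exp_mean_def sum_distrib_right
  by (rule torus_mean_sum) (intro bm_intros assms)

lemma exp_mean_cong:
  "(\<And>\<theta>. q (phase \<theta>) = q' (phase \<theta>)) \<Longrightarrow> exp_mean S B q l = exp_mean S B q' l"
  unfolding exp_mean_def by (rule torus_mean_cong) simp

text \<open>
  The scalar counterpart of \<open>cofactor_matrix\<close>.
\<close>
definition cofactor_entry ::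
  "'a \<Rightarrow> 'a \<Rightarrow> 'a set \<Rightarrow> ('a \<Rightarrow> 'a \<Rightarrow> real) \<Rightarrow> ('a \<Rightarrow> complex) \<Rightarrow> 'a \<Rightarrow> 'a \<Rightarrow> complex" where
  "cofactor_entry a b S B z x y =
     (if x \<noteq> b \<and> y \<noteq> a then rate_matrix S B z x y else if x = b \<and> y = a then 1 else 0)"

lemma bm_cofactor_entry [bm_intros]:
  "x \<in> S \<Longrightarrow> bm_torus S (\<lambda>z. cofactor_entry a b S B z x y)"
  unfolding cofactor_entry_def by (intro bm_intros)

lemma bm_prod_list [bm_intros]:
  "(\<And>x. x \<in> set xs \<Longrightarrow> bounded_measurable M (f x)) \<Longrightarrow>
   bounded_measurable M (\<lambda>\<theta>. prod_list (map (\<lambda>x. f x \<theta>) xs))"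
  by (induction xs) (auto intro!: bm_intros)

lemma cofactor_matrix_exp_mean:
  assumes S: "finite S" "x \<in> S" and q: "bm_torus S q"
    and f: "\<And>l. (\<And>y. y \<in> S \<Longrightarrow> 0 < l y) \<Longrightarrow> f l = exp_mean S B q l"
    and l: "\<And>y. y \<in> S \<Longrightarrow> 0 < l y"
  shows "cofactor_matrix a b (generator_diff_op B) x y f l =
         exp_mean S B (\<lambda>z. cofactor_entry a b S B z x y * q z) l"
proof -
  have "generator_diff_op B x y f l = exp_mean S B (\<lambda>z. rate_matrix S B z x y * q z) l"
  proof (cases "x = y")
    case True
    have "exp_mean S B (\<lambda>z. rate_matrix S B z x y * q z) l =
        exp_mean S B (\<lambda>z. - of_real (B x y) * q z + q z * rate S B z x) l"
      using True by (intro exp_mean_cong) (simp add: rate_matrix_def algebra_simps)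
    also have "\<dots> = - of_real (B x y) * exp_mean S B q l + exp_mean S B (\<lambda>z. q z * rate S B z x) l"
      by (subst exp_mean_add, (intro bm_intros q S)+) (simp only: exp_mean_mult)
    finally show ?thesis
      using True partial_deriv_exp_mean[OF S q f l] f[OF l] by (simp add: generator_diff_op_def)
  next
    case False
    then show ?thesis
      using exp_mean_mult[of S B "- of_real (B x y)" q l] f[OF l]
      by (simp add: generator_diff_op_def rate_matrix_def)
  qed
  moreover have "exp_mean S B (\<lambda>z. 0) l = 0" using exp_mean_mult[of S B 0 q l] by simp
  ultimately show ?thesis
    using f[OF l] by (simp add: cofactor_matrix_def cofactor_entry_def)
qed

text \<open>
  Applying the entries one after the other keeps the function in the class of exponential means and
  collects their product in the integrand; the order of the factors becomes immaterial.
\<close>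
lemma foldr_cofactor_matrix:
  assumes S: "finite S" "set xs \<subseteq> S" and q: "bm_torus S q"
    and f: "\<And>l. (\<And>y. y \<in> S \<Longrightarrow> 0 < l y) \<Longrightarrow> f l = exp_mean S B q l"
    and l: "\<And>y. y \<in> S \<Longrightarrow> 0 < l y"
  shows "foldr (\<lambda>x. cofactor_matrix a b (generator_diff_op B) x (p x)) xs f l =
         exp_mean S B (\<lambda>z. (\<Prod>x\<leftarrow>xs. cofactor_entry a b S B z x (p x)) * q z) l"
  using S(2) l
proof (induction xs arbitrary: l)
  case Nil
  then show ?case using f by simp
next
  case (Cons x xs)
  have "bm_torus S (\<lambda>z. (\<Prod>x\<leftarrow>xs. cofactor_entry a b S B z x (p x)) * q z)"
    by (intro bm_intros q) (use Cons.prems in auto)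
  note step = cofactor_matrix_exp_mean[where x = x and y = "p x" and a = a and b = b, OF S(1) _ this Cons.IH Cons.prems(2)]
  show ?case using step Cons.prems(1) by (simp add: mult.assoc)
qed

text \<open>
  Only permutations with \<open>p b = a\<close> survive, since otherwise the entry in row \<open>b\<close> is \<open>0\<close>; for those the
  entry in row \<open>b\<close> is \<open>1\<close> and the other ones are entries of the rate matrix.
\<close>
lemma sum_prod_cofactor_entry:
  assumes "finite S" "b \<in> S"
  shows "(\<Sum>p | p permutes S. of_int (sign p) * (\<Prod>x\<in>S. cofactor_entry a b S B z x (p x))) =
         cofactor S a b (rate_matrix S B z)"
proof -
  have "(\<Sum>p | p permutes S. of_int (sign p) * (\<Prod>x\<in>S. cofactor_entry a b S B z x (p x))) =
      (\<Sum>p | p permutes S \<and> p b = a. of_int (sign p) * (\<Prod>x\<in>S. cofactor_entry a b S B z x (p x)))"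
  proof (rule sum.mono_neutral_right)
    show "\<forall>p\<in>{p. p permutes S} - {p. p permutes S \<and> p b = a}.
        of_int (sign p) * (\<Prod>x\<in>S. cofactor_entry a b S B z x (p x)) = 0"
    proof
      fix p assume "p \<in> {p. p permutes S} - {p. p permutes S \<and> p b = a}"
      then have "cofactor_entry a b S B z b (p b) = 0" by (auto simp: cofactor_entry_def)
      then have "(\<Prod>x\<in>S. cofactor_entry a b S B z x (p x)) = 0" using assms by (metis prod_zero)
      then show "of_int (sign p) * (\<Prod>x\<in>S. cofactor_entry a b S B z x (p x)) = 0" by simp
    qed
  qed (use assms finite_permutations in auto)
  also have "\<dots> = cofactor S a b (rate_matrix S B z)"
    unfolding cofactor_def
  proof (rule sum.cong[OF refl])
    fix p assume "p \<in> {p. p permutes S \<and> p b = a}"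
    then have p: "p permutes S" "p b = a" by auto
    have "(\<Prod>x\<in>S. cofactor_entry a b S B z x (p x)) = (\<Prod>x\<in>S - {b}. cofactor_entry a b S B z x (p x))"
      using assms p by (subst prod.remove[of _ b]) (auto simp: cofactor_entry_def)
    also have "\<dots> = (\<Prod>x\<in>S - {b}. rate_matrix S B z x (p x))"
    proof (rule prod.cong[OF refl])
      fix x assume "x \<in> S - {b}"
      then have "p x \<noteq> a" using p permutes_inj[OF p(1)] by (auto dest: injD)
      then show "cofactor_entry a b S B z x (p x) = rate_matrix S B z x (p x)"
        using \<open>x \<in> S - {b}\<close> by (simp add: cofactor_entry_def)
    qed
    finally show "of_int (sign p) * (\<Prod>x\<in>S. cofactor_entry a b S B z x (p x)) =
        of_int (sign p) * (\<Prod>x\<in>S - {b}. rate_matrix S B z x (p x))" by simp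
  qed
  finally show ?thesis .
qed

text \<open>
  The density in the form that is used from here on. It makes sense for all \<open>l\<close>, in particular on the
  faces of the orthant, and for matrices \<open>B\<close> that arise from a generator by killing.
\<close>
definition cofactor_mean ::
  "('a \<Rightarrow> 'a \<Rightarrow> real) \<Rightarrow> 'a set \<Rightarrow> 'a \<Rightarrow> 'a \<Rightarrow> ('a \<Rightarrow> real) \<Rightarrow> complex" where
  "cofactor_mean B S a b l = exp_mean S B (\<lambda>z. cofactor S a b (rate_matrix S B z)) l"

text \<open>
  Each Leibniz term is a composition of operators applied to the exponential mean with integrand \<open>1\<close>, so
  it multiplies that integrand by the product of its scalar entries, and the sum over the permutations
  is a scalar cofactor.
\<close>
theorem local_time_density_eq:
  assumes R: "finite R" "b \<in> R" and l: "\<And>x. x \<in> R \<Longrightarrow> 0 < l x"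
  shows "local_time_density A R a b l = cofactor_mean A R a b l"
proof -
  define xs where "xs = (SOME xs. distinct xs \<and> set xs = R)"
  have "\<exists>xs. distinct xs \<and> set xs = R" using finite_distinct_list[OF R(1)] by blast
  then have "distinct xs \<and> set xs = R" unfolding xs_def by (rule someI_ex)
  then have xs: "distinct xs" "set xs = R" by auto
  have "foldr (\<lambda>x. cofactor_matrix a b (generator_diff_op A) x (p x)) xs (angle_integral A R) l =
      exp_mean R A (\<lambda>z. (\<Prod>x\<leftarrow>xs. cofactor_entry a b R A z x (p x)) * 1) l" for p
    by (rule foldr_cofactor_matrix[OF R(1) _ bm_const])
       (use xs l R in \<open>auto simp: exp_mean_def intro!: angle_integral_eq_torus_mean\<close>)
  then have fold: "foldr (\<lambda>x. cofactor_matrix a b (generator_diff_op A) x (p x)) xs (angle_integral A R) l =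
      exp_mean R A (\<lambda>z. \<Prod>x\<in>R. cofactor_entry a b R A z x (p x)) l" for p
    using xs by (simp add: prod.distinct_set_conv_list[OF xs(1), symmetric])
  have "local_time_density A R a b l =
      (\<Sum>p | p permutes R. of_int (sign p) * exp_mean R A (\<lambda>z. \<Prod>x\<in>R. cofactor_entry a b R A z x (p x)) l)"
    unfolding local_time_density_def det_op_def xs_def[symmetric] fold ..
  also have "\<dots> = exp_mean R A (\<lambda>z. \<Sum>p | p permutes R.
      of_int (sign p) * (\<Prod>x\<in>R. cofactor_entry a b R A z x (p x))) l"
    unfolding exp_mean_mult[symmetric] by (rule exp_mean_sum[symmetric]) (intro bm_intros)
  also have "\<dots> = cofactor_mean A R a b l"
    unfolding sum_prod_cofactor_entry[OF R] cofactor_mean_def ..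
  finally show ?thesis .
qed

section \<open>Integration over simplices\<close>

abbreviation pi_borel :: "'a set \<Rightarrow> ('a \<Rightarrow> real) measure" where
  "pi_borel S \<equiv> \<Pi>\<^sub>M x\<in>S. borel"

abbreviation pi_lborel :: "'a set \<Rightarrow> ('a \<Rightarrow> real) measure" where
  "pi_lborel S \<equiv> \<Pi>\<^sub>M x\<in>S. lborel"

text \<open>
  The image of the simplex of total mass \<open>T\<close> in the chart that omits one coordinate.
\<close>
definition chart_domain :: "'a set \<Rightarrow> real \<Rightarrow> ('a \<Rightarrow> real) set" where
  "chart_domain J T = {l. (\<forall>x\<in>J. 0 < l x) \<and> (\<Sum>x\<in>J. l x) < T}"

text \<open>
  Measurable and bounded on every cube \<open>[0, T]\<^sup>S\<close>. The class contains the torus means as functions of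
  \<open>l\<close>, and its members are integrable over all the simplices.
\<close>
definition orthant_bounded :: "'a set \<Rightarrow> (('a \<Rightarrow> real) \<Rightarrow> complex) \<Rightarrow> bool" where
  "orthant_bounded S F \<longleftrightarrow> F \<in> borel_measurable (pi_borel S) \<and>
     (\<forall>T. \<exists>C. \<forall>l\<in>space (pi_borel S). (\<forall>x\<in>S. 0 \<le> l x \<and> l x \<le> T) \<longrightarrow> norm (F l) \<le> C)"

lemma sets_PiM_lborel: "sets (pi_lborel J) = sets (pi_borel J)"
  by (rule sets_PiM_cong) auto

lemma space_PiM_lborel: "space (pi_lborel J) = space (pi_borel J)"
  by (simp add: space_PiM)

lemma product_sigma_finite_lborel: "product_sigma_finite (\<lambda>_::'a. lborel :: real measure)"
  by unfold_locales

lemma component_measurable_lborel: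
  "x \<in> J \<Longrightarrow> f \<in> measurable N (pi_lborel J) \<Longrightarrow> (\<lambda>z. f z x) \<in> borel_measurable N"
  using measurable_compose[OF _ measurable_component_singleton[of x J "\<lambda>_. lborel :: real measure"]] by simp

lemma coordinate_le_of_sum:
  assumes "finite J" "\<And>x. x \<in> J \<Longrightarrow> 0 < (l x :: real)" "(\<Sum>x\<in>J. l x) < T" "x \<in> J"
  shows "l x \<le> T"
proof -
  have "l x \<le> (\<Sum>x\<in>J. l x)" using assms by (intro member_le_sum) (auto intro: less_imp_le)
  then show ?thesis using assms(3) by simp
qed

lemma chart_domain_measurable:
  assumes "finite J"
  shows "chart_domain J T \<inter> space (pi_lborel J) \<in> sets (pi_lborel J)"
proof -
  define B where "B = (pi_lborel J)"
  have comp [measurable]: "(\<lambda>l. l x) \<in> borel_measurable B" if "x \<in> J" for x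
    unfolding B_def
    using measurable_component_singleton[OF that, of "\<lambda>_. lborel :: real measure"] by simp
  have [measurable]: "Measurable.pred B (\<lambda>l. \<forall>x\<in>J. 0 < l x)"
    by (rule pred_intros_finite) (use assms in auto)
  have [measurable]: "(\<lambda>l. \<Sum>x\<in>J. l x) \<in> borel_measurable B"
    by measurable
  have "{l \<in> space B. (\<forall>x\<in>J. 0 < l x) \<and> (\<Sum>x\<in>J. l x) < T} \<in> sets B"
    by measurable
  then show ?thesis by (simp add: chart_domain_def Int_def conj_commute B_def)
qed

lemma emeasure_chart_domain:
  assumes "finite J"
  shows "emeasure (pi_lborel J) (chart_domain J T \<inter> space (pi_lborel J)) < \<infinity>"
proof -
  have "chart_domain J T \<inter> space (pi_lborel J) \<subseteq> (\<Pi>\<^sub>E x\<in>J. {0..T})"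
  proof
    fix l assume l: "l \<in> chart_domain J T \<inter> space (pi_lborel J)"
    then have p: "\<And>x. x \<in> J \<Longrightarrow> 0 < l x" and "(\<Sum>x\<in>J. l x) < T" "l \<in> extensional J"
      by (auto simp: chart_domain_def space_PiM PiE_def)
    then show "l \<in> (\<Pi>\<^sub>E x\<in>J. {0..T})"
      using coordinate_le_of_sum[OF assms p] less_imp_le[OF p] by (auto simp: PiE_def)
  qed
  then have "emeasure (pi_lborel J) (chart_domain J T \<inter> space (pi_lborel J)) \<le>
      emeasure (pi_lborel J) (\<Pi>\<^sub>E x\<in>J. {0..T})"
    by (rule emeasure_mono) (use assms in \<open>auto intro!: sets_PiM_I_finite\<close>)
  also have "\<dots> = (\<Prod>x\<in>J. emeasure lborel {0..T})"
    by (rule product_sigma_finite.emeasure_PiM[OF product_sigma_finite_lborel assms]) auto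
  also have "\<dots> < \<infinity>"
    by (cases "0 \<le> T"; cases "card J") (auto simp: emeasure_lborel_Icc_eq ennreal_power ennreal_mult[symmetric])
  finally show ?thesis .
qed

lemma fun_upd_measurable_PiM:
  assumes "f \<in> measurable N (pi_lborel J)" "g \<in> borel_measurable N"
  shows "(\<lambda>z. (f z)(c := g z)) \<in> measurable N (pi_borel (insert c J))"
  by (rule measurable_fun_upd[where J = J])
     (use assms in \<open>auto simp: measurable_cong_sets[OF refl sets_PiM_lborel]\<close>)

lemma orthant_bounded_measurable: "orthant_bounded S F \<Longrightarrow> F \<in> borel_measurable (pi_borel S)"
  by (simp add: orthant_bounded_def)

lemma orthant_boundedE:
  assumes "orthant_bounded S F"
  obtains C where "\<And>l. l \<in> space (pi_borel S) \<Longrightarrow>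
    (\<And>x. x \<in> S \<Longrightarrow> 0 \<le> l x \<and> l x \<le> T) \<Longrightarrow> norm (F l) \<le> C"
proof -
  from assms obtain C where "\<forall>l\<in>space (pi_borel S).
      (\<forall>x\<in>S. 0 \<le> l x \<and> l x \<le> T) \<longrightarrow> norm (F l) \<le> C"
    unfolding orthant_bounded_def by presburger
  then show thesis by (intro that[of C]) simp
qed

lemma integral_simplex_measure:
  fixes F :: "('a \<Rightarrow> real) \<Rightarrow> complex"
  assumes S: "finite S" "c \<in> S" and F: "F \<in> borel_measurable (pi_borel S)"
  shows "(\<integral>l. F l \<partial>simplex_measure S c T) =
    (\<integral>l. indicator (chart_domain (S - {c}) T) l *\<^sub>R F (l(c := T - (\<Sum>x\<in>S - {c}. l x)))
       \<partial>(pi_lborel (S - {c})))"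
proof -
  have "F \<in> borel_measurable (mass_simplex_borel S T)"
    unfolding mass_simplex_borel_def by (rule measurable_restrict_space1) (rule F)
  then show ?thesis
    unfolding simplex_measure_def chart_domain_def
    by (subst integral_distr[OF measurable_simplex_chart[OF S]], assumption,
        subst integral_restrict_space)
       (use chart_domain_measurable[of "S - {c}" T] S in \<open>auto simp: chart_domain_def\<close>)
qed

lemma integrable_chart:
  fixes F :: "('a \<Rightarrow> real) \<Rightarrow> complex"
  assumes J: "finite J" and m: "F \<in> borel_measurable (pi_lborel J)"
    and b: "\<And>l. l \<in> chart_domain J T \<Longrightarrow> l \<in> space (pi_borel J) \<Longrightarrow> norm (F l) \<le> C"
  shows "integrable (pi_lborel J) (\<lambda>l. indicator (chart_domain J T) l *\<^sub>R F l)"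
proof -
  have "integrable (pi_lborel J)
      (\<lambda>l. indicator (chart_domain J T \<inter> space (pi_lborel J)) l *\<^sub>R F l)"
    by (rule integrableI_bounded_set_indicator[where B = C, OF chart_domain_measurable[OF J] m emeasure_chart_domain[OF J]],
        rule AE_I2) (simp add: space_PiM_lborel b)
  then show ?thesis
    by (subst Bochner_Integration.integrable_cong[OF refl,
          where g = "\<lambda>l. indicator (chart_domain J T \<inter> space (pi_lborel J)) l *\<^sub>R F l"])
       (auto simp: indicator_def)
qed

lemma integrable_chart_orthant:
  assumes J: "finite J" and F: "orthant_bounded J F"
  shows "integrable (pi_lborel J) (\<lambda>l. indicator (chart_domain J T) l *\<^sub>R F l)"
proof -
  obtain C where C: "\<And>l. l \<in> space (pi_borel J) \<Longrightarrow>
      (\<And>x. x \<in> J \<Longrightarrow> 0 \<le> l x \<and> l x \<le> T) \<Longrightarrow> norm (F l) \<le> C"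
    using orthant_boundedE[OF F] by blast
  show ?thesis
  proof (rule integrable_chart[OF J])
    show "F \<in> borel_measurable (pi_lborel J)"
      using orthant_bounded_measurable[OF F] by (simp add: measurable_cong_sets[OF sets_PiM_lborel refl])
    fix l assume l: "l \<in> chart_domain J T" "l \<in> space (pi_borel J)"
    have pos: "\<And>x. x \<in> J \<Longrightarrow> 0 < l x" and lt: "(\<Sum>x\<in>J. l x) < T"
      using l(1) by (auto simp: chart_domain_def)
    show "norm (F l) \<le> C"
      by (rule C[OF l(2)]) (use coordinate_le_of_sum[OF J pos lt] less_imp_le[OF pos] in blast)
  qed
qed

lemma finite_measure_simplex:
  assumes S: "finite S" "c \<in> S"
  shows "finite_measure (simplex_measure S c T)"
proof -
  have "space (restrict_space (pi_lborel (S - {c})) (chart_domain (S - {c}) T)) =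
      chart_domain (S - {c}) T \<inter> space (pi_lborel (S - {c}))"
    by (simp add: space_restrict_space)
  moreover have "emeasure (restrict_space (pi_lborel (S - {c})) (chart_domain (S - {c}) T))
      (chart_domain (S - {c}) T \<inter> space (pi_lborel (S - {c}))) < \<infinity>"
    using emeasure_chart_domain[of "S - {c}" T] chart_domain_measurable[of "S - {c}" T] S
    by (subst emeasure_restrict_space) auto
  ultimately have "finite_measure (restrict_space (pi_lborel (S - {c})) (chart_domain (S - {c}) T))"
    by (intro finite_measureI) simp
  then show ?thesis
    unfolding simplex_measure_def chart_domain_def
    by (rule finite_measure.finite_measure_distr[OF _ measurable_simplex_chart[OF S]])
qed

lemma space_simplex_measure: "space (simplex_measure S c T) = mass_simplex S T"
  by (auto simp: simplex_measure_def mass_simplex_borel_def space_restrict_space space_PiM mass_simplex_def)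

lemma sets_simplex_measure: "sets (simplex_measure S c T) = sets (mass_simplex_borel S T)"
  by (simp add: simplex_measure_def)

lemma mass_simplex_le:
  assumes "finite S" "l \<in> mass_simplex S T" "x \<in> S"
  shows "0 \<le> l x \<and> l x \<le> T"
proof -
  have p: "0 < l x" if "x \<in> S" for x using assms(2) that by (auto simp: mass_simplex_def)
  have "l x \<le> (\<Sum>x\<in>S. l x)" using assms p by (intro member_le_sum) (auto intro: less_imp_le)
  then show ?thesis using assms p[OF assms(3)] by (simp add: mass_simplex_def)
qed

lemma bm_simplex:
  assumes "finite S" "orthant_bounded S F"
  shows "bounded_measurable (simplex_measure S c T) F"
proof -
  obtain C where C: "\<And>l. l \<in> space (pi_borel S) \<Longrightarrow>
    (\<And>x. x \<in> S \<Longrightarrow> 0 \<le> l x \<and> l x \<le> T) \<Longrightarrow> norm (F l) \<le> C"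
    using orthant_boundedE[OF assms(2)] by blast
  show ?thesis
  proof (rule bounded_measurableI[where C = C])
    show "F \<in> borel_measurable (simplex_measure S c T)"
      unfolding measurable_cong_sets[OF sets_simplex_measure refl] mass_simplex_borel_def
      by (rule measurable_restrict_space1) (rule orthant_bounded_measurable[OF assms(2)])
    fix l assume "l \<in> space (simplex_measure S c T)"
    then have l: "l \<in> mass_simplex S T" by (simp add: space_simplex_measure)
    then show "norm (F l) \<le> C"
      by (intro C) (use mass_simplex_le[OF assms(1)] in \<open>auto simp: mass_simplex_def space_PiM PiE_def\<close>)
  qed
qed

lemma sum_pos_coordinates:
  assumes "finite J" "\<And>x. x \<in> J \<Longrightarrow> 0 < (l x :: real)"
  shows "0 \<le> (\<Sum>x\<in>J. l x)"
  using assms by (intro sum_nonneg) (auto intro: less_imp_le)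

lemma chart_domain_insert:
  assumes "finite J" "b \<notin> J"
  shows "l(b := t) \<in> chart_domain (insert b J) T \<longleftrightarrow>
    (\<forall>x\<in>J. 0 < l x) \<and> 0 < t \<and> t + (\<Sum>x\<in>J. l x) < T"
proof -
  have "(\<Sum>x\<in>J. (l(b := t)) x) = (\<Sum>x\<in>J. l x)" using assms by (intro sum.cong) auto
  then show ?thesis using assms by (auto simp: chart_domain_def)
qed

lemma sum_upd_notin: "b \<notin> J \<Longrightarrow> (\<Sum>x\<in>J. (l(b := t)) x) = (\<Sum>x\<in>J. l x)"
  by (intro sum.cong) auto

lemma orthant_bounded_shift:
  assumes K: "finite K" "c \<notin> K" and F: "orthant_bounded (insert c K) F"
  obtains C where "\<And>l s. l \<in> space (pi_borel K) \<Longrightarrow> \<forall>x\<in>K. 0 < l x \<Longrightarrow>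
    (\<Sum>x\<in>K. l x) < s \<Longrightarrow> s \<le> T \<Longrightarrow> norm (F (l(c := s - (\<Sum>x\<in>K. l x)))) \<le> C"
proof -
  obtain C where C: "\<And>l. l \<in> space (pi_borel (insert c K)) \<Longrightarrow>
      (\<And>x. x \<in> insert c K \<Longrightarrow> 0 \<le> l x \<and> l x \<le> T) \<Longrightarrow> norm (F l) \<le> C"
    using orthant_boundedE[OF F] by blast
  show thesis
  proof (rule that[of C], rule C)
    fix l :: "'a \<Rightarrow> real" and s
    assume l: "l \<in> space (pi_borel K)" "\<forall>x\<in>K. 0 < l x"
      and s: "(\<Sum>x\<in>K. l x) < s" "s \<le> T"
    show "l(c := s - (\<Sum>x\<in>K. l x)) \<in> space (pi_borel (insert c K))"
      using l(1) by (auto simp: space_PiM PiE_def extensional_def)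
    fix x assume x: "x \<in> insert c K"
    have pos: "\<And>y. y \<in> K \<Longrightarrow> 0 < l y" using l(2) by blast
    have sum: "0 \<le> (\<Sum>x\<in>K. l x)" by (rule sum_pos_coordinates[OF K(1) pos])
    show "0 \<le> (l(c := s - (\<Sum>x\<in>K. l x))) x \<and> (l(c := s - (\<Sum>x\<in>K. l x))) x \<le> T"
    proof (cases "x = c")
      case True
      then show ?thesis using s sum by simp
    next
      case False
      then have "x \<in> K" using x by simp
      then show ?thesis
        using False coordinate_le_of_sum[OF K(1) pos s(1)] s(2) less_imp_le[OF pos] by fastforce
    qed
  qed
qed

text \<open>
  Let \<open>s\<close> be the mass of the coordinates other than \<open>b\<close> and \<open>c\<close>. For fixed values of these, the two
  charts parametrise the same segment by \<open>l\<^sub>b\<close> and by \<open>l\<^sub>c = T - s - l\<^sub>b\<close>.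
\<close>
lemma integral_simplex_chart_change:
  assumes S: "finite S" "b \<in> S" "c \<in> S" and F: "orthant_bounded S F"
  shows "(\<integral>l. F l \<partial>simplex_measure S b T) = (\<integral>l. F l \<partial>simplex_measure S c T)"
proof (cases "b = c")
  case False
  define J where "J = S - {b} - {c}"
  have J: "finite J" "b \<notin> J" "c \<notin> J" "S - {c} = insert b J" "S - {b} = insert c J"
    using S False by (auto simp: J_def)
  have expand: "(\<integral>l. F l \<partial>simplex_measure S c T) =
      (\<integral>l. (\<integral>t. indicator {t. (\<forall>x\<in>J. 0 < l x) \<and> 0 < t \<and> t + (\<Sum>x\<in>J. l x) < T} t *\<^sub>R
         F (l(b := t, c := T - (t + (\<Sum>x\<in>J. l x)))) \<partial>lborel) \<partial>(pi_lborel J))"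
    if bc: "b \<noteq> c" "b \<in> S" "c \<in> S" "b \<notin> J" "c \<notin> J" "S - {c} = insert b J" for b c
  proof -
    have ins: "insert c (insert b J) = S" using bc by auto
    let ?f = "\<lambda>l. indicator (chart_domain (insert b J) T) l *\<^sub>R F (l(c := T - (\<Sum>x\<in>insert b J. l x)))"
    have bJ: "finite (insert b J)" "c \<notin> insert b J" using J bc by auto
    obtain C where C: "\<And>l s. l \<in> space (pi_borel (insert b J)) \<Longrightarrow> \<forall>x\<in>insert b J. 0 < l x \<Longrightarrow>
        (\<Sum>x\<in>insert b J. l x) < s \<Longrightarrow> s \<le> T \<Longrightarrow> norm (F (l(c := s - (\<Sum>x\<in>insert b J. l x)))) \<le> C"
      using orthant_bounded_shift[OF bJ F[folded ins]] by blast
    have "integrable (pi_lborel (insert b J)) ?f"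
    proof (rule integrable_chart[OF bJ(1)])
      have "(\<lambda>l. l(c := T - (\<Sum>x\<in>insert b J. l x))) \<in>
          measurable (pi_lborel (insert b J)) (pi_borel (insert c (insert b J)))"
        by (rule fun_upd_measurable_PiM)
           (auto intro!: borel_measurable_diff borel_measurable_sum component_measurable_lborel)
      then show "(\<lambda>l. F (l(c := T - (\<Sum>x\<in>insert b J. l x)))) \<in> borel_measurable (pi_lborel (insert b J))"
        unfolding ins by (rule measurable_compose[OF _ orthant_bounded_measurable[OF F]])
      show "norm (F (l(c := T - (\<Sum>x\<in>insert b J. l x)))) \<le> C"
        if "l \<in> chart_domain (insert b J) T" "l \<in> space (pi_borel (insert b J))" for l
        by (rule C) (use that in \<open>auto simp: chart_domain_def\<close>)
    qed
    note fubini = product_sigma_finite.product_integral_insert[OF product_sigma_finite_lborel J(1) bc(4) this]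
    have sum: "(\<Sum>x\<in>insert b J. (l(b := t)) x) = t + (\<Sum>x\<in>J. l x)" for l t
      by (simp only: sum.insert[OF J(1) bc(4)] sum_upd_notin[OF bc(4)] fun_upd_same)
    have ind: "indicator (chart_domain (insert b J) T) (l(b := t)) =
        (indicator {t. (\<forall>x\<in>J. 0 < l x) \<and> 0 < t \<and> t + (\<Sum>x\<in>J. l x) < T} t :: real)" for l t
      unfolding indicator_def chart_domain_insert[OF J(1) bc(4)] by simp
    show ?thesis
      unfolding integral_simplex_measure[OF S(1) bc(3) orthant_bounded_measurable[OF F]] bc(6) fubini
        sum ind ..
  qed
  have "(\<integral>l. F l \<partial>simplex_measure S c T) =
      (\<integral>l. (\<integral>t. indicator {t. (\<forall>x\<in>J. 0 < l x) \<and> 0 < t \<and> t + (\<Sum>x\<in>J. l x) < T} t *\<^sub>R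
         F (l(b := t, c := T - (t + (\<Sum>x\<in>J. l x)))) \<partial>lborel) \<partial>(pi_lborel J))"
    by (rule expand) (use J S False in auto)
  also have "\<dots> = (\<integral>l. (\<integral>t. indicator {t. (\<forall>x\<in>J. 0 < l x) \<and> 0 < t \<and> t + (\<Sum>x\<in>J. l x) < T} t *\<^sub>R
         F (l(c := t, b := T - (t + (\<Sum>x\<in>J. l x)))) \<partial>lborel) \<partial>(pi_lborel J))"
  proof (rule Bochner_Integration.integral_cong[OF refl])
    fix l :: "'a \<Rightarrow> real"
    let ?s = "\<Sum>x\<in>J. l x"
    let ?h = "\<lambda>t. indicator {t. (\<forall>x\<in>J. 0 < l x) \<and> 0 < t \<and> t + ?s < T} t *\<^sub>R F (l(b := t, c := T - (t + ?s)))"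
    have "(\<integral>t. ?h t \<partial>lborel) = (\<integral>t. ?h ((T - ?s) + (-1) * t) \<partial>lborel)"
      by (subst lborel_integral_real_affine[of "-1" _ "T - ?s"]) simp_all
    also have "\<dots> = (\<integral>t. indicator {t. (\<forall>x\<in>J. 0 < l x) \<and> 0 < t \<and> t + ?s < T} t *\<^sub>R
        F (l(c := t, b := T - (t + ?s))) \<partial>lborel)"
    proof (rule Bochner_Integration.integral_cong[OF refl])
      fix t
      have "T - ((T - ?s) + (-1) * t + ?s) = t" "(T - ?s) + (-1) * t = T - (t + ?s)" by auto
      then show "?h ((T - ?s) + (-1) * t) = indicator {t. (\<forall>x\<in>J. 0 < l x) \<and> 0 < t \<and> t + ?s < T} t *\<^sub>R
        F (l(c := t, b := T - (t + ?s)))"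
        using fun_upd_twist[OF False, of l] by (auto simp: indicator_def algebra_simps)
    qed
    finally show "(\<integral>t. ?h t \<partial>lborel) = (\<integral>t. indicator {t. (\<forall>x\<in>J. 0 < l x) \<and> 0 < t \<and> t + ?s < T} t *\<^sub>R
        F (l(c := t, b := T - (t + ?s))) \<partial>lborel)" .
  qed
  also have "\<dots> = (\<integral>l. F l \<partial>simplex_measure S b T)"
    by (rule expand[symmetric]) (use J S False in auto)
  finally show ?thesis ..
qed simp

lemma measurable_chart_pair:
  assumes F: "orthant_bounded (insert c K) F"
  shows "(\<lambda>(l, s). F (l(c := s - (\<Sum>x\<in>K. l x)))) \<in>
    borel_measurable ((pi_lborel K) \<Otimes>\<^sub>M lborel)"
proof -
  have "(\<lambda>z. (fst z)(c := snd z - (\<Sum>x\<in>K. fst z x))) \<in>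
      measurable ((pi_lborel K) \<Otimes>\<^sub>M (lborel :: real measure)) (pi_borel (insert c K))"
  proof (rule fun_upd_measurable_PiM)
    show "fst \<in> measurable ((pi_lborel K) \<Otimes>\<^sub>M (lborel :: real measure)) (pi_lborel K)"
      by (rule measurable_fst)
    show "(\<lambda>z. snd z - (\<Sum>x\<in>K. fst z x)) \<in> borel_measurable ((pi_lborel K) \<Otimes>\<^sub>M (lborel :: real measure))"
    proof (intro borel_measurable_diff borel_measurable_sum)
      show "snd \<in> borel_measurable ((pi_lborel K) \<Otimes>\<^sub>M (lborel :: real measure))"
        using measurable_snd[of "\<Pi>\<^sub>M x\<in>K. (lborel :: real measure)" "lborel :: real measure"] by simp
      fix x assume "x \<in> K"
      from measurable_compose[OF measurable_fst measurable_component_singleton[OF this, where M = "\<lambda>_. lborel :: real measure"]]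
      show "(\<lambda>z. fst z x) \<in> borel_measurable ((pi_lborel K) \<Otimes>\<^sub>M (lborel :: real measure))"
        by simp
    qed
  qed
  from measurable_compose[OF this orthant_bounded_measurable[OF F]]
  show ?thesis by (simp add: split_beta')
qed

text \<open>
  Fubini's theorem on the set of pairs of a point \<open>l\<close> with positive coordinates and a time \<open>s\<close> between
  its total mass and \<open>T\<close>. For fixed \<open>s\<close> this is a chart domain.
\<close>
lemma chart_fubini:
  fixes f :: "('a \<Rightarrow> real) \<Rightarrow> real \<Rightarrow> complex"
  assumes K: "finite K"
    and m: "(\<lambda>(l, s). f l s) \<in> borel_measurable ((pi_lborel K) \<Otimes>\<^sub>M lborel)"
    and b: "\<And>l s. l \<in> space (pi_borel K) \<Longrightarrow> \<forall>x\<in>K. 0 < l x \<Longrightarrow>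
      (\<Sum>x\<in>K. l x) < s \<Longrightarrow> s \<le> T \<Longrightarrow> norm (f l s) \<le> C"
  defines "D \<equiv> \<lambda>l. {s. (\<forall>x\<in>K. 0 < l x) \<and> (\<Sum>x\<in>K. l x) < s \<and> s < T}"
  shows "(\<integral>l. (\<integral>s. indicator (D l) s *\<^sub>R f l s \<partial>lborel) \<partial>(pi_lborel K)) =
      (LINT s:{0<..<T}|lborel. (\<integral>l. indicator (chart_domain K s) l *\<^sub>R f l s \<partial>(pi_lborel K)))"
    and "integrable (pi_lborel K) (\<lambda>l. \<integral>s. indicator (D l) s *\<^sub>R f l s \<partial>lborel)"
    and "set_integrable lborel {0<..<T} (\<lambda>s. \<integral>l. indicator (chart_domain K s) l *\<^sub>R f l s \<partial>(pi_lborel K))"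
proof -
  define B where "B = (pi_lborel K)"
  interpret product_sigma_finite "\<lambda>_::'a. lborel :: real measure" by (rule product_sigma_finite_lborel)
  interpret B: sigma_finite_measure B unfolding B_def by (rule sigma_finite) (rule K)
  interpret pair_sigma_finite B "lborel :: real measure" ..
  define A where "A = {z \<in> space (B \<Otimes>\<^sub>M (lborel :: real measure)). snd z \<in> D (fst z)}"
  have sum0: "0 \<le> (\<Sum>x\<in>K. l x)" if "\<forall>x\<in>K. 0 < l x" for l :: "'a \<Rightarrow> real"
    using K that by (intro sum_pos_coordinates) auto
  let ?BL = "B \<Otimes>\<^sub>M (lborel :: real measure)"
  have comp: "(\<lambda>z. fst z x) \<in> borel_measurable ?BL" if "x \<in> K" for x
    unfolding B_def
    using measurable_compose[OF measurable_fst measurable_component_singleton[OF that, where M = "\<lambda>_. lborel :: real measure"]]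
    by simp
  have snd: "snd \<in> borel_measurable ?BL"
    using measurable_snd[of B "lborel :: real measure"] by simp
  have "Measurable.pred ?BL (\<lambda>z. \<forall>x\<in>K. 0 < fst z x)"
    by (rule pred_intros_finite[OF K]) (use comp borel_measurable_pred_less[OF borel_measurable_const comp] in auto)
  moreover have "Measurable.pred ?BL (\<lambda>z. (\<Sum>x\<in>K. fst z x) < snd z)"
    by (rule borel_measurable_pred_less[OF borel_measurable_sum[OF comp] snd])
  moreover have "Measurable.pred ?BL (\<lambda>z. snd z < T)"
    by (rule borel_measurable_pred_less[OF snd borel_measurable_const])
  ultimately have "Measurable.pred ?BL (\<lambda>z. (\<forall>x\<in>K. 0 < fst z x) \<and> (\<Sum>x\<in>K. fst z x) < snd z \<and> snd z < T)"
    by (intro pred_intros_logic)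
  then have A: "A \<in> sets ?BL"
    unfolding A_def D_def mem_Collect_eq by (rule predE)
  have "emeasure (B \<Otimes>\<^sub>M lborel) A \<le>
      emeasure (B \<Otimes>\<^sub>M lborel) ((chart_domain K T \<inter> space B) \<times> {0..T})"
  proof (rule emeasure_mono)
    show "A \<subseteq> (chart_domain K T \<inter> space B) \<times> {0..T}"
    proof
      fix z assume "z \<in> A"
      then have "fst z \<in> space B" and pos: "\<forall>x\<in>K. 0 < fst z x"
        and lt: "(\<Sum>x\<in>K. fst z x) < snd z" "snd z < T"
        by (auto simp: A_def D_def space_pair_measure)
      moreover have "fst z \<in> chart_domain K T" using pos lt by (simp add: chart_domain_def)
      moreover have "snd z \<in> {0..T}" using sum0[OF pos] lt by simp
      ultimately show "z \<in> (chart_domain K T \<inter> space B) \<times> {0..T}"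
        by (simp add: mem_Times_iff)
    qed
    show "(chart_domain K T \<inter> space B) \<times> {0..T} \<in> sets (B \<Otimes>\<^sub>M lborel)"
      using chart_domain_measurable[OF K] by (auto simp: B_def)
  qed
  also have "\<dots> = emeasure B (chart_domain K T \<inter> space B) * emeasure lborel {0..T}"
    using chart_domain_measurable[OF K] by (intro lborel.emeasure_pair_measure_Times) (auto simp: B_def)
  also have "\<dots> < \<infinity>"
    using emeasure_chart_domain[OF K, of T]
    by (auto simp: B_def[symmetric] ennreal_mult_less_top emeasure_lborel_Icc_eq)
  finally have finA: "emeasure (B \<Otimes>\<^sub>M lborel) A < \<infinity>" .
  have "integrable (B \<Otimes>\<^sub>M lborel) (\<lambda>z. indicator A z *\<^sub>R (case z of (l, s) \<Rightarrow> f l s))"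
  proof (rule integrableI_bounded_set_indicator[OF A _ finA])
    show "(\<lambda>(l, s). f l s) \<in> borel_measurable (B \<Otimes>\<^sub>M lborel)" using m by (simp add: B_def)
    show "AE z in B \<Otimes>\<^sub>M lborel. z \<in> A \<longrightarrow> norm (case z of (l, s) \<Rightarrow> f l s) \<le> C"
    proof (rule AE_I2, rule impI)
      fix z assume "z \<in> A"
      then show "norm (case z of (l, s) \<Rightarrow> f l s) \<le> C"
        using b[of "fst z" "snd z"] by (auto simp: A_def D_def split_beta space_pair_measure B_def space_PiM_lborel)
    qed
  qed
  moreover have "indicator A z *\<^sub>R (case z of (l, s) \<Rightarrow> f l s) = (case z of (l, s) \<Rightarrow> indicator (D l) s *\<^sub>R f l s)"
    if "z \<in> space (B \<Otimes>\<^sub>M lborel)" for z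
    using that by (auto simp: A_def indicator_def split_beta)
  ultimately have int: "integrable (B \<Otimes>\<^sub>M lborel) (\<lambda>(l, s). indicator (D l) s *\<^sub>R f l s)"
    by (simp cong: Bochner_Integration.integrable_cong)
  show "integrable (pi_lborel K) (\<lambda>l. \<integral>s. indicator (D l) s *\<^sub>R f l s \<partial>lborel)"
    using integrable_fst'[OF int] unfolding B_def by simp
  have slice: "(\<integral>l. indicator (D l) s *\<^sub>R f l s \<partial>B) =
      indicator {0<..<T} s *\<^sub>R (\<integral>l. indicator (chart_domain K s) l *\<^sub>R f l s \<partial>B)" for s
  proof -
    have "indicator (D l) s *\<^sub>R f l s = indicator {0<..<T} s *\<^sub>R (indicator (chart_domain K s) l *\<^sub>R f l s)" for l
      using sum0[of l] by (auto simp: D_def chart_domain_def indicator_def)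
    note eq = this
    show ?thesis unfolding eq by (rule integral_scaleR_right)
  qed
  show "set_integrable lborel {0<..<T} (\<lambda>s. \<integral>l. indicator (chart_domain K s) l *\<^sub>R f l s \<partial>(pi_lborel K))"
    using integrable_snd[OF int] unfolding slice set_integrable_def by (simp add: B_def)
  have "(\<integral>l. (\<integral>s. indicator (D l) s *\<^sub>R f l s \<partial>lborel) \<partial>B) =
      (\<integral>s. (\<integral>l. indicator (D l) s *\<^sub>R f l s \<partial>B) \<partial>lborel)"
    by (rule Fubini_integral[OF int, symmetric])
  also have "\<dots> = (LINT s:{0<..<T}|lborel. (\<integral>l. indicator (chart_domain K s) l *\<^sub>R f l s \<partial>B))"
    unfolding set_lebesgue_integral_def slice ..
  finally show "(\<integral>l. (\<integral>s. indicator (D l) s *\<^sub>R f l s \<partial>lborel) \<partial>(pi_lborel K)) =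
      (LINT s:{0<..<T}|lborel. (\<integral>l. indicator (chart_domain K s) l *\<^sub>R f l s \<partial>(pi_lborel K)))"
    unfolding B_def .
qed

text \<open>
  A chart domain of mass less than \<open>T\<close> is sliced into the simplices of mass \<open>s < T\<close>.
\<close>
lemma integral_chart_domain_slices:
  assumes J: "finite J" "c \<in> J" and F: "orthant_bounded J F"
  shows "(\<integral>l. indicator (chart_domain J T) l *\<^sub>R F l \<partial>(pi_lborel J)) =
    (LINT s:{0<..<T}|lborel. (\<integral>l. F l \<partial>simplex_measure J c s))"
proof -
  define K where "K = J - {c}"
  have K: "finite K" "c \<notin> K" "insert c K = J" using J by (auto simp: K_def)
  note F' = F[folded K(3)]
  obtain C where C: "\<And>l s. l \<in> space (pi_borel K) \<Longrightarrow> \<forall>x\<in>K. 0 < l x \<Longrightarrow>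
    (\<Sum>x\<in>K. l x) < s \<Longrightarrow> s \<le> T \<Longrightarrow> norm (F (l(c := s - (\<Sum>x\<in>K. l x)))) \<le> C"
    using orthant_bounded_shift[OF K(1,2) F'] by blast
  have "integrable (pi_lborel J) (\<lambda>l. indicator (chart_domain J T) l *\<^sub>R F l)"
    by (rule integrable_chart_orthant[OF J(1) F])
  then have "(\<integral>l. indicator (chart_domain J T) l *\<^sub>R F l \<partial>(pi_lborel J)) =
      (\<integral>l. (\<integral>t. indicator (chart_domain J T) (l(c := t)) *\<^sub>R F (l(c := t)) \<partial>lborel) \<partial>(pi_lborel K))"
    unfolding K(3)[symmetric]
    by (rule product_sigma_finite.product_integral_insert[OF product_sigma_finite_lborel K(1,2)])
  also have "\<dots> = (\<integral>l. (\<integral>s. indicator {s. (\<forall>x\<in>K. 0 < l x) \<and> (\<Sum>x\<in>K. l x) < s \<and> s < T} s *\<^sub>R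
      F (l(c := s - (\<Sum>x\<in>K. l x))) \<partial>lborel) \<partial>(pi_lborel K))"
  proof (rule Bochner_Integration.integral_cong[OF refl])
    fix l :: "'a \<Rightarrow> real"
    let ?s = "\<Sum>x\<in>K. l x"
    have "(\<integral>t. indicator (chart_domain J T) (l(c := t)) *\<^sub>R F (l(c := t)) \<partial>lborel) =
        (\<integral>s. indicator (chart_domain J T) (l(c := - ?s + 1 * s)) *\<^sub>R F (l(c := - ?s + 1 * s)) \<partial>lborel)"
      by (subst lborel_integral_real_affine[of 1 _ "- ?s"]) simp_all
    also have "\<dots> = (\<integral>s. indicator {s. (\<forall>x\<in>K. 0 < l x) \<and> ?s < s \<and> s < T} s *\<^sub>R F (l(c := s - ?s)) \<partial>lborel)"
    proof (rule Bochner_Integration.integral_cong[OF refl])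
      fix s
      have "- ?s + 1 * s = s - ?s" by simp
      moreover have "indicator (chart_domain J T) (l(c := s - ?s)) =
          (indicator {s. (\<forall>x\<in>K. 0 < l x) \<and> ?s < s \<and> s < T} s :: real)"
        unfolding indicator_def K(3)[symmetric] chart_domain_insert[OF K(1,2)] by simp
      ultimately show "indicator (chart_domain J T) (l(c := - ?s + 1 * s)) *\<^sub>R F (l(c := - ?s + 1 * s)) =
          indicator {s. (\<forall>x\<in>K. 0 < l x) \<and> ?s < s \<and> s < T} s *\<^sub>R F (l(c := s - ?s))"
        by simp
    qed
    finally show "(\<integral>t. indicator (chart_domain J T) (l(c := t)) *\<^sub>R F (l(c := t)) \<partial>lborel) =
       (\<integral>s. indicator {s. (\<forall>x\<in>K. 0 < l x) \<and> ?s < s \<and> s < T} s *\<^sub>R F (l(c := s - ?s)) \<partial>lborel)" .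
  qed
  also have "\<dots> = (LINT s:{0<..<T}|lborel. (\<integral>l. indicator (chart_domain K s) l *\<^sub>R
      F (l(c := s - (\<Sum>x\<in>K. l x))) \<partial>(pi_lborel K)))"
    by (rule chart_fubini(1)[OF K(1) measurable_chart_pair[OF F'] C])
  also have "\<dots> = (LINT s:{0<..<T}|lborel. (\<integral>l. F l \<partial>simplex_measure J c s))"
    unfolding integral_simplex_measure[OF J orthant_bounded_measurable[OF F]] K_def ..
  finally show ?thesis .
qed

lemma set_integrable_simplex_slices:
  assumes S: "finite S" "c \<in> S" and F: "orthant_bounded S F"
  shows "set_integrable lborel {0<..<T} (\<lambda>s. \<integral>l. F l \<partial>simplex_measure S c s)"
proof -
  define K where "K = S - {c}"
  have K: "finite K" "c \<notin> K" "insert c K = S" using S by (auto simp: K_def)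
  note F' = F[folded K(3)]
  obtain C where C: "\<And>l s. l \<in> space (pi_borel K) \<Longrightarrow> \<forall>x\<in>K. 0 < l x \<Longrightarrow>
    (\<Sum>x\<in>K. l x) < s \<Longrightarrow> s \<le> T \<Longrightarrow> norm (F (l(c := s - (\<Sum>x\<in>K. l x)))) \<le> C"
    using orthant_bounded_shift[OF K(1,2) F'] by blast
  from chart_fubini(3)[OF K(1) measurable_chart_pair[OF F'] C]
  show ?thesis
    unfolding integral_simplex_measure[OF S orthant_bounded_measurable[OF F]] K_def .
qed

lemma interval_integral_FTC_shift:
  fixes f g :: "real \<Rightarrow> complex"
  assumes d: "\<And>t. (f has_vector_derivative g t) (at t)" and c: "continuous_on UNIV g" and "a \<le> T"
  shows "f (T - a) = f 0 + (\<integral>s. indicator {a<..<T} s *\<^sub>R g (s - a) \<partial>lborel)"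
proof -
  have "f (T - a) - f 0 = (\<integral>u. indicator {0..T - a} u *\<^sub>R g u \<partial>lborel)"
    by (rule integral_FTC_Icc[symmetric])
       (use assms in \<open>auto intro: has_vector_derivative_at_within continuous_on_subset\<close>)
  also have "\<dots> = (\<integral>s. indicator {0..T - a} (- a + 1 * s) *\<^sub>R g (- a + 1 * s) \<partial>lborel)"
    by (subst lborel_integral_real_affine[of 1 _ "- a"]) simp_all
  also have "\<dots> = (\<integral>s. indicator {a<..<T} s *\<^sub>R g (s - a) \<partial>lborel)"
  proof (rule integral_cong_AE)
    have [measurable]: "g \<in> borel_measurable borel" using c by (rule borel_measurable_continuous_onI)
    show "(\<lambda>s. indicator {0..T - a} (- a + 1 * s) *\<^sub>R g (- a + 1 * s)) \<in> borel_measurable lborel"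
      by measurable
    show "(\<lambda>s. indicator {a<..<T} s *\<^sub>R g (s - a)) \<in> borel_measurable lborel" by measurable
    show "AE s in lborel. indicator {0..T - a} (- a + 1 * s) *\<^sub>R g (- a + 1 * s) =
        indicator {a<..<T} s *\<^sub>R g (s - a)"
      using AE_lborel_singleton[of a] AE_lborel_singleton[of T]
    proof eventually_elim
      case (elim s)
      have "- a + 1 * s = s - a" by simp
      moreover have "indicator {0..T - a} (s - a) = (indicator {a<..<T} s :: real)"
        using elim by (auto simp: indicator_def)
      ultimately show ?case by simp
    qed
  qed
  finally show ?thesis by (simp add: algebra_simps)
qed

text \<open>
  In the chart that omits \<open>b\<close>, the coordinate \<open>l\<^sub>b\<close> runs from \<open>0\<close> to the mass left over by the other
  coordinates. The fundamental theorem of calculus in \<open>l\<^sub>b\<close> writes \<open>F\<close> as its value at \<open>l\<^sub>b = 0\<close> plus the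
  integral of its derivative \<open>G\<close>; slicing both terms by total mass gives the two integrals over \<open>s\<close>. If \<open>b\<close>
  is the only site, the boundary is a point, namely the function that is \<open>0\<close> at \<open>b\<close> and \<open>undefined\<close>
  elsewhere.
\<close>
lemma integral_simplex_recursion:
  assumes S: "finite S" "b \<in> S" and c: "S \<noteq> {b} \<Longrightarrow> c \<in> S - {b}" and T: "0 < T"
    and F: "orthant_bounded S F" and G: "orthant_bounded S G"
    and F0: "orthant_bounded (S - {b}) (\<lambda>l. F (l(b := 0)))"
    and deriv: "\<And>l t. ((\<lambda>t. F (l(b := t))) has_vector_derivative G (l(b := t))) (at t)"
    and cont: "\<And>l. continuous_on UNIV (\<lambda>t. G (l(b := t)))"
  shows "(\<integral>l. F l \<partial>simplex_measure S b T) =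
    (if S = {b} then F ((\<lambda>_. undefined)(b := 0))
     else LINT s:{0<..<T}|lborel. (\<integral>l. F (l(b := 0)) \<partial>simplex_measure (S - {b}) c s)) +
    (LINT s:{0<..<T}|lborel. (\<integral>l. G l \<partial>simplex_measure S b s))"
proof -
  define J where "J = S - {b}"
  have J: "finite J" "b \<notin> J" "insert b J = S" using S by (auto simp: J_def)
  note G' = G[folded J(3)]
  obtain C where C: "\<And>l s. l \<in> space (pi_borel J) \<Longrightarrow> \<forall>x\<in>J. 0 < l x \<Longrightarrow>
    (\<Sum>x\<in>J. l x) < s \<Longrightarrow> s \<le> T \<Longrightarrow> norm (G (l(b := s - (\<Sum>x\<in>J. l x)))) \<le> C"
    using orthant_bounded_shift[OF J(1,2) G'] by blast
  let ?D = "\<lambda>l. {s. (\<forall>x\<in>J. 0 < l x) \<and> (\<Sum>x\<in>J. l x) < s \<and> s < T}"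
  let ?g = "\<lambda>l s. G (l(b := s - (\<Sum>x\<in>J. l x)))"
  have fub: "(\<integral>l. (\<integral>s. indicator (?D l) s *\<^sub>R ?g l s \<partial>lborel) \<partial>(pi_lborel J)) =
      (LINT s:{0<..<T}|lborel. (\<integral>l. indicator (chart_domain J s) l *\<^sub>R ?g l s \<partial>(pi_lborel J)))"
    by (rule chart_fubini(1)[OF J(1) measurable_chart_pair[OF G'] C])
  have int1: "integrable (pi_lborel J) (\<lambda>l. \<integral>s. indicator (?D l) s *\<^sub>R ?g l s \<partial>lborel)"
    by (rule chart_fubini(2)[OF J(1) measurable_chart_pair[OF G'] C])
  have int0: "integrable (pi_lborel J) (\<lambda>l. indicator (chart_domain J T) l *\<^sub>R F (l(b := 0)))"
    by (rule integrable_chart_orthant[OF J(1) F0[folded J_def]])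
  have "(\<integral>l. F l \<partial>simplex_measure S b T) =
      (\<integral>l. indicator (chart_domain J T) l *\<^sub>R F (l(b := T - (\<Sum>x\<in>J. l x))) \<partial>(pi_lborel J))"
    unfolding J_def by (rule integral_simplex_measure[OF S orthant_bounded_measurable[OF F]])
  also have "\<dots> = (\<integral>l. indicator (chart_domain J T) l *\<^sub>R F (l(b := 0)) +
      (\<integral>s. indicator (?D l) s *\<^sub>R ?g l s \<partial>lborel) \<partial>(pi_lborel J))"
  proof (rule Bochner_Integration.integral_cong[OF refl])
    fix l :: "'a \<Rightarrow> real"
    let ?s = "\<Sum>x\<in>J. l x"
    show "indicator (chart_domain J T) l *\<^sub>R F (l(b := T - ?s)) =
      indicator (chart_domain J T) l *\<^sub>R F (l(b := 0)) + (\<integral>s. indicator (?D l) s *\<^sub>R ?g l s \<partial>lborel)"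
    proof (cases "l \<in> chart_domain J T")
      case True
      then have "?s \<le> T" and D: "?D l = {?s<..<T}" by (auto simp: chart_domain_def)
      from interval_integral_FTC_shift[OF deriv cont this(1), of l] True
      show ?thesis unfolding D by simp
    next
      case False
      then have "?D l = {}" by (auto simp: chart_domain_def)
      then show ?thesis using False by simp
    qed
  qed
  also have "\<dots> = (\<integral>l. indicator (chart_domain J T) l *\<^sub>R F (l(b := 0)) \<partial>(pi_lborel J)) +
      (\<integral>l. (\<integral>s. indicator (?D l) s *\<^sub>R ?g l s \<partial>lborel) \<partial>(pi_lborel J))"
    by (rule Bochner_Integration.integral_add[OF int0 int1])
  also have "(\<integral>l. (\<integral>s. indicator (?D l) s *\<^sub>R ?g l s \<partial>lborel) \<partial>(pi_lborel J)) =
      (LINT s:{0<..<T}|lborel. (\<integral>l. G l \<partial>simplex_measure S b s))"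
    unfolding fub integral_simplex_measure[OF S orthant_bounded_measurable[OF G], folded J_def] ..
  also have "(\<integral>l. indicator (chart_domain J T) l *\<^sub>R F (l(b := 0)) \<partial>(pi_lborel J)) =
      (if S = {b} then F ((\<lambda>_. undefined)(b := 0))
       else LINT s:{0<..<T}|lborel. (\<integral>l. F (l(b := 0)) \<partial>simplex_measure (S - {b}) c s))"
  proof (cases "S = {b}")
    case True
    then have "J = {}" by (auto simp: J_def)
    then show ?thesis using True T
      by (simp add: PiM_empty lebesgue_integral_count_space_finite chart_domain_def fun_upd_def)
  next
    case False
    then show ?thesis
      using integral_chart_domain_slices[OF J(1) c[OF False, folded J_def] F0[folded J_def]] by (simp add: J_def)
  qed
  finally show ?thesis .
qed

section \<open>Boundary values and the forward equation\<close>

lemma orthant_bounded_exp_mean: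
  assumes S: "finite S" and q: "bm_torus S q"
  shows "orthant_bounded S (exp_mean S B q)"
  unfolding orthant_bounded_def
proof (intro conjI allI)
  interpret finite_measure "torus S" by (rule finite_measure_torus)
  let ?N = "(pi_borel S) \<Otimes>\<^sub>M torus S"
  have l: "(\<lambda>p. complex_of_real (fst p x)) \<in> borel_measurable ?N" if "x \<in> S" for x
  proof -
    have "(\<lambda>p. fst p x) \<in> borel_measurable ?N"
      by (rule measurable_compose[OF measurable_fst measurable_component_singleton[OF that]])
    then show ?thesis by measurable
  qed
  have r: "(\<lambda>p. rate S B (phase (snd p)) x) \<in> borel_measurable ?N" if "x \<in> S" for x
    by (rule measurable_compose[OF measurable_snd bounded_measurable_measurable[OF bm_rate[OF that]]])
  have qm: "(\<lambda>p. q (phase (snd p))) \<in> borel_measurable ?N"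
    by (rule measurable_compose[OF measurable_snd bounded_measurable_measurable[OF q]])
  have "(\<lambda>p. q (phase (snd p)) * exp (\<Sum>x\<in>S. of_real (fst p x) * rate S B (phase (snd p)) x)) \<in> borel_measurable ?N"
    by (intro borel_measurable_times qm borel_measurable_sum l r measurable_compose[OF _ borel_measurable_exp])
  then have "(\<lambda>(l, \<theta>). q (phase \<theta>) * exp (\<Sum>x\<in>S. of_real (l x) * rate S B (phase \<theta>) x)) \<in> borel_measurable ?N"
    by (simp add: split_beta')
  then show "exp_mean S B q \<in> borel_measurable (pi_borel S)"
    unfolding exp_mean_def[abs_def] torus_mean_def by (rule borel_measurable_lebesgue_integral)
next
  fix T :: real
  obtain C where C: "0 \<le> C" "\<And>\<theta>. \<theta> \<in> space (torus S) \<Longrightarrow> norm (q (phase \<theta>)) \<le> C"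
    using bounded_measurableE[OF q] by blast
  have "\<exists>D. \<forall>x\<in>S. 0 \<le> D x \<and> (\<forall>\<theta>\<in>space (torus S). norm (rate S B (phase \<theta>) x) \<le> D x)"
    by (rule bchoice) (use bounded_measurableE[OF bm_rate] in metis)
  then obtain D where D: "\<And>x. x \<in> S \<Longrightarrow> 0 \<le> D x"
    "\<And>x \<theta>. x \<in> S \<Longrightarrow> \<theta> \<in> space (torus S) \<Longrightarrow> norm (rate S B (phase \<theta>) x) \<le> D x" by blast
  interpret prob_space "torus S" by (rule prob_space_PiM) (rule prob_space_circle)
  show "\<exists>C. \<forall>l\<in>space (pi_borel S).
      (\<forall>x\<in>S. 0 \<le> l x \<and> l x \<le> T) \<longrightarrow> norm (exp_mean S B q l) \<le> C"
  proof (intro exI ballI impI)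
    fix l :: "'a \<Rightarrow> real" assume l: "\<forall>x\<in>S. 0 \<le> l x \<and> l x \<le> T"
    let ?f = "\<lambda>\<theta>. q (phase \<theta>) * exp (\<Sum>x\<in>S. of_real (l x) * rate S B (phase \<theta>) x)"
    have i: "integrable (torus S) ?f"
      by (intro bm_integrable[OF finite_measure_torus] bm_intros q)
    have "norm (exp_mean S B q l) \<le> (\<integral>\<theta>. norm (?f \<theta>) \<partial>torus S)"
      unfolding exp_mean_def torus_mean_def by (rule integral_norm_bound)
    also have "\<dots> \<le> (\<integral>\<theta>. C * exp (\<Sum>x\<in>S. T * D x) \<partial>torus S)"
    proof (rule integral_mono)
      fix \<theta> assume \<theta>: "\<theta> \<in> space (torus S)"
      have "norm (\<Sum>x\<in>S. of_real (l x) * rate S B (phase \<theta>) x) \<le> (\<Sum>x\<in>S. T * D x)"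
      proof (rule sum_norm_le)
        fix x assume x: "x \<in> S"
        then show "norm (of_real (l x) * rate S B (phase \<theta>) x) \<le> T * D x"
          using l D[OF x] \<theta> by (auto simp: norm_mult intro!: mult_mono)
      qed
      then have "norm (exp (\<Sum>x\<in>S. of_real (l x) * rate S B (phase \<theta>) x)) \<le> exp (\<Sum>x\<in>S. T * D x)"
        using norm_exp order_trans by (metis exp_le_cancel_iff)
      then show "norm (?f \<theta>) \<le> C * exp (\<Sum>x\<in>S. T * D x)"
        using C(1) C(2)[OF \<theta>] by (simp add: norm_mult mult_mono)
    qed (use i in auto)
    finally show "norm (exp_mean S B q l) \<le> C * exp (\<Sum>x\<in>S. T * D x)"
      by (simp add: prob_space)
  qed
qed

lemma cofactor_cong:
  assumes "finite S" "\<And>x y. x \<in> S - {c} \<Longrightarrow> M x y = M' x y"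
  shows "cofactor S a c M = cofactor S a c M'"
  unfolding cofactor_def using assms by (intro sum.cong arg_cong2[where f = "(*)"] prod.cong refl) auto

text \<open>
  Setting \<open>z\<^sub>b = 0\<close> removes the site \<open>b\<close> from the rates of the other sites.
\<close>
lemma rate_upd_0:
  assumes "finite S" "b \<in> S" "x \<noteq> b"
  shows "rate S B (z(b := 0)) x = rate (S - {b}) B z x"
proof -
  have "rate S B (z(b := 0)) x = (\<Sum>y\<in>S - {b}. of_real (B x y) * ((z(b := 0)) y / z x))"
    unfolding rate_def using assms by (subst sum.remove[of _ b]) auto
  also have "\<dots> = rate (S - {b}) B z x"
    unfolding rate_def by (rule sum.cong) auto
  finally show ?thesis .
qed

lemma rate_matrix_upd_0:
  assumes "finite S" "b \<in> S" "x \<noteq> b"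
  shows "rate_matrix S B (z(b := 0)) x y = rate_matrix (S - {b}) B z x y"
  unfolding rate_matrix_def rate_upd_0[OF assms] ..

text \<open>
  For \<open>a \<noteq> b\<close> this is the expansion along column \<open>b\<close>, whose remaining entries are \<open>- B\<^sub>c\<^sub>b\<close>. For \<open>a = b\<close>
  the cofactor is the determinant of the rate matrix of \<open>S - {b}\<close>, which is singular unless it is empty.
\<close>
lemma cofactor_boundary:
  assumes S: "finite S" "a \<in> S" "b \<in> S" and z: "\<And>x. z x \<noteq> 0"
  shows "cofactor S a b (rate_matrix (S - {b}) B z) =
    (if a = b then of_bool (S = {b})
     else \<Sum>c\<in>S - {b}. of_real (B c b) * cofactor (S - {b}) a c (rate_matrix (S - {b}) B z))"
proof (cases "a = b")
  case True
  show ?thesis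
  proof (cases "S = {b}")
    case S1: True
    have "{p. p permutes ({} :: 'a set)} = {id}" by auto
    then show ?thesis using True S1 by (simp add: cofactor_diagonal set_det_def sign_id)
  next
    case False
    then obtain c where c: "c \<in> S - {b}" using S by auto
    have "set_det (S - {b}) (rate_matrix (S - {b}) B z) = 0"
      by (rule set_det_eq_0[where z = z, OF _ c z rate_matrix_kernel]) (use S z in auto)
    then show ?thesis using True False S by (simp add: cofactor_diagonal)
  qed
next
  case False
  have "cofactor S a b (rate_matrix (S - {b}) B z) =
      - (\<Sum>c\<in>S - {b}. rate_matrix (S - {b}) B z c b * cofactor (S - {b}) a c (rate_matrix (S - {b}) B z))"
    by (rule cofactor_expand_column[OF S False])
  also have "\<dots> = (\<Sum>c\<in>S - {b}. of_real (B c b) * cofactor (S - {b}) a c (rate_matrix (S - {b}) B z))"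
    unfolding sum_negf[symmetric] by (rule sum.cong) (auto simp: rate_matrix_def)
  finally show ?thesis using False by simp
qed

text \<open>
  When \<open>l\<^sub>b = 0\<close>, the rate of \<open>b\<close> occurs neither in the exponent nor in the cofactor, in which row \<open>b\<close> is
  deleted. It is the only term with \<open>z\<^sub>b\<close> in a denominator, so the mean value property applies.
\<close>
lemma cofactor_mean_boundary:
  assumes S: "finite S" "a \<in> S" "b \<in> S"
  shows "cofactor_mean B S a b (l(b := 0)) =
    (if a = b then of_bool (S = {b}) else \<Sum>c\<in>S - {b}. of_real (B c b) * cofactor_mean B (S - {b}) a c l)"
proof -
  define f where "f z = cofactor S a b (rate_matrix S B z) * exp (\<Sum>x\<in>S. of_real ((l(b := 0)) x) * rate S B z x)" for z
  have sum_b: "(\<Sum>x\<in>S. of_real ((l(b := 0)) x) * rate S B z x) = (\<Sum>x\<in>S - {b}. of_real (l x) * rate S B z x)" for z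
  proof -
    have "(\<Sum>x\<in>S. of_real ((l(b := 0)) x) * rate S B z x) = (\<Sum>x\<in>S - {b}. of_real ((l(b := 0)) x) * rate S B z x)"
      using S by (subst sum.remove[of _ b]) auto
    also have "\<dots> = (\<Sum>x\<in>S - {b}. of_real (l x) * rate S B z x)" by (rule sum.cong) auto
    finally show ?thesis .
  qed
  have rate_holo: "(\<lambda>\<zeta>. rate S B (z(b := \<zeta>)) x) holomorphic_on UNIV" if "x \<noteq> b" for z x
  proof -
    have "(\<lambda>\<zeta>. (z(b := \<zeta>)) y / z x) holomorphic_on UNIV" for y
      unfolding divide_inverse by (cases "y = b") (auto intro!: holomorphic_intros)
    note * = this
    show ?thesis
      unfolding rate_def fun_upd_other[OF that] by (rule * | rule holomorphic_intros)+
  qed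
  have matrix_holo: "(\<lambda>\<zeta>. rate_matrix S B (z(b := \<zeta>)) x y) holomorphic_on UNIV" if "x \<noteq> b" for z x y
    unfolding rate_matrix_def using rate_holo[OF that, of z]
    by (cases "x = y") (auto intro!: holomorphic_intros)
  have matrix_holo': "(\<lambda>\<zeta>. rate_matrix S B (z(b := \<zeta>)) x y) holomorphic_on UNIV" if "x \<in> S - {b}" for z x y
    using matrix_holo that by blast
  have rate_holo': "(\<lambda>\<zeta>. rate S B (z(b := \<zeta>)) x) holomorphic_on UNIV" if "x \<in> S - {b}" for z x
    using rate_holo that by blast
  have holo: "(\<lambda>\<zeta>. f (z(b := \<zeta>))) holomorphic_on UNIV" for z
    unfolding f_def sum_b cofactor_def
    by (rule matrix_holo' rate_holo' | assumption | rule holomorphic_intros)+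
  have bm: "bm_torus S f"
    unfolding f_def by (intro bm_intros)
  have "cofactor_mean B S a b (l(b := 0)) = torus_mean S f"
    by (simp add: cofactor_mean_def exp_mean_def f_def[abs_def])
  also have "\<dots> = torus_mean (S - {b}) (\<lambda>z. f (z(b := 0)))"
    by (rule torus_mean_entire[OF S(1,3) bm holo])
  also have "\<dots> = torus_mean (S - {b}) (\<lambda>z.
      (if a = b then of_bool (S = {b})
       else \<Sum>c\<in>S - {b}. of_real (B c b) * cofactor (S - {b}) a c (rate_matrix (S - {b}) B z)) *
      exp (\<Sum>x\<in>S - {b}. of_real (l x) * rate (S - {b}) B z x))"
  proof (rule torus_mean_cong)
    fix \<theta> :: "'a \<Rightarrow> real"
    have "cofactor S a b (rate_matrix S B ((phase \<theta>)(b := 0))) = cofactor S a b (rate_matrix (S - {b}) B (phase \<theta>))"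
      by (rule cofactor_cong[OF S(1)]) (use rate_matrix_upd_0[OF S(1,3)] in auto)
    moreover have "(\<Sum>x\<in>S - {b}. of_real (l x) * rate S B ((phase \<theta>)(b := 0)) x) =
        (\<Sum>x\<in>S - {b}. of_real (l x) * rate (S - {b}) B (phase \<theta>) x)"
      by (rule sum.cong) (use rate_upd_0[OF S(1,3)] in auto)
    ultimately show "f ((phase \<theta>)(b := 0)) =
       (if a = b then of_bool (S = {b})
       else \<Sum>c\<in>S - {b}. of_real (B c b) * cofactor (S - {b}) a c (rate_matrix (S - {b}) B (phase \<theta>))) *
      exp (\<Sum>x\<in>S - {b}. of_real (l x) * rate (S - {b}) B (phase \<theta>) x)"
      unfolding f_def sum_b by (simp only: cofactor_boundary[OF S phase_nonzero])
  qed
  also have "\<dots> = (if a = b then of_bool (S = {b}) else \<Sum>c\<in>S - {b}. of_real (B c b) * cofactor_mean B (S - {b}) a c l)"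
  proof (cases "a = b")
    case True
    interpret prob_space "torus ({} :: 'a set)" by (rule prob_space_PiM) (rule prob_space_circle)
    show ?thesis using True by (cases "S = {b}") (auto simp: torus_mean_def prob_space)
  next
    case False
    show ?thesis
      unfolding cofactor_mean_def exp_mean_mult[symmetric]
      using False
      by (subst exp_mean_sum[symmetric]) (auto intro!: bm_intros simp: exp_mean_def)
  qed
  finally show ?thesis .
qed

lemma cofactor_mean_transport:
  assumes S: "finite S" "a \<in> S" "b \<in> S"
  shows "exp_mean S B (\<lambda>z. cofactor S a b (rate_matrix S B z) * rate S B z b) l =
    (\<Sum>c\<in>S. of_real (B c b) * cofactor_mean B S a c l)"
proof -
  have "exp_mean S B (\<lambda>z. cofactor S a b (rate_matrix S B z) * rate S B z b) l =
      exp_mean S B (\<lambda>z. \<Sum>c\<in>S. of_real (B c b) * cofactor S a c (rate_matrix S B z)) l"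
    by (rule exp_mean_cong) (rule cofactor_rate_eigen[OF S phase_nonzero])
  also have "\<dots> = (\<Sum>c\<in>S. of_real (B c b) * cofactor_mean B S a c l)"
    unfolding cofactor_mean_def exp_mean_mult[symmetric] by (rule exp_mean_sum) (intro bm_intros)
  finally show ?thesis .
qed

lemma orthant_bounded_cofactor_mean: "finite S \<Longrightarrow> orthant_bounded S (cofactor_mean B S a b)"
  unfolding cofactor_mean_def[abs_def] by (intro orthant_bounded_exp_mean bm_intros)

text \<open>
  The weight of the paths from \<open>a\<close> to \<open>b\<close> whose range is exactly \<open>S\<close>. The integral does not depend on the
  chart; omitting \<open>b\<close> is convenient because the forward equation differentiates in \<open>l\<^sub>b\<close>.
\<close>
definition range_weight :: "('a \<Rightarrow> 'a \<Rightarrow> real) \<Rightarrow> 'a set \<Rightarrow> 'a \<Rightarrow> 'a \<Rightarrow> real \<Rightarrow> complex" where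
  "range_weight B S a b T = (\<integral>l. cofactor_mean B S a b l \<partial>simplex_measure S b T)"

text \<open>
  The rate at which paths with range \<open>S\<close> jump to \<open>b\<close>, including the diagonal term for those that sit
  in \<open>b\<close>.
\<close>
definition inflow :: "('a \<Rightarrow> 'a \<Rightarrow> real) \<Rightarrow> 'a \<Rightarrow> 'a set \<Rightarrow> 'a \<Rightarrow> real \<Rightarrow> complex" where
  "inflow B b S a s = (\<Sum>c\<in>S. of_real (B c b) * range_weight B S a c s)"

lemma range_weight_chart:
  assumes "finite S" "b \<in> S" "c \<in> S"
  shows "(\<integral>l. cofactor_mean B S a b l \<partial>simplex_measure S c T) = range_weight B S a b T"
  unfolding range_weight_def
  by (rule integral_simplex_chart_change[OF assms(1,3,2) orthant_bounded_cofactor_mean[OF assms(1)]])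

lemma set_integrable_range_weight:
  assumes "finite S" "b \<in> S"
  shows "set_integrable lborel {0<..<T} (range_weight B S a b)"
  unfolding range_weight_def[abs_def]
  by (rule set_integrable_simplex_slices[OF assms orthant_bounded_cofactor_mean[OF assms(1)]])

lemma set_integrable_inflow:
  assumes "finite S"
  shows "set_integrable lborel {0<..<T} (inflow B b S a)"
  unfolding inflow_def[abs_def] set_integrable_def scaleR_sum_right
  by (intro Bochner_Integration.integrable_sum)
     (use set_integrable_range_weight[OF assms, THEN set_integrable_mult_right] in \<open>auto simp: set_integrable_def\<close>)

lemma integral_sum_cofactor_mean:
  assumes S: "finite S" "d \<in> S"
  shows "(\<integral>l. (\<Sum>c\<in>S. of_real (B c b) * cofactor_mean B S a c l) \<partial>simplex_measure S d s) = inflow B b S a s"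
proof -
  have "integrable (simplex_measure S d s) (cofactor_mean B S a c)" for c
    by (rule bm_integrable[OF finite_measure_simplex[OF S] bm_simplex[OF S(1) orthant_bounded_cofactor_mean[OF S(1)]]])
  then show ?thesis
    unfolding inflow_def
    by (subst Bochner_Integration.integral_sum) (auto simp: range_weight_chart S)
qed

text \<open>
  The two sources of paths that end in \<open>b\<close> with range \<open>S\<close>: those that had range \<open>S\<close> before, and those
  with range \<open>S - {b}\<close> that enter \<open>b\<close> for the first time.
\<close>
lemma range_weight_recursion:
  assumes S: "finite S" "a \<in> S" "b \<in> S" and T: "0 < T"
  shows "range_weight B S a b T = of_bool (S = {b}) +
    (LINT s:{0<..<T}|lborel. (if a = b then 0 else inflow B b (S - {b}) a s) + inflow B b S a s)"
proof -
  define G where "G = exp_mean S B (\<lambda>z. cofactor S a b (rate_matrix S B z) * rate S B z b)"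
  have G_eq: "G l = (\<Sum>c\<in>S. of_real (B c b) * cofactor_mean B S a c l)" for l
    unfolding G_def by (rule cofactor_mean_transport[OF S])
  have q: "bm_torus S (\<lambda>z. cofactor S a b (rate_matrix S B z) * rate S B z b)"
    by (intro bm_intros S)
  have obG: "orthant_bounded S G"
    unfolding G_def by (rule orthant_bounded_exp_mean[OF S(1) q])
  have deriv: "((\<lambda>t. cofactor_mean B S a b (l(b := t))) has_vector_derivative G (l(b := t))) (at t)" for l t
    unfolding G_def cofactor_mean_def
    by (rule exp_mean_has_vector_derivative[OF S(1,3)]) (intro bm_intros)
  have cont: "continuous_on UNIV (\<lambda>t. G (l(b := t)))" for l
    unfolding G_def
    by (intro continuous_at_imp_continuous_on ballI has_vector_derivative_continuous[OF exp_mean_has_vector_derivative[OF S(1,3) q]])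
  have sum_ob: "orthant_bounded J (\<lambda>l. \<Sum>c\<in>J. of_real (B c b) * cofactor_mean B J a c l)" if "finite J" for J
  proof -
    have "orthant_bounded J (exp_mean J B (\<lambda>z. \<Sum>c\<in>J. of_real (B c b) * cofactor J a c (rate_matrix J B z)))"
      by (rule orthant_bounded_exp_mean[OF that]) (intro bm_intros)
    also have "exp_mean J B (\<lambda>z. \<Sum>c\<in>J. of_real (B c b) * cofactor J a c (rate_matrix J B z)) =
        (\<lambda>l. \<Sum>c\<in>J. of_real (B c b) * cofactor_mean B J a c l)"
      unfolding cofactor_mean_def exp_mean_mult[symmetric]
      by (rule ext, rule exp_mean_sum) (intro bm_intros)
    finally show ?thesis .
  qed
  have F0: "orthant_bounded (S - {b}) (\<lambda>l. cofactor_mean B S a b (l(b := 0)))"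
  proof (cases "a = b")
    case True
    then show ?thesis unfolding cofactor_mean_boundary[OF S] by (auto simp: orthant_bounded_def intro!: exI[of _ 1])
  next
    case False
    then show ?thesis unfolding cofactor_mean_boundary[OF S] using sum_ob[of "S - {b}"] S(1) by simp
  qed
  obtain c where c: "S \<noteq> {b} \<Longrightarrow> c \<in> S - {b}" using S(3) by blast
  have "range_weight B S a b T =
    (if S = {b} then cofactor_mean B S a b ((\<lambda>_. undefined)(b := 0))
     else LINT s:{0<..<T}|lborel. (\<integral>l. cofactor_mean B S a b (l(b := 0)) \<partial>simplex_measure (S - {b}) c s)) +
    (LINT s:{0<..<T}|lborel. (\<integral>l. G l \<partial>simplex_measure S b s))"
    unfolding range_weight_def
    by (rule integral_simplex_recursion[OF S(1,3) c T orthant_bounded_cofactor_mean[OF S(1)] obG F0 deriv cont])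
  also have "(\<lambda>s. \<integral>l. G l \<partial>simplex_measure S b s) = inflow B b S a"
    unfolding G_eq integral_sum_cofactor_mean[OF S(1,3)] ..
  also have "(if S = {b} then cofactor_mean B S a b ((\<lambda>_. undefined)(b := 0))
     else LINT s:{0<..<T}|lborel. (\<integral>l. cofactor_mean B S a b (l(b := 0)) \<partial>simplex_measure (S - {b}) c s)) =
     of_bool (S = {b}) + (LINT s:{0<..<T}|lborel. if a = b then 0 else inflow B b (S - {b}) a s)"
  proof (cases "S = {b}")
    case True
    then have "a = b" using S by simp
    then show ?thesis using True S by (subst cofactor_mean_boundary[OF S]) simp
  next
    case False
    show ?thesis
    proof (cases "a = b")
      case True
      then show ?thesis unfolding cofactor_mean_boundary[OF S] using False by simp
    next
      case ab: False
      have "(\<integral>l. cofactor_mean B S a b (l(b := 0)) \<partial>simplex_measure (S - {b}) c s) = inflow B b (S - {b}) a s" for s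
        unfolding cofactor_mean_boundary[OF S] using ab integral_sum_cofactor_mean[OF _ c[OF False]] S(1) by simp
      note eq = this
      show ?thesis unfolding eq using False ab by simp
    qed
  qed
  also have "of_bool (S = {b}) + (LINT s:{0<..<T}|lborel. if a = b then 0 else inflow B b (S - {b}) a s) +
      (LINT s:{0<..<T}|lborel. inflow B b S a s) = of_bool (S = {b}) +
    (LINT s:{0<..<T}|lborel. (if a = b then 0 else inflow B b (S - {b}) a s) + inflow B b S a s)"
  proof -
    have "set_integrable lborel {0<..<T} (\<lambda>s. if a = b then 0 else inflow B b (S - {b}) a s)"
      using set_integrable_inflow[of "S - {b}"] S(1)
      by (cases "a = b") (auto simp: set_integrable_def)
    from set_integral_add(2)[OF this set_integrable_inflow[OF S(1)]] show ?thesis by (simp add: add.assoc)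
  qed
  finally show ?thesis .
qed

text \<open>
  At time \<open>0\<close>, where the simplex is degenerate, the value is fixed by continuity.
\<close>
definition killed_kernel :: "('a \<Rightarrow> 'a \<Rightarrow> real) \<Rightarrow> 'a set \<Rightarrow> 'a \<Rightarrow> 'a \<Rightarrow> real \<Rightarrow> complex" where
  "killed_kernel B S a b T =
     (if T \<le> 0 then of_bool (a = b) else \<Sum>U | U \<subseteq> S \<and> a \<in> U \<and> b \<in> U. range_weight B U a b T)"

lemma set_integrable_killed_kernel:
  assumes "finite S"
  shows "set_integrable lborel {0<..<T} (killed_kernel B S a b)"
proof -
  have "set_integrable lborel {0<..<T} (\<lambda>s. \<Sum>U | U \<subseteq> S \<and> a \<in> U \<and> b \<in> U. range_weight B U a b s)"
    unfolding set_integrable_def scaleR_sum_right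
    by (intro Bochner_Integration.integrable_sum)
       (auto intro!: set_integrable_range_weight[unfolded set_integrable_def] intro: finite_subset[OF _ assms])
  also have "?this \<longleftrightarrow> set_integrable lborel {0<..<T} (killed_kernel B S a b)"
    by (rule set_integrable_cong) (auto simp: killed_kernel_def)
  finally show ?thesis .
qed

text \<open>
  Grouping the sets \<open>W\<close> by whether they contain \<open>b\<close>: those without \<open>b\<close> are the sets \<open>U - {b}\<close> with
  \<open>b \<in> U\<close>. There is none if \<open>a = b\<close>, as \<open>a \<in> W\<close>.
\<close>
lemma sum_inflow_subsets:
  assumes S: "finite S" "a \<in> S" "b \<in> S" and s: "0 < s"
  shows "(\<Sum>U | U \<subseteq> S \<and> a \<in> U \<and> b \<in> U. (if a = b then 0 else inflow B b (U - {b}) a s) + inflow B b U a s) =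
    (\<Sum>c\<in>S. of_real (B c b) * killed_kernel B S a c s)"
proof -
  define W where "W = {U. U \<subseteq> S \<and> a \<in> U}"
  have finW: "finite W" unfolding W_def by (rule finite_subset[of _ "Pow S"]) (use S in auto)
  have "(\<Sum>c\<in>S. of_real (B c b) * killed_kernel B S a c s) =
      (\<Sum>c\<in>S. \<Sum>U\<in>{U\<in>W. c \<in> U}. of_real (B c b) * range_weight B U a c s)"
    using s by (simp add: killed_kernel_def sum_distrib_left W_def conj_assoc)
  also have "\<dots> = (\<Sum>U\<in>W. \<Sum>c\<in>{c\<in>S. c \<in> U}. of_real (B c b) * range_weight B U a c s)"
    by (rule sum.swap_restrict[OF S(1) finW])
  also have "\<dots> = (\<Sum>U\<in>W. inflow B b U a s)"
  proof (rule sum.cong[OF refl])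
    fix U assume "U \<in> W"
    then have "{c\<in>S. c \<in> U} = U" by (auto simp: W_def)
    then show "(\<Sum>c\<in>{c\<in>S. c \<in> U}. of_real (B c b) * range_weight B U a c s) = inflow B b U a s"
      by (simp add: inflow_def)
  qed
  also have "\<dots> = (\<Sum>U\<in>{U\<in>W. b \<notin> U}. inflow B b U a s) + (\<Sum>U\<in>{U\<in>W. b \<in> U}. inflow B b U a s)"
    by (subst sum.union_disjoint[symmetric]) (use finW in \<open>auto intro!: sum.cong\<close>)
  also have "(\<Sum>U\<in>{U\<in>W. b \<notin> U}. inflow B b U a s) =
      (\<Sum>U\<in>{U\<in>W. b \<in> U}. if a = b then 0 else inflow B b (U - {b}) a s)"
  proof (cases "a = b")
    case True
    then have "{U\<in>W. b \<notin> U} = {}" by (auto simp: W_def)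
    then have "(\<Sum>U\<in>{U\<in>W. b \<notin> U}. inflow B b U a s) = 0" by (simp only: sum.empty)
    then show ?thesis using True by simp
  next
    case False
    have "(\<Sum>U\<in>{U\<in>W. b \<notin> U}. inflow B b U a s) = (\<Sum>U\<in>{U\<in>W. b \<in> U}. inflow B b (U - {b}) a s)"
      by (rule sum.reindex_bij_witness[where i = "\<lambda>U. U - {b}" and j = "insert b"])
         (use False S in \<open>auto simp: W_def\<close>)
    then show ?thesis using False by simp
  qed
  finally show ?thesis
    by (simp add: sum.distrib W_def conj_assoc)
qed

theorem killed_kernel_forward_equation:
  assumes S: "finite S" "a \<in> S" "b \<in> S" and T: "0 \<le> T"
  shows "killed_kernel B S a b T = of_bool (a = b) +
    (LINT s:{0<..<T}|lborel. \<Sum>c\<in>S. of_real (B c b) * killed_kernel B S a c s)"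
proof (cases "T = 0")
  case True
  then show ?thesis by (simp add: killed_kernel_def set_lebesgue_integral_def)
next
  case False
  then have T0: "0 < T" using T by simp
  define W where "W = {U. U \<subseteq> S \<and> a \<in> U \<and> b \<in> U}"
  have finW: "finite W" unfolding W_def by (rule finite_subset[of _ "Pow S"]) (use S in auto)
  define h where "h U s = (if a = b then 0 else inflow B b (U - {b}) a s) + inflow B b U a s" for U s
  have h: "set_integrable lborel {0<..<T} (h U)" if "U \<in> W" for U
  proof -
    have fin: "finite U" using that S(1) finite_subset by (auto simp: W_def)
    have "set_integrable lborel {0<..<T} (\<lambda>s. if a = b then 0 else inflow B b (U - {b}) a s)"
      using set_integrable_inflow[of "U - {b}"] fin
      by (cases "a = b") (auto simp: set_integrable_def)
    from set_integral_add(1)[OF this set_integrable_inflow[OF fin]] show ?thesis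
      unfolding h_def[abs_def] .
  qed
  have "killed_kernel B S a b T = (\<Sum>U\<in>W. range_weight B U a b T)"
    using T0 by (simp add: killed_kernel_def W_def)
  also have "\<dots> = (\<Sum>U\<in>W. of_bool (U = {b}) + (LINT s:{0<..<T}|lborel. h U s))"
    unfolding h_def
    by (rule sum.cong[OF refl], rule range_weight_recursion) (use T0 S finite_subset in \<open>auto simp: W_def\<close>)
  also have "\<dots> = (\<Sum>U\<in>W. of_bool (U = {b})) + (\<Sum>U\<in>W. LINT s:{0<..<T}|lborel. h U s)"
    by (rule sum.distrib)
  also have "(\<Sum>U\<in>W. of_bool (U = {b})) = (of_bool (a = b) :: complex)"
  proof (cases "a = b")
    case True
    then have "{b} \<in> W" using S by (simp add: W_def)
    then show ?thesis using True finW by (simp add: of_bool_def sum.delta)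
  next
    case False
    then have "{b} \<notin> W" by (simp add: W_def)
    then show ?thesis using False finW by (simp add: of_bool_def sum.delta)
  qed
  also have "(\<Sum>U\<in>W. LINT s:{0<..<T}|lborel. h U s) = (LINT s:{0<..<T}|lborel. \<Sum>U\<in>W. h U s)"
    using h unfolding set_lebesgue_integral_def set_integrable_def scaleR_sum_right
    by (subst Bochner_Integration.integral_sum) auto
  also have "\<dots> = (LINT s:{0<..<T}|lborel. \<Sum>c\<in>S. of_real (B c b) * killed_kernel B S a c s)"
    by (rule set_lebesgue_integral_cong)
       (use sum_inflow_subsets[OF S] in \<open>auto simp: h_def W_def\<close>)
  finally show ?thesis .
qed

text \<open>
  The integral equation makes its bounded solution continuous, then Lipschitz continuous; a second
  application bounds the error of an Euler step by a multiple of the squared step size.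
\<close>
lemma killed_kernel_step:
  assumes S: "finite S" "a \<in> S" and T: "0 < T"
  obtains K where "\<And>b t h. b \<in> S \<Longrightarrow> 0 \<le> t \<Longrightarrow> 0 \<le> h \<Longrightarrow> t + h \<le> T \<Longrightarrow>
      norm (killed_kernel B S a b (t + h) - killed_kernel B S a b t -
        of_real h * (\<Sum>c\<in>S. of_real (B c b) * killed_kernel B S a c t)) \<le> K * h\<^sup>2"
    and "\<And>b t. b \<in> S \<Longrightarrow> 0 \<le> t \<Longrightarrow> t \<le> T \<Longrightarrow> norm (killed_kernel B S a b t) \<le> K"
proof -
  define p where "p = killed_kernel B S a"
  define f where "f b s = (\<Sum>c\<in>S. of_real (B c b) * p c s)" for b s
  have fint: "set_integrable lborel {0<..<u} (f b)" for b u
    unfolding f_def[abs_def] set_integrable_def scaleR_sum_right p_def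
    by (intro Bochner_Integration.integrable_sum)
       (use set_integrable_killed_kernel[OF S(1), THEN set_integrable_mult_right] in \<open>auto simp: set_integrable_def\<close>)
  have eq: "p b t = of_bool (a = b) + integral {0..t} (f b)" and fi: "f b integrable_on {0..t}"
    if "b \<in> S" "0 \<le> t" for b t
  proof -
    have "(LINT s:{0<..<t}|lborel. f b s) = integral {0<..<t} (f b)" "f b integrable_on {0<..<t}"
      using set_borel_integral_eq_integral[OF fint] by blast+
    then show "p b t = of_bool (a = b) + integral {0..t} (f b)" "f b integrable_on {0..t}"
      using killed_kernel_forward_equation[OF S that(1,2), of B]
      by (auto simp: p_def f_def[abs_def] integral_open_interval_real integrable_on_open_interval_real)
  qed
  have cont: "continuous_on {0..T} (p b)" if "b \<in> S" for b
  proof -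
    have "continuous_on {0..T} (\<lambda>t. of_bool (a = b) + integral {0..t} (f b))"
      by (intro continuous_intros indefinite_integral_continuous_1 fi that) (use T in simp)
    then show ?thesis by (rule continuous_on_eq) (use eq that in auto)
  qed
  have "\<exists>M. \<forall>t\<in>{0..T}. norm (p b t) \<le> M" if "b \<in> S" for b
    using compact_imp_bounded[OF compact_continuous_image[OF cont[OF that] compact_Icc]]
    by (auto simp: bounded_iff)
  then obtain M where M: "\<And>b t. b \<in> S \<Longrightarrow> t \<in> {0..T} \<Longrightarrow> norm (p b t) \<le> M b" by metis
  define L where "L = (\<Sum>b\<in>S. \<Sum>c\<in>S. \<bar>B c b\<bar> * \<bar>M c\<bar>)"
  have L0: "0 \<le> L" unfolding L_def by (intro sum_nonneg) auto
  have fL: "norm (f b s) \<le> L" if "b \<in> S" "s \<in> {0..T}" for b s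
  proof -
    have "norm (f b s) \<le> (\<Sum>c\<in>S. \<bar>B c b\<bar> * \<bar>M c\<bar>)"
      unfolding f_def
      by (rule sum_norm_le) (use M that in \<open>auto simp: norm_mult intro!: mult_left_mono intro: order_trans[OF _ abs_ge_self]\<close>)
    also have "\<dots> \<le> L" unfolding L_def
      by (rule member_le_sum) (use S that in \<open>auto intro!: sum_nonneg\<close>)
    finally show ?thesis .
  qed
  have incr: "p b v - p b u = integral {u..v} (f b)" "f b integrable_on {u..v}"
    if "b \<in> S" "0 \<le> u" "u \<le> v" for b u v
  proof -
    have i: "f b integrable_on {0..v}" using fi that by auto
    have "integral {0..u} (f b) + integral {u..v} (f b) = integral {0..v} (f b)"
      by (rule Henstock_Kurzweil_Integration.integral_combine) (use that i in auto)
    then show "p b v - p b u = integral {u..v} (f b)"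
      using eq[OF that(1,2)] eq[OF that(1), of v] that by (simp add: algebra_simps)
    show "f b integrable_on {u..v}" by (rule integrable_on_subinterval[OF i]) (use that in auto)
  qed
  have lip: "norm (p b v - p b u) \<le> L * (v - u)" if "b \<in> S" "0 \<le> u" "u \<le> v" "v \<le> T" for b u v
  proof -
    have "norm (integral (cbox u v) (f b)) \<le> L * measure lborel (cbox u v)"
      by (rule has_integral_bound[OF L0 integrable_integral]) (use incr that fL in auto)
    then show ?thesis using incr(1) that by simp
  qed
  define L' where "L' = (\<Sum>b\<in>S. \<Sum>c\<in>S. \<bar>B c b\<bar> * L)"
  have L'0: "0 \<le> L'" unfolding L'_def using L0 by (intro sum_nonneg) auto
  have flip: "norm (f b v - f b u) \<le> L' * (v - u)" if "b \<in> S" "0 \<le> u" "u \<le> v" "v \<le> T" for b u v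
  proof -
    have "norm (f b v - f b u) = norm (\<Sum>c\<in>S. of_real (B c b) * (p c v - p c u))"
      unfolding f_def by (simp add: sum_subtractf algebra_simps)
    also have "\<dots> \<le> (\<Sum>c\<in>S. \<bar>B c b\<bar> * (L * (v - u)))"
      by (rule sum_norm_le) (use lip that in \<open>auto simp: norm_mult intro!: mult_left_mono\<close>)
    also have "\<dots> = (\<Sum>c\<in>S. \<bar>B c b\<bar> * L) * (v - u)" by (simp add: sum_distrib_right mult.assoc)
    also have "\<dots> \<le> L' * (v - u)"
      unfolding L'_def
      by (rule mult_right_mono[OF member_le_sum]) (use S that L0 in \<open>auto intro!: sum_nonneg\<close>)
    finally show ?thesis .
  qed
  have step: "norm (p b (t + h) - p b t - of_real h * f b t) \<le> L' * h\<^sup>2"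
    if "b \<in> S" "0 \<le> t" "0 \<le> h" "t + h \<le> T" for b t h
  proof -
    have i: "f b integrable_on {t..t + h}" using incr(2) that by auto
    have "p b (t + h) - p b t - of_real h * f b t = integral {t..t + h} (f b) - integral {t..t + h} (\<lambda>_. f b t)"
      using incr(1)[of b t "t + h"] that by (simp add: scaleR_conv_of_real)
    also have "\<dots> = integral {t..t + h} (\<lambda>s. f b s - f b t)"
      by (rule Henstock_Kurzweil_Integration.integral_diff[symmetric]) (use i in auto)
    also have "norm \<dots> \<le> (L' * h) * measure lborel (cbox t (t + h))"
    proof (unfold cbox_interval[symmetric], rule has_integral_bound[OF _ integrable_integral])
      show "0 \<le> L' * h" using L'0 that by simp
      show "(\<lambda>s. f b s - f b t) integrable_on cbox t (t + h)"
        using i by (intro integrable_diff) auto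
      fix s assume "s \<in> cbox t (t + h)"
      then have s: "t \<le> s" "s \<le> t + h" by auto
      have "norm (f b s - f b t) \<le> L' * (s - t)" using flip that s by auto
      also have "\<dots> \<le> L' * h" using s L'0 by (intro mult_left_mono) auto
      finally show "norm (f b s - f b t) \<le> L' * h" .
    qed
    finally show ?thesis using that by (simp add: power2_eq_square mult.assoc)
  qed
  define K where "K = L' + (\<Sum>b\<in>S. \<bar>M b\<bar>)"
  show thesis
  proof (rule that[of K])
    fix b t h assume *: "b \<in> S" "0 \<le> t" "0 \<le> h" "t + h \<le> T"
    have "L' * h\<^sup>2 \<le> K * h\<^sup>2" unfolding K_def by (intro mult_right_mono) (auto intro: sum_nonneg)
    then show "norm (killed_kernel B S a b (t + h) - killed_kernel B S a b t -
        of_real h * (\<Sum>c\<in>S. of_real (B c b) * killed_kernel B S a c t)) \<le> K * h\<^sup>2"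
      using step[OF *] unfolding f_def p_def by linarith
  next
    fix b t assume *: "b \<in> S" "0 \<le> t" "t \<le> T"
    have "norm (p b t) \<le> \<bar>M b\<bar>" using M[OF *(1), of t] * by auto
    also have "\<dots> \<le> (\<Sum>b\<in>S. \<bar>M b\<bar>)" by (rule member_le_sum) (use * S in auto)
    also have "\<dots> \<le> K" unfolding K_def using L'0 by simp
    finally show "norm (killed_kernel B S a b t) \<le> K" unfolding p_def .
  qed
qed

section \<open>Right-continuous paths and Riemann sums\<close>

text \<open>
  The index of the first point of the grid \<open>0, T/n, \<dots>, T\<close> that is not to the left of \<open>s\<close>. Right
  endpoints are the ones that a right-continuous path controls.
\<close>
definition grid_point :: "real \<Rightarrow> nat \<Rightarrow> real \<Rightarrow> nat" where
  "grid_point T n s = nat \<lceil>s * real n / T\<rceil>"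

text \<open>
  Right continuity for the discrete topology, at nonnegative times.
\<close>
definition step_path :: "(real \<Rightarrow> 'a) \<Rightarrow> bool" where
  "step_path f \<longleftrightarrow> (\<forall>s\<ge>0. eventually (\<lambda>t. f t = f s) (at_right s))"

lemma step_pathE:
  assumes "step_path f" "0 \<le> s"
  obtains d where "0 < d" "\<And>t. s \<le> t \<Longrightarrow> t < s + d \<Longrightarrow> f t = f s"
proof -
  from assms have "eventually (\<lambda>t. f t = f s) (at_right s)" by (simp add: step_path_def)
  then obtain b where b: "b > s" "\<forall>t>s. t < b \<longrightarrow> f t = f s"
    unfolding eventually_at_right_field by blast
  show thesis
  proof (rule that[of "b - s"])
    fix t assume "s \<le> t" "t < s + (b - s)"
    then show "f t = f s" using b(2) by (cases "t = s") auto
  qed (use b in simp)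
qed

lemma grid_point_bounds:
  assumes T: "0 < T" and n: "0 < n" and s: "0 \<le> s" "s \<le> T"
  shows "grid_point T n s \<le> n" "s \<le> real (grid_point T n s) * (T / n)"
    "real (grid_point T n s) * (T / n) < s + T / n"
proof -
  have nonneg: "0 \<le> s * real n / T" using assms by simp
  have "s * real n / T \<le> real n" using assms by (simp add: field_simps)
  then have "\<lceil>s * real n / T\<rceil> \<le> int n" by (intro ceiling_le) simp
  then show "grid_point T n s \<le> n" by (simp only: grid_point_def nat_le_iff)
  have eq: "real (grid_point T n s) = real_of_int \<lceil>s * real n / T\<rceil>"
    using nonneg by (simp add: grid_point_def)
  have "s * real n / T \<le> real (grid_point T n s)" unfolding eq by (rule le_of_int_ceiling)
  then show "s \<le> real (grid_point T n s) * (T / n)" using assms by (simp add: field_simps)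
  have "real (grid_point T n s) < s * real n / T + 1" unfolding eq by linarith
  then have "real (grid_point T n s) * (T / n) < (s * real n / T + 1) * (T / n)"
    using assms by (intro mult_strict_right_mono) auto
  also have "(s * real n / T + 1) * (T / n) = s + T / n" using T n by (simp add: field_simps)
  finally show "real (grid_point T n s) * (T / n) < s + T / n" .
qed

lemma eventually_mesh_less:
  assumes "0 < d" shows "\<forall>\<^sub>F n in sequentially. T / real n < d"
proof -
  have "(\<lambda>n. T / real n) \<longlonglongrightarrow> 0" by (rule lim_const_over_n)
  then show ?thesis using assms by (auto dest: order_tendstoD)
qed

text \<open>
  The grid point approaches \<open>s\<close> from the right, where the path is constant for a while.
\<close>
lemma eventually_grid_point:
  assumes f: "step_path f" and T: "0 < T" and s: "0 \<le> s" "s \<le> T"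
  shows "\<forall>\<^sub>F n in sequentially. f (real (grid_point T n s) * (T / n)) = f s"
proof -
  obtain d where d: "0 < d" "\<And>t. s \<le> t \<Longrightarrow> t < s + d \<Longrightarrow> f t = f s" using step_pathE[OF f s(1)] by blast
  show ?thesis
    using eventually_mesh_less[OF d(1), of T] eventually_gt_at_top[of 0]
  proof eventually_elim
    case (elim n)
    show ?case
      using grid_point_bounds(2,3)[OF T elim(2) s] elim(1) by (intro d(2)) linarith+
  qed
qed

lemma grid_point_unique:
  assumes T: "0 < T" and n: "0 < n" and s: "(real j - 1) * (T / n) < s" "s \<le> real j * (T / n)" and j: "1 \<le> j"
  shows "grid_point T n s = j"
proof -
  have "real j - 1 < s * real n / T" "s * real n / T \<le> real j"
    using s T n by (simp_all add: field_simps)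
  then have "\<lceil>s * real n / T\<rceil> = int j" by (intro ceiling_unique) auto
  then show ?thesis by (simp add: grid_point_def)
qed

lemma riemann_sum_as_integral:
  fixes c :: "nat \<Rightarrow> real"
  assumes T: "0 < T" and n: "0 < n"
  shows "has_bochner_integral lborel (\<lambda>s. indicator {0<..T} s * c (grid_point T n s)) (T / n * (\<Sum>j=1..n. c j))"
proof -
  define I where "I j = {(real j - 1) * (T / n)<..real j * (T / n)}" for j
  have h: "0 < T / n" using T n by simp
  have pw: "indicator {0<..T} s * c (grid_point T n s) = (\<Sum>j=1..n. c j * indicator (I j) s)" for s
  proof (cases "s \<in> {0<..T}")
    case True
    then have s: "0 < s" "s \<le> T" by auto
    define k where "k = grid_point T n s"
    have k: "k \<le> n" "s \<le> real k * (T / n)" "real k * (T / n) < s + T / n"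
      using grid_point_bounds[OF T n less_imp_le[OF s(1)] s(2)] by (auto simp: k_def)
    have k1: "1 \<le> k" using k(2) s(1) by (cases k) auto
    have "s \<in> I j \<longleftrightarrow> j = k" if "j \<in> {1..n}" for j
    proof
      assume "s \<in> I j" then show "j = k" using grid_point_unique[OF T n] that by (auto simp: I_def k_def)
    next
      have "(real k - 1) * (T / n) = real k * (T / n) - T / n" using n by (simp add: field_simps)
      moreover assume "j = k"
      ultimately show "s \<in> I j" using k(2,3) by (simp add: I_def)
    qed
    then have "(\<Sum>j=1..n. c j * indicator (I j) s) = (\<Sum>j=1..n. if j = k then c j else 0)"
      by (intro sum.cong) (auto simp: indicator_def)
    also have "\<dots> = c k" using k k1 by (simp add: sum.delta)
    finally show ?thesis using True by (simp add: k_def)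
  next
    case False
    have "s \<notin> I j" if "j \<in> {1..n}" for j
    proof
      assume "s \<in> I j"
      then have "(real j - 1) * (T / n) < s" "s \<le> real j * (T / n)" by (auto simp: I_def)
      moreover have "0 \<le> (real j - 1) * (T / n)" by (intro mult_nonneg_nonneg) (use that h in auto)
      moreover have "real j * (T / n) \<le> real n * (T / n)" using that h by (intro mult_right_mono) auto
      ultimately show False using False n by auto
    qed
    then show ?thesis using False by simp
  qed
  have le: "(real j - 1) * (T / n) \<le> real j * (T / n)" for j using h by (intro mult_right_mono) auto
  have fin: "emeasure lborel (I j) < \<infinity>" and meas: "I j \<in> sets lborel" for j
    unfolding I_def by (simp_all only: emeasure_lborel_Ioc[OF le]) auto
  have "has_bochner_integral lborel (\<lambda>s. \<Sum>j=1..n. c j * indicator (I j) s) (\<Sum>j=1..n. c j * measure lborel (I j))"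
    by (intro has_bochner_integral_sum has_bochner_integral_mult_right has_bochner_integral_real_indicator)
       (rule meas fin)+
  moreover have "measure lborel (I j) = T / n" for j
    using n unfolding I_def by (subst measure_lborel_Ioc[OF le]) (simp add: field_simps)
  ultimately show ?thesis unfolding pw by (simp add: sum_distrib_left sum_distrib_right mult.commute)
qed

lemma riemann_sum_limit:
  fixes c :: "'a \<Rightarrow> real"
  assumes f: "step_path f" and T: "0 < T" and c: "\<And>x. \<bar>c x\<bar> \<le> M"
  shows "(\<lambda>n. T / n * (\<Sum>j=1..n. c (f (real j * (T / n))))) \<longlonglongrightarrow> (LINT s:{0..T}|lborel. c (f s))"
    and "set_integrable lborel {0..T} (\<lambda>s. c (f s))"
proof -
  define g where "g n s = indicator {0<..T} s * c (f (real (grid_point T n s) * (T / n)))" for n s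
  have hb: "has_bochner_integral lborel (g n) (T / n * (\<Sum>j=1..n. c (f (real j * (T / n)))))" if "0 < n" for n
    unfolding g_def[abs_def] by (rule riemann_sum_as_integral[OF T that])
  have gm: "g (Suc n) \<in> borel_measurable lborel" for n
    using hb[of "Suc n"] by (auto simp: has_bochner_integral_iff)
  have lim: "(\<lambda>n. g (Suc n) s) \<longlonglongrightarrow> indicator {0<..T} s * c (f s)" for s
  proof (cases "s \<in> {0<..T}")
    case True
    then have "\<forall>\<^sub>F n in sequentially. f (real (grid_point T n s) * (T / n)) = f s"
      by (intro eventually_grid_point[OF f T]) auto
    then have "\<forall>\<^sub>F n in sequentially. g n s = indicator {0<..T} s * c (f s)"
      by eventually_elim (simp add: g_def)
    then have "(\<lambda>n. g n s) \<longlonglongrightarrow> indicator {0<..T} s * c (f s)" by (rule tendsto_eventually)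
    then show ?thesis by (rule LIMSEQ_Suc)
  qed (simp add: g_def)
  have lm: "(\<lambda>s. indicator {0<..T} s * c (f s)) \<in> borel_measurable lborel"
    by (rule borel_measurable_LIMSEQ_real[OF lim gm])
  have w: "integrable lborel (\<lambda>s. M * indicator {0<..T} s)"
    using T by simp
  have bound: "AE s in lborel. norm (g (Suc n) s) \<le> M * indicator {0<..T} s" for n
    using c by (auto simp: g_def indicator_def)
  have dom: "integrable lborel (\<lambda>s. indicator {0<..T} s * c (f s))"
    "(\<lambda>n. integral\<^sup>L lborel (g (Suc n))) \<longlonglongrightarrow> (\<integral>s. indicator {0<..T} s * c (f s) \<partial>lborel)"
    using integrable_dominated_convergence[OF lm gm w AE_I2[OF lim] bound]
      integral_dominated_convergence[OF lm gm w AE_I2[OF lim] bound] by auto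
  have ae: "AE s in lborel. indicator {0<..T} s * c (f s) = indicator {0..T} s * c (f s)"
    using AE_lborel_singleton[of 0] by eventually_elim (auto simp: indicator_def)
  have "(\<lambda>s. indicator {0..T} s * c (f s)) = (\<lambda>s. indicator {0<..T} s * c (f s) + indicator {0} s * c (f 0))"
    using T by (auto simp: indicator_def fun_eq_iff)
  then have m0: "(\<lambda>s. indicator {0..T} s * c (f s)) \<in> borel_measurable lborel" using lm by simp
  show "set_integrable lborel {0..T} (\<lambda>s. c (f s))"
    unfolding set_integrable_def real_scaleR_def
    by (rule integrable_cong_AE_imp[OF dom(1) m0]) (use ae in \<open>simp only: eq_commute\<close>)
  have "(\<integral>s. indicator {0<..T} s * c (f s) \<partial>lborel) = (LINT s:{0..T}|lborel. c (f s))"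
    unfolding set_lebesgue_integral_def real_scaleR_def by (rule integral_cong_AE[OF lm m0 ae])
  with dom(2) have "(\<lambda>n. T / Suc n * (\<Sum>j=1..Suc n. c (f (real j * (T / Suc n))))) \<longlonglongrightarrow> (LINT s:{0..T}|lborel. c (f s))"
    using has_bochner_integral_integral_eq[OF hb[OF zero_less_Suc]] by simp
  then show "(\<lambda>n. T / n * (\<Sum>j=1..n. c (f (real j * (T / n))))) \<longlonglongrightarrow> (LINT s:{0..T}|lborel. c (f s))"
    by (subst (asm) filterlim_sequentially_Suc[where f = "\<lambda>n. T / n * (\<Sum>j=1..n. c (f (real j * (T / n))))"])
qed

text \<open>
  A product of functions supported on a finite set \<open>S\<close> is a finite sum over the \<open>S\<close>-valued paths, of
  which at most one coincides with \<open>Y\<close>.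
\<close>
lemma sum_over_paths:
  fixes \<psi> :: "'a \<Rightarrow> real" and n :: nat
  assumes S: "finite S" and \<psi>: "\<And>x. x \<notin> S \<Longrightarrow> \<psi> x = 0"
  shows "(\<Prod>j\<le>n. \<psi> (Y j)) = (\<Sum>\<xi>\<in>PiE {..n} (\<lambda>_. S). (\<Prod>j\<le>n. \<psi> (\<xi> j)) * of_bool (\<forall>j\<le>n. Y j = \<xi> j))"
proof (cases "\<forall>j\<le>n. Y j \<in> S")
  case True
  then have mem: "restrict Y {..n} \<in> PiE {..n} (\<lambda>_. S)" by auto
  have "(\<forall>j\<le>n. Y j = \<xi> j) \<longleftrightarrow> \<xi> = restrict Y {..n}" if "\<xi> \<in> PiE {..n} (\<lambda>_. S)" for \<xi>
    using that by (auto simp: fun_eq_iff PiE_def extensional_def)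
  then have "(\<Sum>\<xi>\<in>PiE {..n} (\<lambda>_. S). (\<Prod>j\<le>n. \<psi> (\<xi> j)) * of_bool (\<forall>j\<le>n. Y j = \<xi> j)) =
      (\<Sum>\<xi>\<in>PiE {..n} (\<lambda>_. S). if \<xi> = restrict Y {..n} then (\<Prod>j\<le>n. \<psi> (\<xi> j)) else 0)"
    by (intro sum.cong) auto
  also have "\<dots> = (\<Prod>j\<le>n. \<psi> (restrict Y {..n} j))"
    using mem S by (subst sum.delta) (auto intro!: finite_PiE)
  finally show ?thesis by simp
next
  case False
  then obtain j where j: "j \<le> n" "Y j \<notin> S" by auto
  then have "\<psi> (Y j) = 0" using \<psi> by blast
  then have "(\<Prod>j\<le>n. \<psi> (Y j)) = 0" using j(1) by (intro prod_zero) auto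
  moreover have "\<not> (\<forall>j\<le>n. Y j = \<xi> j)" if "\<xi> \<in> PiE {..n} (\<lambda>_. S)" for \<xi>
    using that j by (auto simp: PiE_def Pi_def)
  then have "(\<Sum>\<xi>\<in>PiE {..n} (\<lambda>_. S). (\<Prod>j\<le>n. \<psi> (\<xi> j)) * of_bool (\<forall>j\<le>n. Y j = \<xi> j)) = 0"
    by (intro sum.neutral ballI) (simp only: of_bool_eq mult_zero_right)
  ultimately show ?thesis by simp
qed

section \<open>The chain observed on a time grid\<close>

text \<open>
  Killing outside \<open>S\<close> and at rate \<open>V\<close> inside, over one step of length \<open>h\<close>.
\<close>
definition mesh_weight :: "'a set \<Rightarrow> ('a \<Rightarrow> real) \<Rightarrow> real \<Rightarrow> 'a \<Rightarrow> real" where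
  "mesh_weight S V h x = (if x \<in> S then exp (- (h * V x)) else 0)"

lemma mesh_weight_bounds: "\<lbrakk>\<And>x. 0 \<le> V x; 0 \<le> h\<rbrakk> \<Longrightarrow> 0 \<le> mesh_weight S V h x \<and> mesh_weight S V h x \<le> 1"
  by (simp add: mesh_weight_def)

lemma prod_mesh_weight:
  fixes n :: nat
  assumes S: "finite S" and Y: "\<And>j. j \<le> n \<Longrightarrow> Y j \<in> S"
  shows "(\<Prod>j\<le>n. mesh_weight S V h (Y j)) =
    exp (- (\<Sum>x\<in>S. V x * (h * indicator {x} (Y 0) + h * (\<Sum>j=1..n. indicator {x} (Y j)))))"
proof -
  have V: "V (Y j) = (\<Sum>x\<in>S. V x * indicator {x} (Y j))" if "j \<le> n" for j
  proof -
    have "(\<Sum>x\<in>S. V x * indicator {x} (Y j)) = (\<Sum>x\<in>S. if x = Y j then V x else 0)"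
      by (intro sum.cong) (auto simp: indicator_def)
    then show ?thesis using S Y[OF that] by (simp add: sum.delta)
  qed
  have "(\<Prod>j\<le>n. mesh_weight S V h (Y j)) = exp (\<Sum>j\<le>n. - (h * V (Y j)))"
    using Y by (simp add: exp_sum mesh_weight_def)
  also have "(\<Sum>j\<le>n. - (h * V (Y j))) = (\<Sum>j\<le>n. \<Sum>x\<in>S. - (V x * (h * indicator {x} (Y j))))"
    by (rule sum.cong[OF refl]) (simp add: V sum_distrib_left sum_negf algebra_simps)
  also have "\<dots> = (\<Sum>x\<in>S. \<Sum>j\<le>n. - (V x * (h * indicator {x} (Y j))))"
    by (rule sum.swap)
  also have "\<dots> = - (\<Sum>x\<in>S. V x * (\<Sum>j\<le>n. h * indicator {x} (Y j)))"
    by (simp only: sum_negf sum_distrib_left)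
  also have "(\<lambda>x. \<Sum>j\<le>n. h * indicator {x} (Y j)) =
      (\<lambda>x. h * indicator {x} (Y 0) + h * (\<Sum>j=1..n. indicator {x} (Y j)) :: real)"
  proof
    fix x
    have "{..n} = insert 0 {1..n}" by auto
    then have "(\<Sum>j\<le>n. g j) = g 0 + (\<Sum>j=1..n. g j)" for g :: "nat \<Rightarrow> real" by simp
    then show "(\<Sum>j\<le>n. h * indicator {x} (Y j)) =
        (h * indicator {x} (Y 0) + h * (\<Sum>j=1..n. indicator {x} (Y j)) :: real)"
      unfolding sum_distrib_left .
  qed
  finally show ?thesis .
qed

context continuous_time_markov_chain
begin

definition transition :: "real \<Rightarrow> 'a \<Rightarrow> 'a \<Rightarrow> real" where
  "transition t x y = measure (P x) {\<omega> \<in> space (P x). X t \<omega> = y}"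

lemma prob_space_P: "prob_space (P x)" by (rule prob_space)

lemma sample_path_is_step_path: "\<omega> \<in> space (P x) \<Longrightarrow> step_path (\<lambda>t. X t \<omega>)"
  using right_continuous by (auto simp: step_path_def)

lemma sets_X_eq: "0 \<le> t \<Longrightarrow> {\<omega> \<in> space (P x). X t \<omega> = y} \<in> sets (P x)"
  using measurable_sets[OF measurable_X[of t x], of "{y}"] by (simp add: vimage_def Int_def conj_commute)

lemma sets_path_eq:
  fixes n :: nat
  assumes u: "\<And>i. i \<le> n \<Longrightarrow> 0 \<le> u i"
  shows "{\<omega> \<in> space (P x). \<forall>i\<le>n. X (u i) \<omega> = \<xi> i} \<in> sets (P x)"
proof -
  have "{\<omega> \<in> space (P x). \<forall>i\<in>{..n}. X (u i) \<omega> = \<xi> i} \<in> sets (P x)"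
    by (rule sets.sets_Collect_finite_All) (use u sets_X_eq in auto)
  then show ?thesis unfolding Ball_def atMost_iff .
qed

lemma transition_bounds: "0 \<le> transition t x y" "transition t x y \<le> 1"
  using prob_space.prob_le_1[OF prob_space_P] by (auto simp: transition_def)

lemma sum_transition_le:
  assumes "finite S" "0 \<le> t"
  shows "(\<Sum>y\<in>S. transition t x y) \<le> 1"
proof -
  interpret prob_space "P x" by (rule prob_space_P)
  have "(\<Sum>y\<in>S. transition t x y) = prob (\<Union>y\<in>S. {\<omega> \<in> space (P x). X t \<omega> = y})"
    unfolding transition_def
    by (rule finite_measure_finite_Union[symmetric])
       (use assms sets_X_eq in \<open>auto simp: disjoint_family_on_def\<close>)
  then show ?thesis by simp
qed

lemma transition_0: "transition 0 x y = of_bool (x = y)"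
proof -
  interpret prob_space "P x" by (rule prob_space_P)
  show ?thesis
  proof (cases "x = y")
    case True
    have "prob {\<omega> \<in> space (P x). X 0 \<omega> = x} = 1"
      using start[of x] sets_X_eq[of 0 x x] by (subst prob_Collect_eq_1) auto
    then show ?thesis using True by (simp add: transition_def)
  next
    case False
    have "AE \<omega> in P x. \<not> X 0 \<omega> = y" using start[of x] by eventually_elim (use False in auto)
    then have "prob {\<omega> \<in> space (P x). X 0 \<omega> = y} = 0"
      using sets_X_eq[of 0 x y] by (subst prob_Collect_eq_0) auto
    then show ?thesis using False by (simp add: transition_def)
  qed
qed

lemma transition_tendsto:
  assumes "\<And>n. 0 < h n" "h \<longlonglongrightarrow> 0"
  shows "(\<lambda>n. transition (h n) x y) \<longlonglongrightarrow> of_bool (x = y)"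
proof -
  have "continuous (at 0 within {0..}) (\<lambda>t. transition t x y)"
    unfolding transition_def by (rule DERIV_continuous[OF generator])
  then have "((\<lambda>t. transition t x y) \<longlongrightarrow> of_bool (x = y)) (at 0 within {0..})"
    by (simp add: continuous_within transition_0)
  moreover have "filterlim h (at 0 within {0..}) sequentially"
    unfolding filterlim_at using assms by (auto intro!: always_eventually less_imp_le less_imp_neq[symmetric])
  ultimately show ?thesis by (rule filterlim_compose)
qed

text \<open>
  The weight at time \<open>0\<close> is included in order to have a uniform product; it tends to \<open>1\<close> as \<open>h\<close> tends
  to \<open>0\<close>.
\<close>
definition mesh_mean :: "'a set \<Rightarrow> ('a \<Rightarrow> real) \<Rightarrow> 'a \<Rightarrow> real \<Rightarrow> nat \<Rightarrow> 'a \<Rightarrow> real" where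
  "mesh_mean S V a h n y =
     (\<integral>\<omega>. (\<Prod>j\<le>n. mesh_weight S V h (X (real j * h) \<omega>)) * of_bool (X (real n * h) \<omega> = y) \<partial>P a)"

lemma path_expansion:
  assumes S: "finite S" and h: "0 \<le> h" and \<psi>: "\<And>x. x \<notin> S \<Longrightarrow> \<psi> x = 0"
    and E: "\<And>\<xi>. {\<omega> \<in> space (P a). (\<forall>j\<le>n. X (real j * h) \<omega> = \<xi> j) \<and> E \<omega>} \<in> sets (P a)"
  shows "(\<integral>\<omega>. (\<Prod>j\<le>n. \<psi> (X (real j * h) \<omega>)) * of_bool (E \<omega>) \<partial>P a) =
    (\<Sum>\<xi>\<in>PiE {..n} (\<lambda>_. S). (\<Prod>j\<le>n. \<psi> (\<xi> j)) *
       measure (P a) {\<omega> \<in> space (P a). (\<forall>j\<le>n. X (real j * h) \<omega> = \<xi> j) \<and> E \<omega>})"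
proof -
  interpret prob_space "P a" by (rule prob_space_P)
  let ?N = "\<lambda>\<xi>. {\<omega> \<in> space (P a). (\<forall>j\<le>n. X (real j * h) \<omega> = \<xi> j) \<and> E \<omega>}"
  have "(\<integral>\<omega>. (\<Prod>j\<le>n. \<psi> (X (real j * h) \<omega>)) * of_bool (E \<omega>) \<partial>P a) =
      (\<integral>\<omega>. (\<Sum>\<xi>\<in>PiE {..n} (\<lambda>_. S). (\<Prod>j\<le>n. \<psi> (\<xi> j)) * indicator (?N \<xi>) \<omega>) \<partial>P a)"
  proof (rule Bochner_Integration.integral_cong[OF refl])
    fix \<omega> assume \<omega>: "\<omega> \<in> space (P a)"
    have expand: "(\<Prod>j\<le>n. \<psi> (X (real j * h) \<omega>)) = (\<Sum>\<xi>\<in>PiE {..n} (\<lambda>_. S).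
        (\<Prod>j\<le>n. \<psi> (\<xi> j)) * of_bool (\<forall>j\<le>n. X (real j * h) \<omega> = \<xi> j))"
      by (rule sum_over_paths[OF S \<psi>])
    show "(\<Prod>j\<le>n. \<psi> (X (real j * h) \<omega>)) * of_bool (E \<omega>) =
        (\<Sum>\<xi>\<in>PiE {..n} (\<lambda>_. S). (\<Prod>j\<le>n. \<psi> (\<xi> j)) * indicator (?N \<xi>) \<omega>)"
      unfolding expand sum_distrib_right
      by (rule sum.cong) (use \<omega> in \<open>auto simp: indicator_def\<close>)
  qed
  also have "\<dots> = (\<Sum>\<xi>\<in>PiE {..n} (\<lambda>_. S). (\<Prod>j\<le>n. \<psi> (\<xi> j)) * measure (P a) (?N \<xi>))"
  proof (subst Bochner_Integration.integral_sum)
    have fin: "emeasure (P a) (?N \<xi>) < \<infinity>" for \<xi> by (simp only: emeasure_eq_measure ennreal_less_top infinity_ennreal_def)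
    show "integrable (P a) (\<lambda>\<omega>. (\<Prod>j\<le>n. \<psi> (\<xi> j)) * indicator (?N \<xi>) \<omega>)" for \<xi>
      by (rule integrable_mult_right, rule integrable_real_indicator[OF E fin])
    have "?N \<xi> \<inter> space (P a) = ?N \<xi>" for \<xi> by blast
    note space = this
    show "(\<Sum>\<xi>\<in>PiE {..n} (\<lambda>_. S). \<integral>\<omega>. (\<Prod>j\<le>n. \<psi> (\<xi> j)) * indicator (?N \<xi>) \<omega> \<partial>P a) =
        (\<Sum>\<xi>\<in>PiE {..n} (\<lambda>_. S). (\<Prod>j\<le>n. \<psi> (\<xi> j)) * measure (P a) (?N \<xi>))"
      by (simp only: integral_mult_right_zero Bochner_Integration.integral_indicator space)
  qed
  finally show ?thesis .
qed

text \<open>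
  The Markov property speaks of single paths. As \<open>S\<close> is finite, the mean is a finite sum
  over paths, and the property applies to each term.
\<close>
lemma mesh_mean_recursion:
  assumes S: "finite S" "y \<in> S" and h: "0 < h"
  shows "mesh_mean S V a h (Suc n) y =
    (\<Sum>x\<in>S. mesh_mean S V a h n x * (transition h x y * exp (- (h * V y))))"
proof -
  let ?\<psi> = "mesh_weight S V h"
  let ?Pi = "PiE {..n} (\<lambda>_. S)"
  let ?N = "\<lambda>\<xi>. {\<omega> \<in> space (P a). \<forall>j\<le>n. X (real j * h) \<omega> = \<xi> j}"
  have \<psi>: "x \<notin> S \<Longrightarrow> ?\<psi> x = 0" for x by (simp add: mesh_weight_def)
  have setN: "?N \<xi> \<in> sets (P a)" for \<xi> by (rule sets_path_eq) (use h in auto)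
  have mean: "mesh_mean S V a h n x = (\<Sum>\<xi>\<in>?Pi. (\<Prod>j\<le>n. ?\<psi> (\<xi> j)) * (of_bool (\<xi> n = x) * measure (P a) (?N \<xi>)))" for x
  proof -
    have eq: "{\<omega> \<in> space (P a). (\<forall>j\<le>n. X (real j * h) \<omega> = \<xi> j) \<and> X (real n * h) \<omega> = x} =
        (if \<xi> n = x then ?N \<xi> else {})" for \<xi>
      by auto
    have "mesh_mean S V a h n x = (\<Sum>\<xi>\<in>?Pi. (\<Prod>j\<le>n. ?\<psi> (\<xi> j)) *
       measure (P a) {\<omega> \<in> space (P a). (\<forall>j\<le>n. X (real j * h) \<omega> = \<xi> j) \<and> X (real n * h) \<omega> = x})"
      unfolding mesh_mean_def
    proof (rule path_expansion[where S = S and h = h and \<psi> = "?\<psi>" and n = n and a = a and E = "\<lambda>\<omega>. X (real n * h) \<omega> = x"])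
      show "finite S" "0 \<le> h" "\<And>x. x \<notin> S \<Longrightarrow> ?\<psi> x = 0" using S h \<psi> by auto
      show "{\<omega> \<in> space (P a). (\<forall>j\<le>n. X (real j * h) \<omega> = \<xi> j) \<and> X (real n * h) \<omega> = x} \<in> sets (P a)" for \<xi>
        unfolding eq by (cases "\<xi> n = x") (simp_all only: simp_thms if_True if_False sets.empty_sets setN)
    qed
    moreover have "measure (P a) {\<omega> \<in> space (P a). (\<forall>j\<le>n. X (real j * h) \<omega> = \<xi> j) \<and> X (real n * h) \<omega> = x} =
        of_bool (\<xi> n = x) * measure (P a) (?N \<xi>)" for \<xi>
      unfolding eq by (cases "\<xi> n = x") simp_all
    ultimately show ?thesis by (simp only:)
  qed
  have markov: "{\<omega> \<in> space (P a). (\<forall>j\<le>n. X (real j * h) \<omega> = \<xi> j) \<and> X (real (Suc n) * h) \<omega> = y} \<in> sets (P a)"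
    "measure (P a) {\<omega> \<in> space (P a). (\<forall>j\<le>n. X (real j * h) \<omega> = \<xi> j) \<and> X (real (Suc n) * h) \<omega> = y} =
     measure (P a) (?N \<xi>) * transition h (\<xi> n) y" for \<xi>
  proof -
    let ?\<xi> = "\<xi>(Suc n := y)"
    have eq: "{\<omega> \<in> space (P a). (\<forall>j\<le>n. X (real j * h) \<omega> = \<xi> j) \<and> X (real (Suc n) * h) \<omega> = y} =
        {\<omega> \<in> space (P a). \<forall>j\<le>Suc n. X (real j * h) \<omega> = ?\<xi> j}"
      by (auto simp: le_Suc_eq)
    show "{\<omega> \<in> space (P a). (\<forall>j\<le>n. X (real j * h) \<omega> = \<xi> j) \<and> X (real (Suc n) * h) \<omega> = y} \<in> sets (P a)"
      unfolding eq by (rule sets_path_eq) (use h in auto)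
    have "measure (P a) {\<omega> \<in> space (P a). \<forall>j\<le>Suc n. X (real j * h) \<omega> = ?\<xi> j} =
        measure (P a) {\<omega> \<in> space (P a). \<forall>j\<le>n. X (real j * h) \<omega> = ?\<xi> j} *
        measure (P (?\<xi> n)) {\<omega> \<in> space (P (?\<xi> n)). X (real (Suc n) * h - real n * h) \<omega> = ?\<xi> (Suc n)}"
      by (rule markov_property[where u = "\<lambda>j. real j * h" and n = n]) (use h in auto)
    moreover have "real (Suc n) * h - real n * h = h" by (simp add: algebra_simps)
    moreover have "{\<omega> \<in> space (P a). \<forall>j\<le>n. X (real j * h) \<omega> = ?\<xi> j} = ?N \<xi>" by auto
    ultimately show "measure (P a) {\<omega> \<in> space (P a). (\<forall>j\<le>n. X (real j * h) \<omega> = \<xi> j) \<and> X (real (Suc n) * h) \<omega> = y} =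
        measure (P a) (?N \<xi>) * transition h (\<xi> n) y"
      unfolding eq transition_def by simp
  qed
  have "mesh_mean S V a h (Suc n) y = (\<integral>\<omega>. exp (- (h * V y)) * ((\<Prod>j\<le>n. ?\<psi> (X (real j * h) \<omega>)) *
      of_bool (X (real (Suc n) * h) \<omega> = y)) \<partial>P a)"
    unfolding mesh_mean_def
    by (rule Bochner_Integration.integral_cong[OF refl]) (use S(2) in \<open>auto simp: mesh_weight_def\<close>)
  also have "\<dots> = exp (- (h * V y)) * (\<Sum>\<xi>\<in>?Pi. (\<Prod>j\<le>n. ?\<psi> (\<xi> j)) * (measure (P a) (?N \<xi>) * transition h (\<xi> n) y))"
  proof -
    have "(\<integral>\<omega>. (\<Prod>j\<le>n. ?\<psi> (X (real j * h) \<omega>)) * of_bool (X (real (Suc n) * h) \<omega> = y) \<partial>P a) =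
        (\<Sum>\<xi>\<in>?Pi. (\<Prod>j\<le>n. ?\<psi> (\<xi> j)) *
          measure (P a) {\<omega> \<in> space (P a). (\<forall>j\<le>n. X (real j * h) \<omega> = \<xi> j) \<and> X (real (Suc n) * h) \<omega> = y})"
      by (rule path_expansion[where S = S and h = h and \<psi> = "?\<psi>" and n = n and a = a and E = "\<lambda>\<omega>. X (real (Suc n) * h) \<omega> = y"])
         (rule S(1) less_imp_le[OF h] \<psi> markov(1) | assumption)+
    then show ?thesis unfolding integral_mult_right_zero markov(2) by (rule arg_cong)
  qed
  also have "(\<Sum>\<xi>\<in>?Pi. (\<Prod>j\<le>n. ?\<psi> (\<xi> j)) * (measure (P a) (?N \<xi>) * transition h (\<xi> n) y)) =
     (\<Sum>\<xi>\<in>?Pi. \<Sum>x\<in>S. (\<Prod>j\<le>n. ?\<psi> (\<xi> j)) * (of_bool (\<xi> n = x) * measure (P a) (?N \<xi>)) * transition h x y)"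
  proof (rule sum.cong[OF refl])
    fix \<xi> assume "\<xi> \<in> ?Pi"
    then have "\<xi> n \<in> S" by auto
    then show "(\<Prod>j\<le>n. ?\<psi> (\<xi> j)) * (measure (P a) (?N \<xi>) * transition h (\<xi> n) y) =
        (\<Sum>x\<in>S. (\<Prod>j\<le>n. ?\<psi> (\<xi> j)) * (of_bool (\<xi> n = x) * measure (P a) (?N \<xi>)) * transition h x y)"
      using S(1) by (subst sum.remove[of _ "\<xi> n"]) (auto intro!: sum.neutral)
  qed
  also have "\<dots> = (\<Sum>x\<in>S. mesh_mean S V a h n x * transition h x y)"
    unfolding mean sum_distrib_right by (rule sum.swap)
  finally show ?thesis by (simp add: sum_distrib_left mult_ac)
qed

lemma mesh_mean_0:
  assumes "a \<in> S" "y \<in> S"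
  shows "mesh_mean S V a h 0 y = of_bool (a = y) * exp (- (h * V a))"
proof -
  interpret prob_space "P a" by (rule prob_space_P)
  have m: "X 0 \<in> measurable (P a) (count_space UNIV)" by (rule measurable_X) simp
  have "mesh_mean S V a h 0 y = (\<integral>\<omega>. of_bool (a = y) * exp (- (h * V a)) \<partial>P a)"
    unfolding mesh_mean_def
  proof (rule integral_cong_AE)
    show "(\<lambda>\<omega>. (\<Prod>j\<le>0. mesh_weight S V h (X (real j * h) \<omega>)) * of_bool (X (real 0 * h) \<omega> = y)) \<in> borel_measurable (P a)"
      using measurable_compose[OF m, of "\<lambda>x. mesh_weight S V h x * of_bool (x = y)" borel] by simp
    show "AE \<omega> in P a. (\<Prod>j\<le>0. mesh_weight S V h (X (real j * h) \<omega>)) * of_bool (X (real 0 * h) \<omega> = y) =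
        of_bool (a = y) * exp (- (h * V a))"
      using start[of a] by eventually_elim (use assms in \<open>auto simp: mesh_weight_def\<close>)
  qed simp
  then show ?thesis by (simp add: prob_space)
qed

definition killed_generator :: "('a \<Rightarrow> real) \<Rightarrow> 'a \<Rightarrow> 'a \<Rightarrow> real" where
  "killed_generator V x y = A x y - (if x = y then V x else 0)"

lemma killed_transition_derivative:
  assumes "\<And>n. 0 < h n" "h \<longlonglongrightarrow> 0"
  shows "(\<lambda>n. (transition (h n) x y * exp (- (h n * V y)) - of_bool (x = y)) / h n - killed_generator V x y) \<longlonglongrightarrow> 0"
proof -
  let ?f = "\<lambda>t. transition t x y * exp (- (t * V y))"
  have "(?f has_real_derivative A x y * exp (- (0 * V y)) + (- (1 * V y)) * exp (- (0 * V y)) * transition 0 x y) (at 0 within {0..})"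
    using generator[of x y, folded transition_def] by (auto intro!: derivative_eq_intros)
  then have "(?f has_real_derivative killed_generator V x y) (at 0 within {0..})"
    by (rule DERIV_cong) (simp add: killed_generator_def transition_0)
  then have "((\<lambda>t. (?f t - ?f 0) / (t - 0)) \<longlongrightarrow> killed_generator V x y) (at 0 within {0..})"
    by (simp add: has_field_derivative_iff)
  moreover have "filterlim h (at 0 within {0..}) sequentially"
    unfolding filterlim_at using assms by (auto intro!: always_eventually less_imp_le less_imp_neq[symmetric])
  ultimately have "(\<lambda>n. (?f (h n) - ?f 0) / (h n - 0)) \<longlonglongrightarrow> killed_generator V x y"
    by (rule filterlim_compose)
  then show ?thesis
    by (intro LIM_zero) (simp add: transition_0)
qed

text \<open>
  Stability: one step of the killed chain is a substochastic matrix, so errors do not grow, and the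
  defect of the kernel in one step is of order \<open>h (\<eta> + h)\<close>. Here \<open>\<eta>\<close> measures how far the difference
  quotient of the transition function at \<open>0\<close> is from \<open>B\<close>.
\<close>
lemma mesh_mean_error:
  assumes S: "finite S" "a \<in> S" and V: "\<And>x. 0 \<le> V x" and h: "0 < h" and N: "real N * h \<le> T" and K: "0 \<le> K"
    and step: "\<And>b t. b \<in> S \<Longrightarrow> 0 \<le> t \<Longrightarrow> t + h \<le> T \<Longrightarrow>
      norm (killed_kernel B S a b (t + h) - killed_kernel B S a b t -
        of_real h * (\<Sum>c\<in>S. of_real (B c b) * killed_kernel B S a c t)) \<le> K * h\<^sup>2"
    and bound: "\<And>b t. b \<in> S \<Longrightarrow> 0 \<le> t \<Longrightarrow> t \<le> T \<Longrightarrow> norm (killed_kernel B S a b t) \<le> K"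
  defines "\<eta> \<equiv> \<Sum>x\<in>S. \<Sum>y\<in>S. \<bar>(transition h x y * exp (- (h * V y)) - of_bool (x = y)) / h - B x y\<bar>"
  shows "n \<le> N \<Longrightarrow> (\<Sum>y\<in>S. norm (of_real (mesh_mean S V a h n y) - killed_kernel B S a y (real n * h))) \<le>
    \<bar>exp (- (h * V a)) - 1\<bar> + real n * (K * (h * \<eta>) + real (card S) * (K * h\<^sup>2))"
proof (induction n)
  case 0
  have "(\<Sum>y\<in>S. norm (of_real (mesh_mean S V a h 0 y) - killed_kernel B S a y (real 0 * h))) =
      (\<Sum>y\<in>S. if y = a then \<bar>exp (- (h * V a)) - 1\<bar> else 0)"
  proof (rule sum.cong[OF refl])
    fix y assume y: "y \<in> S"
    have "complex_of_real (exp (- (h * V a))) - 1 = of_real (exp (- (h * V a)) - 1)" by simp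
    then have "norm (complex_of_real (exp (- (h * V a))) - 1) = \<bar>exp (- (h * V a)) - 1\<bar>"
      by (simp only: norm_of_real)
    then show "norm (of_real (mesh_mean S V a h 0 y) - killed_kernel B S a y (real 0 * h)) =
        (if y = a then \<bar>exp (- (h * V a)) - 1\<bar> else 0)"
      using mesh_mean_0[OF S(2) y] by (auto simp: killed_kernel_def)
  qed
  then show ?case using S by (simp add: sum.delta)
next
  case (Suc n)
  define p where "p y = killed_kernel B S a y (real n * h)" for y
  define p' where "p' y = killed_kernel B S a y (real (Suc n) * h)" for y
  define v where "v y = mesh_mean S V a h n y" for y
  define Q where "Q x y = transition h x y * exp (- (h * V y))" for x y
  define r where "r x y = (Q x y - of_bool (x = y)) / h - B x y" for x y
  have Q0: "0 \<le> Q x y" for x y using transition_bounds[of h x y] by (simp add: Q_def)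
  have sumQ: "(\<Sum>y\<in>S. Q x y) \<le> 1" for x
  proof -
    have "(\<Sum>y\<in>S. Q x y) \<le> (\<Sum>y\<in>S. transition h x y)"
      unfolding Q_def using transition_bounds[of h x] V h
      by (intro sum_mono mult_right_le_one_le) auto
    also have "\<dots> \<le> 1" by (rule sum_transition_le[OF S(1)]) (use h in simp)
    finally show ?thesis .
  qed
  have "real (Suc n) * h \<le> real N * h" using Suc.prems h by (intro mult_right_mono) auto
  then have nT: "real n * h + h \<le> T" using N by (simp add: algebra_simps)
  have n0: "0 \<le> real n * h" using h by simp
  have Qr: "Q x y = of_bool (x = y) + h * B x y + h * r x y" for x y
    using h by (simp add: r_def field_simps)
  have one: "norm (of_real (mesh_mean S V a h (Suc n) y) - p' y) \<le>
      (\<Sum>x\<in>S. norm (of_real (v x) - p x) * Q x y) + (K * (h * (\<Sum>x\<in>S. \<bar>r x y\<bar>)) + K * h\<^sup>2)" if y: "y \<in> S" for y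
  proof -
    have delta: "(\<Sum>x\<in>S. p x * of_bool (x = y)) = p y"
      using S(1) y by (subst sum.remove[of _ y]) (auto intro!: sum.neutral)
    have pQ: "(\<Sum>x\<in>S. p x * of_real (Q x y)) =
        p y + of_real h * (\<Sum>x\<in>S. of_real (B x y) * p x) + (\<Sum>x\<in>S. p x * of_real (h * r x y))"
    proof -
      have "(\<Sum>x\<in>S. p x * of_real (Q x y)) =
          (\<Sum>x\<in>S. p x * of_bool (x = y) + of_real h * (of_real (B x y) * p x) + p x * of_real (h * r x y))"
        by (rule sum.cong[OF refl]) (simp add: Qr algebra_simps)
      then show ?thesis by (simp add: sum.distrib delta sum_distrib_left)
    qed
    have "of_real (mesh_mean S V a h (Suc n) y) - p' y =
        (\<Sum>x\<in>S. (of_real (v x) - p x) * of_real (Q x y)) + (\<Sum>x\<in>S. p x * of_real (h * r x y)) -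
        (p' y - p y - of_real h * (\<Sum>x\<in>S. of_real (B x y) * p x))"
    proof -
      have "of_real (mesh_mean S V a h (Suc n) y) = (\<Sum>x\<in>S. of_real (v x) * complex_of_real (Q x y))"
        unfolding mesh_mean_recursion[OF S(1) y h] by (simp add: v_def Q_def)
      also have "\<dots> = (\<Sum>x\<in>S. (of_real (v x) - p x) * of_real (Q x y)) + (\<Sum>x\<in>S. p x * of_real (Q x y))"
        by (simp add: sum.distrib[symmetric] algebra_simps)
      finally show ?thesis unfolding pQ by simp
    qed
    also have "norm \<dots> \<le> (norm (\<Sum>x\<in>S. (of_real (v x) - p x) * of_real (Q x y)) + norm (\<Sum>x\<in>S. p x * of_real (h * r x y))) +
        norm (p' y - p y - of_real h * (\<Sum>x\<in>S. of_real (B x y) * p x))"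
      by (rule order_trans[OF norm_triangle_ineq4 add_right_mono[OF norm_triangle_ineq]])
    also have "\<dots> \<le> ((\<Sum>x\<in>S. norm (of_real (v x) - p x) * Q x y) + K * (h * (\<Sum>x\<in>S. \<bar>r x y\<bar>))) + K * h\<^sup>2"
    proof (intro add_mono)
      show "norm (\<Sum>x\<in>S. (of_real (v x) - p x) * of_real (Q x y)) \<le> (\<Sum>x\<in>S. norm (of_real (v x) - p x) * Q x y)"
        by (rule sum_norm_le) (use Q0 in \<open>simp add: norm_mult\<close>)
      have "norm (\<Sum>x\<in>S. p x * of_real (h * r x y)) \<le> (\<Sum>x\<in>S. K * (h * \<bar>r x y\<bar>))"
      proof (rule sum_norm_le)
        fix x assume "x \<in> S"
        then have "norm (p x) \<le> K" unfolding p_def by (intro bound) (use n0 nT h in auto)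
        then show "norm (p x * of_real (h * r x y)) \<le> K * (h * \<bar>r x y\<bar>)"
          using h K by (simp add: norm_mult abs_mult mult_right_mono)
      qed
      then show "norm (\<Sum>x\<in>S. p x * of_real (h * r x y)) \<le> K * (h * (\<Sum>x\<in>S. \<bar>r x y\<bar>))"
        by (simp add: sum_distrib_left)
      have "real (Suc n) * h = real n * h + h" by (simp add: algebra_simps)
      then show "norm (p' y - p y - of_real h * (\<Sum>x\<in>S. of_real (B x y) * p x)) \<le> K * h\<^sup>2"
        using step[OF y n0 nT] by (simp add: p_def p'_def)
    qed
    finally show ?thesis by (simp add: add.assoc)
  qed
  have "(\<Sum>y\<in>S. norm (of_real (mesh_mean S V a h (Suc n) y) - p' y)) \<le>
      (\<Sum>y\<in>S. (\<Sum>x\<in>S. norm (of_real (v x) - p x) * Q x y) + (K * (h * (\<Sum>x\<in>S. \<bar>r x y\<bar>)) + K * h\<^sup>2))"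
    by (rule sum_mono) (rule one)
  also have "\<dots> = (\<Sum>y\<in>S. \<Sum>x\<in>S. norm (of_real (v x) - p x) * Q x y) +
      (K * (h * (\<Sum>y\<in>S. \<Sum>x\<in>S. \<bar>r x y\<bar>)) + real (card S) * (K * h\<^sup>2))"
    by (simp add: sum.distrib sum_distrib_left)
  also have "(\<Sum>y\<in>S. \<Sum>x\<in>S. \<bar>r x y\<bar>) = \<eta>"
    unfolding \<eta>_def r_def Q_def by (rule sum.swap)
  also have "(\<Sum>y\<in>S. \<Sum>x\<in>S. norm (of_real (v x) - p x) * Q x y) = (\<Sum>x\<in>S. norm (of_real (v x) - p x) * (\<Sum>y\<in>S. Q x y))"
    by (subst sum.swap) (simp add: sum_distrib_left)
  also have "\<dots> \<le> (\<Sum>x\<in>S. norm (of_real (v x) - p x) * 1)"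
    by (intro sum_mono mult_left_mono sumQ) auto
  also have "\<dots> \<le> \<bar>exp (- (h * V a)) - 1\<bar> + real n * (K * (h * \<eta>) + real (card S) * (K * h\<^sup>2))"
    using Suc.IH Suc.prems by (simp add: v_def p_def)
  finally show ?case by (simp add: p'_def algebra_simps)
qed

text \<open>
  There are \<open>n\<close> steps of size \<open>T / n\<close>, so the accumulated defect is \<open>O(\<eta> + T / n)\<close>, and \<open>\<eta>\<close> tends to \<open>0\<close>
  because the generator is the derivative of the transition function.
\<close>
theorem mesh_mean_limit:
  assumes S: "finite S" "a \<in> S" "b \<in> S" and V: "\<And>x. 0 \<le> V x" and T: "0 < T"
  shows "(\<lambda>n. complex_of_real (mesh_mean S V a (T / n) n b)) \<longlonglongrightarrow> killed_kernel (killed_generator V) S a b T"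
proof -
  let ?B = "killed_generator V"
  obtain K where step: "\<And>b t h. b \<in> S \<Longrightarrow> 0 \<le> t \<Longrightarrow> 0 \<le> h \<Longrightarrow> t + h \<le> T \<Longrightarrow>
      norm (killed_kernel ?B S a b (t + h) - killed_kernel ?B S a b t -
        of_real h * (\<Sum>c\<in>S. of_real (?B c b) * killed_kernel ?B S a c t)) \<le> K * h\<^sup>2"
    and bound: "\<And>b t. b \<in> S \<Longrightarrow> 0 \<le> t \<Longrightarrow> t \<le> T \<Longrightarrow> norm (killed_kernel ?B S a b t) \<le> K"
    using killed_kernel_step[OF S(1,2) T] by blast
  have K0: "0 \<le> K" using order_trans[OF norm_ge_zero bound[OF S(2), of 0]] T by simp
  \<comment> \<open>The index is shifted because a grid without steps has no mesh.\<close>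
  define h where "h n = T / real (Suc n)" for n
  have h: "0 < h n" for n using T by (simp add: h_def)
  have h0: "h \<longlonglongrightarrow> 0" unfolding h_def by (rule LIMSEQ_Suc[OF lim_const_over_n])
  have hn: "real (Suc n) * h n = T" for n by (simp add: h_def)
  define \<eta> where "\<eta> n = (\<Sum>x\<in>S. \<Sum>y\<in>S. \<bar>(transition (h n) x y * exp (- (h n * V y)) - of_bool (x = y)) / h n - ?B x y\<bar>)" for n
  have \<eta>0: "\<eta> \<longlonglongrightarrow> 0"
    unfolding \<eta>_def[abs_def]
    by (intro tendsto_null_sum tendsto_rabs_zero killed_transition_derivative h h0)
  define E where "E n = \<bar>exp (- (h n * V a)) - 1\<bar> + T * (K * \<eta> n + real (card S) * (K * h n))" for n
  have le_E: "norm (complex_of_real (mesh_mean S V a (h n) (Suc n) b) - killed_kernel ?B S a b T) \<le> E n" for n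
  proof -
    have "norm (complex_of_real (mesh_mean S V a (h n) (Suc n) b) - killed_kernel ?B S a b T) \<le>
        (\<Sum>y\<in>S. norm (of_real (mesh_mean S V a (h n) (Suc n) y) - killed_kernel ?B S a y (real (Suc n) * h n)))"
      using member_le_sum[OF S(3), of "\<lambda>y. norm (of_real (mesh_mean S V a (h n) (Suc n) y) - killed_kernel ?B S a y (real (Suc n) * h n))"] S(1)
      unfolding hn by simp
    also have "\<dots> \<le> \<bar>exp (- (h n * V a)) - 1\<bar> + real (Suc n) * (K * (h n * \<eta> n) + real (card S) * (K * (h n)\<^sup>2))"
      unfolding \<eta>_def
      by (rule mesh_mean_error[OF S(1,2) V h _ K0 step bound order_refl]) (use hn h less_imp_le[OF h] in auto)
    also have "real (Suc n) * (K * (h n * \<eta> n) + real (card S) * (K * (h n)\<^sup>2)) =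
        (real (Suc n) * h n) * (K * \<eta> n + real (card S) * (K * h n))"
      by (simp add: algebra_simps power2_eq_square)
    finally show ?thesis unfolding hn E_def .
  qed
  have E0: "E \<longlonglongrightarrow> 0"
  proof -
    have "E \<longlonglongrightarrow> \<bar>exp (- (0 * V a)) - 1\<bar> + T * (K * 0 + real (card S) * (K * 0))"
      unfolding E_def[abs_def] by (intro tendsto_intros h0 \<eta>0)
    then show ?thesis by simp
  qed
  have "(\<lambda>n. complex_of_real (mesh_mean S V a (h n) (Suc n) b) - killed_kernel ?B S a b T) \<longlonglongrightarrow> 0"
    by (rule Lim_null_comparison[OF always_eventually E0]) (rule allI, rule le_E)
  then have "(\<lambda>n. complex_of_real (mesh_mean S V a (h n) (Suc n) b)) \<longlonglongrightarrow> killed_kernel ?B S a b T"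
    by (rule LIM_zero_cancel)
  then show ?thesis unfolding h_def
    by (subst (asm) filterlim_sequentially_Suc[where f = "\<lambda>n. complex_of_real (mesh_mean S V a (T / n) n b)"])
qed

section \<open>Local times and the Feynman-Kac formula\<close>

lemma measurable_X_compose: "0 \<le> t \<Longrightarrow> (\<lambda>\<omega>. c (X t \<omega>)) \<in> borel_measurable (P a)"
  for c :: "'a \<Rightarrow> real"
  by (rule measurable_compose[OF measurable_X]) auto

lemma local_time_limit:
  assumes "\<omega> \<in> space (P a)" "0 < T"
  shows "(\<lambda>n. T / n * (\<Sum>j=1..n. indicator {x} (X (real j * (T / n)) \<omega>))) \<longlonglongrightarrow> local_time X T \<omega> x"
  unfolding local_time_def
  by (rule riemann_sum_limit(1)[OF sample_path_is_step_path[OF assms(1)] assms(2), of "indicator {x}" 1]) (auto simp: indicator_def)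

lemma local_time_integrable:
  assumes "\<omega> \<in> space (P a)" "0 < T"
  shows "set_integrable lborel {0..T} (\<lambda>s. indicator {x} (X s \<omega>) :: real)"
  by (rule riemann_sum_limit(2)[OF sample_path_is_step_path[OF assms(1)] assms(2), of "indicator {x}" 1]) (auto simp: indicator_def)

lemma local_time_measurable:
  assumes "0 < T"
  shows "(\<lambda>\<omega>. local_time X T \<omega> x) \<in> borel_measurable (P a)"
proof (rule borel_measurable_LIMSEQ_real)
  show "(\<lambda>n. T / n * (\<Sum>j=1..n. indicator {x} (X (real j * (T / n)) \<omega>))) \<longlonglongrightarrow> local_time X T \<omega> x"
    if "\<omega> \<in> space (P a)" for \<omega>
    by (rule local_time_limit[OF that assms])
  show "(\<lambda>\<omega>. T / real n * (\<Sum>j=1..n. indicator {x} (X (real j * (T / real n)) \<omega>))) \<in> borel_measurable (P a)" for n :: nat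
    by (intro borel_measurable_times borel_measurable_const borel_measurable_sum measurable_X_compose) (use assms in simp)
qed

lemma local_time_nonneg: "0 \<le> local_time X T \<omega> x"
  unfolding local_time_def set_lebesgue_integral_def
  by (rule Bochner_Integration.integral_nonneg) auto

text \<open>
  By right continuity the path stays in \<open>X\<^sub>s\<close> for some time after \<open>s\<close>, part of which lies before \<open>T\<close>.
\<close>
lemma local_time_pos:
  assumes \<omega>: "\<omega> \<in> space (P a)" and s: "0 \<le> s" "s < T"
  shows "0 < local_time X T \<omega> (X s \<omega>)"
proof -
  have T: "0 < T" using s by simp
  obtain d where d: "0 < d" "\<And>t. s \<le> t \<Longrightarrow> t < s + d \<Longrightarrow> X t \<omega> = X s \<omega>"
    using step_pathE[OF sample_path_is_step_path[OF \<omega>] s(1)] by blast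
  define e where "e = min d (T - s)"
  have e: "0 < e" "e \<le> d" "s + e \<le> T" using d s by (auto simp: e_def)
  have "e = (\<integral>t. indicator {s..<s + e} t \<partial>lborel)" using e by simp
  also have "\<dots> \<le> (\<integral>t. indicator {0..T} t *\<^sub>R indicator {X s \<omega>} (X t \<omega>) \<partial>lborel)"
  proof (rule integral_mono)
    show "integrable lborel (\<lambda>t. indicator {s..<s + e} t :: real)" using e by simp
    show "integrable lborel (\<lambda>t. indicator {0..T} t *\<^sub>R indicator {X s \<omega>} (X t \<omega>) :: real)"
      using local_time_integrable[OF \<omega> T] by (simp add: set_integrable_def)
    fix t
    show "indicator {s..<s + e} t \<le> (indicator {0..T} t *\<^sub>R indicator {X s \<omega>} (X t \<omega>) :: real)"
      using d(2)[of t] e s by (auto simp: indicator_def)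
  qed
  finally show ?thesis using e unfolding local_time_def set_lebesgue_integral_def by linarith
qed

lemma local_time_outside:
  assumes "\<And>s. 0 \<le> s \<Longrightarrow> s \<le> T \<Longrightarrow> X s \<omega> \<noteq> x"
  shows "local_time X T \<omega> x = 0"
proof -
  have "indicator {0..T} s *\<^sub>R indicator {x} (X s \<omega>) = (0 :: real)" for s
    using assms[of s] by (auto simp: indicator_def)
  note zero = this
  show ?thesis unfolding local_time_def set_lebesgue_integral_def zero by simp
qed

lemma local_time_sum:
  assumes \<omega>: "\<omega> \<in> space (P a)" and T: "0 < T" and S: "finite S"
    and stay: "\<And>s. 0 \<le> s \<Longrightarrow> s \<le> T \<Longrightarrow> X s \<omega> \<in> S"
  shows "(\<Sum>x\<in>S. local_time X T \<omega> x) = T"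
proof -
  have "(\<Sum>x\<in>S. local_time X T \<omega> x) =
      (\<integral>s. (\<Sum>x\<in>S. indicator {0..T} s *\<^sub>R indicator {x} (X s \<omega>)) \<partial>lborel)"
    unfolding local_time_def set_lebesgue_integral_def
    by (rule Bochner_Integration.integral_sum[symmetric])
       (use local_time_integrable[OF \<omega> T] in \<open>simp only: set_integrable_def\<close>)
  also have "\<dots> = (\<integral>s. indicator {0..T} s \<partial>lborel)"
  proof (rule Bochner_Integration.integral_cong[OF refl])
    fix s
    show "(\<Sum>x\<in>S. indicator {0..T} s *\<^sub>R indicator {x} (X s \<omega>)) = (indicator {0..T} s :: real)"
    proof (cases "s \<in> {0..T}")
      case True
      then have "(\<Sum>x\<in>S. indicator {0..T} s *\<^sub>R indicator {x} (X s \<omega>)) = (\<Sum>x\<in>S. if x = X s \<omega> then 1 else 0 :: real)"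
        by (intro sum.cong) (auto simp: indicator_def)
      also have "\<dots> = 1" using S stay[of s] True by (simp add: sum.delta)
      finally show ?thesis using True by simp
    qed simp
  qed
  also have "\<dots> = T" using T by simp
  finally show ?thesis .
qed

text \<open>
  Every site visited before time \<open>T\<close> has positive local time; only the site occupied at \<open>T\<close> itself may
  be missing from the range, and it lies in \<open>S\<close> by assumption.
\<close>
lemma local_time_range_subset_iff:
  assumes \<omega>: "\<omega> \<in> space (P a)" and T: "X T \<omega> \<in> S"
  shows "local_time_range X T \<omega> \<subseteq> S \<longleftrightarrow> (\<forall>s. 0 \<le> s \<and> s \<le> T \<longrightarrow> X s \<omega> \<in> S)"
proof
  assume R: "local_time_range X T \<omega> \<subseteq> S"
  show "\<forall>s. 0 \<le> s \<and> s \<le> T \<longrightarrow> X s \<omega> \<in> S"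
  proof (intro allI impI)
    fix s assume s: "0 \<le> s \<and> s \<le> T"
    show "X s \<omega> \<in> S"
    proof (cases "s = T")
      case False
      then have "local_time X T \<omega> (X s \<omega>) \<noteq> 0" using local_time_pos[OF \<omega>, of s T] s by auto
      then show ?thesis using R by (auto simp: local_time_range_def)
    qed (use T in simp)
  qed
next
  assume "\<forall>s. 0 \<le> s \<and> s \<le> T \<longrightarrow> X s \<omega> \<in> S"
  then show "local_time_range X T \<omega> \<subseteq> S"
    using local_time_outside[of T \<omega>] by (force simp: local_time_range_def)
qed

lemma sets_local_time_range:
  assumes "0 < T"
  shows "{\<omega> \<in> space (P a). local_time_range X T \<omega> = U} \<in> sets (P a)"
proof -
  have "{\<omega> \<in> space (P a). local_time X T \<omega> x \<noteq> 0} \<in> sets (P a)" for x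
    using borel_measurable_neq[OF local_time_measurable[OF assms] borel_measurable_const] .
  then have "{\<omega> \<in> space (P a). (local_time X T \<omega> x \<noteq> 0) = (x \<in> U)} \<in> sets (P a)" for x
    using sets.sets_Collect_neg[of "P a" "\<lambda>\<omega>. local_time X T \<omega> x \<noteq> 0"]
    by (cases "x \<in> U") (simp_all only: simp_thms)
  then have "{\<omega> \<in> space (P a). \<forall>x. (local_time X T \<omega> x \<noteq> 0) = (x \<in> U)} \<in> sets (P a)"
    by (rule sets.sets_Collect_countable_All)
  moreover have "{\<omega> \<in> space (P a). local_time_range X T \<omega> = U} =
      {\<omega> \<in> space (P a). \<forall>x. (local_time X T \<omega> x \<noteq> 0) = (x \<in> U)}"
    by (auto simp: local_time_range_def)
  ultimately show ?thesis by (simp only:)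
qed

definition laplace_weight :: "'a set \<Rightarrow> ('a \<Rightarrow> real) \<Rightarrow> real \<Rightarrow> 'w \<Rightarrow> real" where
  "laplace_weight S V T \<omega> = exp (- (\<Sum>x\<in>S. V x * local_time X T \<omega> x))"

lemma laplace_weight_bounds:
  assumes "\<And>x. 0 \<le> V x"
  shows "0 \<le> laplace_weight S V T \<omega>" "laplace_weight S V T \<omega> \<le> 1"
  using assms local_time_nonneg by (auto simp: laplace_weight_def intro!: sum_nonneg)

lemma laplace_weight_measurable:
  "0 < T \<Longrightarrow> laplace_weight S V T \<in> borel_measurable (P a)"
  unfolding laplace_weight_def[abs_def]
  by (intro measurable_compose[OF _ borel_measurable_exp] borel_measurable_uminus borel_measurable_sum
      borel_measurable_times borel_measurable_const local_time_measurable)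

text \<open>
  If the path stays in \<open>S\<close>, the product of the weights is the exponential of a Riemann sum. If it leaves
  \<open>S\<close>, it does so for an interval of times, which contains a grid point once the mesh is small.
\<close>
lemma mesh_integrand_limit:
  assumes \<omega>: "\<omega> \<in> space (P a)" and S: "finite S" "b \<in> S" and T: "0 < T"
  shows "(\<lambda>n. (\<Prod>j\<le>n. mesh_weight S V (T / n) (X (real j * (T / n)) \<omega>)) * of_bool (X (real n * (T / n)) \<omega> = b))
    \<longlonglongrightarrow> laplace_weight S V T \<omega> * of_bool (local_time_range X T \<omega> \<subseteq> S) * of_bool (X T \<omega> = b)"
    (is "?m \<longlonglongrightarrow> ?L")
proof -
  have end_eq: "real n * (T / n) = T" if "0 < n" for n using that by simp
  show ?thesis
  proof (cases "X T \<omega> = b")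
    case False
    have "\<forall>\<^sub>F n in sequentially. ?m n = 0"
      using eventually_gt_at_top[of 0] by eventually_elim (use False end_eq in auto)
    then show ?thesis using False by (simp add: tendsto_eventually)
  next
    case b: True
    then have TS: "X T \<omega> \<in> S" using S by simp
    show ?thesis
    proof (cases "\<forall>s. 0 \<le> s \<and> s \<le> T \<longrightarrow> X s \<omega> \<in> S")
      case True
      have R: "local_time_range X T \<omega> \<subseteq> S" using local_time_range_subset_iff[OF \<omega> TS] True by blast
      let ?e = "\<lambda>n. exp (- (\<Sum>x\<in>S. V x * (T / n * indicator {x} (X (real 0 * (T / n)) \<omega>) +
          T / n * (\<Sum>j=1..n. indicator {x} (X (real j * (T / n)) \<omega>)))))"
      have "?e \<longlonglongrightarrow> exp (- (\<Sum>x\<in>S. V x * (0 * indicator {x} (X 0 \<omega>) + local_time X T \<omega> x)))"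
      proof -
        have "(\<lambda>n. T / n * indicator {x} (X (real 0 * (T / n)) \<omega>)) \<longlonglongrightarrow> 0 * indicator {x} (X 0 \<omega>)" for x
          using tendsto_mult[OF lim_const_over_n[of T] tendsto_const[of "indicator {x} (X 0 \<omega>) :: real"]] by simp
        note sum = tendsto_add[OF this local_time_limit[OF \<omega> T]]
        show ?thesis by (intro tendsto_exp tendsto_minus tendsto_sum tendsto_mult[OF tendsto_const] sum)
      qed
      moreover have "\<forall>\<^sub>F n in sequentially. ?m n = ?e n"
        using eventually_gt_at_top[of 0]
      proof eventually_elim
        case (elim n)
        have "X (real j * (T / n)) \<omega> \<in> S" if "j \<le> n" for j
        proof -
          have "real j * (T / n) \<le> real n * (T / n)" using that T by (intro mult_right_mono) auto
          moreover have "0 \<le> real j * (T / n)" using T by simp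
          ultimately show ?thesis using True end_eq[OF elim] by simp
        qed
        then have "(\<Prod>j\<le>n. mesh_weight S V (T / n) (X (real j * (T / n)) \<omega>)) = ?e n"
          by (rule prod_mesh_weight[OF S(1)])
        then show ?case unfolding end_eq[OF elim] using b by simp
      qed
      ultimately have "?m \<longlonglongrightarrow> exp (- (\<Sum>x\<in>S. V x * (0 * indicator {x} (X 0 \<omega>) + local_time X T \<omega> x)))"
        by (subst tendsto_cong)
      then show ?thesis using R b by (simp add: laplace_weight_def)
    next
      case False
      then obtain s where s: "0 \<le> s" "s \<le> T" "X s \<omega> \<notin> S" by blast
      have R: "\<not> local_time_range X T \<omega> \<subseteq> S" using local_time_range_subset_iff[OF \<omega> TS] False by blast
      have "\<forall>\<^sub>F n in sequentially. ?m n = 0"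
        using eventually_grid_point[OF sample_path_is_step_path[OF \<omega>] T s(1,2)] eventually_gt_at_top[of 0]
      proof eventually_elim
        case (elim n)
        have "mesh_weight S V (T / n) (X (real (grid_point T n s) * (T / n)) \<omega>) = 0"
          using elim(1) s(3) by (simp add: mesh_weight_def)
        moreover have "grid_point T n s \<in> {..n}" using grid_point_bounds(1)[OF T elim(2) s(1,2)] by simp
        ultimately have "(\<Prod>j\<le>n. mesh_weight S V (T / n) (X (real j * (T / n)) \<omega>)) = 0"
          by (intro prod_zero) auto
        then show ?case by simp
      qed
      then show ?thesis using R by (simp add: tendsto_eventually)
    qed
  qed
qed

text \<open>
  Both sides are limits of the means over the grid, by dominated convergence and by
  \<open>mesh_mean_limit\<close>.
\<close>
theorem feynman_kac:
  assumes S: "finite S" "a \<in> S" "b \<in> S" and V: "\<And>x. 0 \<le> V x" and T: "0 < T"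
  shows "complex_of_real (\<integral>\<omega>. laplace_weight S V T \<omega> * of_bool (local_time_range X T \<omega> \<subseteq> S) * of_bool (X T \<omega> = b) \<partial>P a) =
    killed_kernel (killed_generator V) S a b T"
proof -
  interpret prob_space "P a" by (rule prob_space_P)
  let ?m = "\<lambda>n \<omega>. (\<Prod>j\<le>n. mesh_weight S V (T / real n) (X (real j * (T / real n)) \<omega>)) * of_bool (X (real n * (T / real n)) \<omega> = b)"
  let ?L = "\<lambda>\<omega>. laplace_weight S V T \<omega> * of_bool (local_time_range X T \<omega> \<subseteq> S) * of_bool (X T \<omega> = b)"
  have m: "?m n \<in> borel_measurable (P a)" for n :: nat
    by (intro borel_measurable_times borel_measurable_prod measurable_X_compose measurable_X_compose[where c = "\<lambda>x. of_bool (x = b)"])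
       (use T in simp_all)
  note lim = mesh_integrand_limit[OF _ S(1,3) T]
  have L: "?L \<in> borel_measurable (P a)" by (rule borel_measurable_LIMSEQ_real[OF lim m])
  have "(\<lambda>n. \<integral>\<omega>. ?m n \<omega> \<partial>P a) \<longlonglongrightarrow> (\<integral>\<omega>. ?L \<omega> \<partial>P a)"
  proof (rule integral_dominated_convergence[OF L m, where w = "\<lambda>_. 1"])
    show "AE \<omega> in P a. (\<lambda>n. ?m n \<omega>) \<longlonglongrightarrow> ?L \<omega>" by (rule AE_I2) (rule lim)
    have prod_bounds: "0 \<le> (\<Prod>j\<le>n. mesh_weight S V (T / real n) (Y j)) \<and> (\<Prod>j\<le>n. mesh_weight S V (T / real n) (Y j)) \<le> 1" for n :: nat and Y
      using mesh_weight_bounds[of V "T / real n" S, OF V] T by (auto intro!: prod_nonneg prod_le_1)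
    have norm_le: "norm (p * of_bool c) \<le> 1" if "0 \<le> p \<and> p \<le> 1" for p :: real and c
      using that by (cases c) auto
    show "AE \<omega> in P a. norm (?m n \<omega>) \<le> 1" for n :: nat
      by (rule AE_I2, rule norm_le, rule prod_bounds)
  qed simp
  then have "(\<lambda>n. complex_of_real (\<integral>\<omega>. ?m n \<omega> \<partial>P a)) \<longlonglongrightarrow> complex_of_real (\<integral>\<omega>. ?L \<omega> \<partial>P a)"
    by (rule tendsto_of_real)
  moreover have "(\<lambda>n. complex_of_real (\<integral>\<omega>. ?m n \<omega> \<partial>P a)) \<longlonglongrightarrow> killed_kernel (killed_generator V) S a b T"
    using mesh_mean_limit[OF S V T] by (simp only: mesh_mean_def)
  ultimately show ?thesis by (rule LIMSEQ_unique)
qed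

definition range_mass :: "('a \<Rightarrow> real) \<Rightarrow> 'a set \<Rightarrow> 'a \<Rightarrow> 'a \<Rightarrow> real \<Rightarrow> real" where
  "range_mass V U a b T =
     (\<integral>\<omega>. laplace_weight U V T \<omega> * (of_bool (local_time_range X T \<omega> = U) * of_bool (X T \<omega> = b)) \<partial>P a)"

lemma range_event_measurable:
  assumes "0 < T"
  shows "(\<lambda>\<omega>. of_bool (local_time_range X T \<omega> = U) * of_bool (X T \<omega> = b) :: real) \<in> borel_measurable (P a)"
proof -
  have "(\<lambda>\<omega>. indicator {\<omega> \<in> space (P a). local_time_range X T \<omega> = U} \<omega> :: real) \<in> borel_measurable (P a)"
    by (rule borel_measurable_indicator[OF sets_local_time_range[OF assms]])
  then have "(\<lambda>\<omega>. of_bool (local_time_range X T \<omega> = U) :: real) \<in> borel_measurable (P a)"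
    by (rule measurable_cong[THEN iffD1, rotated]) (auto simp: indicator_def)
  from borel_measurable_times[OF this measurable_X_compose[OF less_imp_le[OF assms], where c = "\<lambda>x. of_bool (x = b)"]]
  show ?thesis .
qed

lemma range_mass_integrable:
  assumes V: "\<And>x. 0 \<le> V x" and T: "0 < T"
  shows "integrable (P a) (\<lambda>\<omega>. laplace_weight U V T \<omega> * (of_bool (local_time_range X T \<omega> = U) * of_bool (X T \<omega> = b)))"
proof -
  interpret prob_space "P a" by (rule prob_space_P)
  show ?thesis
  proof (rule integrable_const_bound[where B = 1])
    show "AE \<omega> in P a. norm (laplace_weight U V T \<omega> * (of_bool (local_time_range X T \<omega> = U) * of_bool (X T \<omega> = b))) \<le> 1"
      using laplace_weight_bounds[of V, OF V] by (auto simp: abs_mult)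
    show "(\<lambda>\<omega>. laplace_weight U V T \<omega> * (of_bool (local_time_range X T \<omega> = U) * of_bool (X T \<omega> = b))) \<in> borel_measurable (P a)"
      by (rule borel_measurable_times[OF laplace_weight_measurable[OF T] range_event_measurable[OF T]])
  qed
qed

text \<open>
  Sites outside the range have local time \<open>0\<close>, so the Laplace weights of \<open>S\<close> and of the range coincide.
\<close>
lemma feynman_kac_by_range:
  assumes S: "finite S" and V: "\<And>x. 0 \<le> V x" and T: "0 < T"
  shows "(\<integral>\<omega>. laplace_weight S V T \<omega> * of_bool (local_time_range X T \<omega> \<subseteq> S) * of_bool (X T \<omega> = b) \<partial>P a) =
    (\<Sum>U\<in>Pow S. range_mass V U a b T)"
proof -
  have "(\<integral>\<omega>. laplace_weight S V T \<omega> * of_bool (local_time_range X T \<omega> \<subseteq> S) * of_bool (X T \<omega> = b) \<partial>P a) =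
      (\<integral>\<omega>. (\<Sum>U\<in>Pow S. laplace_weight U V T \<omega> * (of_bool (local_time_range X T \<omega> = U) * of_bool (X T \<omega> = b))) \<partial>P a)"
  proof (rule Bochner_Integration.integral_cong[OF refl])
    fix \<omega>
    let ?R = "local_time_range X T \<omega>"
    have "(\<Sum>U\<in>Pow S. laplace_weight U V T \<omega> * (of_bool (?R = U) * of_bool (X T \<omega> = b))) =
        (\<Sum>U\<in>Pow S. if U = ?R then laplace_weight ?R V T \<omega> * of_bool (X T \<omega> = b) else 0)"
      by (rule sum.cong) auto
    also have "\<dots> = (if ?R \<subseteq> S then laplace_weight ?R V T \<omega> * of_bool (X T \<omega> = b) else 0)"
      using S by (subst sum.delta) auto
    also have "\<dots> = laplace_weight S V T \<omega> * of_bool (?R \<subseteq> S) * of_bool (X T \<omega> = b)"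
    proof (cases "?R \<subseteq> S")
      case True
      have "(\<Sum>x\<in>?R. V x * local_time X T \<omega> x) = (\<Sum>x\<in>S. V x * local_time X T \<omega> x)"
        by (rule sum.mono_neutral_left) (use S True in \<open>auto simp: local_time_range_def\<close>)
      then show ?thesis using True by (simp add: laplace_weight_def)
    qed simp
    finally show "laplace_weight S V T \<omega> * of_bool (?R \<subseteq> S) * of_bool (X T \<omega> = b) =
        (\<Sum>U\<in>Pow S. laplace_weight U V T \<omega> * (of_bool (?R = U) * of_bool (X T \<omega> = b)))" ..
  qed
  also have "\<dots> = (\<Sum>U\<in>Pow S. range_mass V U a b T)"
    unfolding range_mass_def by (rule Bochner_Integration.integral_sum) (rule range_mass_integrable[OF V T])
  finally show ?thesis .
qed

lemma AE_start_in_range: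
  assumes "0 < T"
  shows "AE \<omega> in P a. a \<in> local_time_range X T \<omega>"
  using start[of a] AE_space
proof eventually_elim
  case (elim \<omega>)
  then show ?case using local_time_pos[OF elim(2), of 0 T] assms by (simp add: local_time_range_def)
qed

text \<open>
  The chain would have to jump to \<open>b\<close> exactly at time \<open>T\<close>. Seen from time \<open>T - h\<close> it makes a transition
  from \<open>U\<close> to \<open>b \<notin> U\<close> within time \<open>h\<close>, whose probability tends to \<open>0\<close> with \<open>h\<close>.
\<close>
lemma AE_end_in_range:
  assumes U: "finite U" "b \<notin> U" and T: "0 < T"
  shows "AE \<omega> in P a. \<not> (local_time_range X T \<omega> = U \<and> X T \<omega> = b)"
proof -
  interpret prob_space "P a" by (rule prob_space_P)
  let ?E = "{\<omega> \<in> space (P a). local_time_range X T \<omega> = U \<and> X T \<omega> = b}"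
  have E: "?E \<in> sets (P a)"
    by (rule sets.sets_Collect_conj[OF sets_X_eq[OF less_imp_le[OF T]] sets_local_time_range[OF T]])
  define h where "h n = T / real (Suc n)" for n
  have h: "0 < h n" "h n \<le> T" for n using T by (auto simp: h_def field_simps)
  have h0: "h \<longlonglongrightarrow> 0" unfolding h_def by (rule LIMSEQ_Suc[OF lim_const_over_n])
  have le: "prob ?E \<le> (\<Sum>c\<in>U. transition (h n) c b)" for n
  proof -
    let ?u = "\<lambda>i :: nat. T - h n + real i * h n"
    let ?N = "\<lambda>c. {\<omega> \<in> space (P a). \<forall>i\<le>Suc 0. X (?u i) \<omega> = (if i = 0 then c else b)}"
    have N: "?N c \<in> sets (P a)" for c
      by (rule sets_path_eq) (use h[of n] in auto)
    have N_le: "prob (?N c) \<le> transition (h n) c b" for c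
    proof -
      have "prob (?N c) = prob {\<omega> \<in> space (P a). \<forall>i\<le>0. X (?u i) \<omega> = (if i = 0 then c else b)} *
          measure (P (if 0 = (0::nat) then c else b)) {\<omega> \<in> space (P (if 0 = (0::nat) then c else b)).
            X (?u (Suc 0) - ?u 0) \<omega> = (if Suc 0 = 0 then c else b)}"
        by (rule markov_property[where u = ?u and n = 0 and x = "\<lambda>i. if i = 0 then c else b"]) (use h[of n] in auto)
      also have "\<dots> = prob {\<omega> \<in> space (P a). \<forall>i\<le>0. X (?u i) \<omega> = (if i = 0 then c else b)} * transition (h n) c b"
        by (simp add: transition_def)
      also have "\<dots> \<le> 1 * transition (h n) c b"
        by (rule mult_right_mono[OF prob_le_1 transition_bounds(1)])
      finally show ?thesis by simp
    qed
    have "prob ?E \<le> prob (\<Union>c\<in>U. ?N c)"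
    proof (rule finite_measure_mono)
      show "?E \<subseteq> (\<Union>c\<in>U. ?N c)"
      proof
        fix \<omega> assume "\<omega> \<in> ?E"
        then have \<omega>: "\<omega> \<in> space (P a)" "local_time_range X T \<omega> = U" "X T \<omega> = b" by auto
        have "0 < local_time X T \<omega> (X (T - h n) \<omega>)" by (rule local_time_pos[OF \<omega>(1)]) (use h[of n] in auto)
        then have c: "X (T - h n) \<omega> \<in> U" using \<omega>(2) by (auto simp: local_time_range_def)
        have "i = 0 \<or> i = Suc 0" if "i \<le> Suc 0" for i using that by auto
        then have "\<omega> \<in> ?N (X (T - h n) \<omega>)" using \<omega> by fastforce
        then show "\<omega> \<in> (\<Union>c\<in>U. ?N c)" using c by blast
      qed
      show "(\<Union>c\<in>U. ?N c) \<in> sets (P a)" by (rule sets.finite_UN[OF U(1) N])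
    qed
    also have "\<dots> \<le> (\<Sum>c\<in>U. prob (?N c))"
      by (rule finite_measure_subadditive_finite[OF U(1)]) (use N in blast)
    also have "\<dots> \<le> (\<Sum>c\<in>U. transition (h n) c b)" by (rule sum_mono) (rule N_le)
    finally show ?thesis .
  qed
  have "(\<lambda>n. \<Sum>c\<in>U. transition (h n) c b) \<longlonglongrightarrow> (\<Sum>c\<in>U. of_bool (c = b))"
    by (intro tendsto_sum transition_tendsto h h0)
  also have "(\<Sum>c\<in>U. of_bool (c = b)) = (0 :: real)" using U by (intro sum.neutral) auto
  finally have "prob ?E \<le> 0" by (rule LIMSEQ_le_const) (use le in auto)
  then have "prob ?E = 0" using measure_nonneg[of "P a" ?E] by linarith
  then show ?thesis using prob_Collect_eq_0[OF E] by simp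
qed

lemma range_mass_eq_0:
  assumes U: "finite U" "a \<notin> U \<or> b \<notin> U" and T: "0 < T"
  shows "range_mass V U a b T = 0"
proof -
  have "AE \<omega> in P a. \<not> (local_time_range X T \<omega> = U \<and> X T \<omega> = b)"
  proof (cases "a \<in> U")
    case True
    then show ?thesis using AE_end_in_range[OF U(1) _ T] U(2) by blast
  next
    case False
    show ?thesis using AE_start_in_range[OF T] by eventually_elim (use False in auto)
  qed
  then have "AE \<omega> in P a. laplace_weight U V T \<omega> * (of_bool (local_time_range X T \<omega> = U) * of_bool (X T \<omega> = b)) = 0"
    by eventually_elim auto
  then show ?thesis unfolding range_mass_def by (rule integral_eq_zero_AE)
qed

text \<open>
  Both sides, summed over the subsets of \<open>U\<close>, give the killed kernel of \<open>U\<close>. By induction all terms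
  except the one of \<open>U\<close> itself agree, hence so does that one.
\<close>
theorem range_mass_eq:
  assumes "finite U" "a \<in> U" "b \<in> U" and V: "\<And>x. 0 \<le> V x" and T: "0 < T"
  shows "complex_of_real (range_mass V U a b T) = range_weight (killed_generator V) U a b T"
  using assms(1-3)
proof (induction U rule: finite_psubset_induct)
  case (psubset U)
  let ?W = "{U'. U' \<subseteq> U \<and> a \<in> U' \<and> b \<in> U'}"
  have finW: "finite ?W" by (rule finite_subset[of _ "Pow U"]) (use psubset in auto)
  have UW: "U \<in> ?W" using psubset.prems by simp
  have "(\<Sum>U'\<in>?W. range_weight (killed_generator V) U' a b T) = killed_kernel (killed_generator V) U a b T"
    using T by (simp add: killed_kernel_def)
  also have "\<dots> = complex_of_real (\<Sum>U'\<in>Pow U. range_mass V U' a b T)"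
    using feynman_kac[OF psubset.hyps(1) psubset.prems V T] feynman_kac_by_range[OF psubset.hyps(1) V T] by simp
  also have "(\<Sum>U'\<in>Pow U. range_mass V U' a b T) = (\<Sum>U'\<in>?W. range_mass V U' a b T)"
  proof (rule sum.mono_neutral_right)
    show "finite (Pow U)" using psubset.hyps by simp
    show "\<forall>U'\<in>Pow U - ?W. range_mass V U' a b T = 0"
      using range_mass_eq_0[OF _ _ T] finite_subset[OF _ psubset.hyps(1)] by blast
  qed auto
  finally have "(\<Sum>U'\<in>?W. range_weight (killed_generator V) U' a b T) = (\<Sum>U'\<in>?W. complex_of_real (range_mass V U' a b T))"
    by simp
  moreover have "(\<Sum>U'\<in>?W - {U}. range_weight (killed_generator V) U' a b T) =
      (\<Sum>U'\<in>?W - {U}. complex_of_real (range_mass V U' a b T))"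
  proof (rule sum.cong[OF refl])
    fix U' assume "U' \<in> ?W - {U}"
    then have "U' \<subset> U" "a \<in> U'" "b \<in> U'" by auto
    then show "range_weight (killed_generator V) U' a b T = complex_of_real (range_mass V U' a b T)"
      using psubset.IH by simp
  qed
  ultimately show ?case
    using sum.remove[OF finW UW, of "\<lambda>U'. range_weight (killed_generator V) U' a b T"]
      sum.remove[OF finW UW, of "\<lambda>U'. complex_of_real (range_mass V U' a b T)"] by simp
qed

end

section \<open>Uniqueness of Laplace transforms\<close>

lemma integrable_mult_bounded:
  fixes f :: "'b \<Rightarrow> complex" and \<phi> :: "'b \<Rightarrow> real"
  assumes f: "integrable M f" and m: "\<phi> \<in> borel_measurable M" and b: "\<And>x. x \<in> space M \<Longrightarrow> \<bar>\<phi> x\<bar> \<le> C"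
  shows "integrable M (\<lambda>x. f x * of_real (\<phi> x))"
proof (rule Bochner_Integration.integrable_bound)
  show "integrable M (\<lambda>x. C * norm (f x))" using f by simp
  have "(\<lambda>x. complex_of_real (\<phi> x)) \<in> borel_measurable M" using m by measurable
  then show "(\<lambda>x. f x * of_real (\<phi> x)) \<in> borel_measurable M"
    by (rule borel_measurable_times[OF borel_measurable_integrable[OF f]])
  show "AE x in M. norm (f x * of_real (\<phi> x)) \<le> norm (C * norm (f x))"
  proof (rule AE_I2)
    fix x assume "x \<in> space M"
    then have "\<bar>\<phi> x\<bar> \<le> \<bar>C\<bar>" using b by fastforce
    then show "norm (f x * of_real (\<phi> x)) \<le> norm (C * norm (f x))"
      by (simp add: norm_mult abs_mult mult.commute mult_right_mono)
  qed
qed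

lemma integral_mult_bounded_limit:
  fixes f :: "'b \<Rightarrow> complex" and \<phi> :: "nat \<Rightarrow> 'b \<Rightarrow> real"
  assumes f: "integrable M f" and m: "\<And>n. \<phi> n \<in> borel_measurable M"
    and b: "\<And>n x. x \<in> space M \<Longrightarrow> \<bar>\<phi> n x\<bar> \<le> C"
    and lim: "\<And>x. x \<in> space M \<Longrightarrow> (\<lambda>n. \<phi> n x) \<longlonglongrightarrow> \<phi>' x"
  shows "(\<lambda>n. \<integral>x. f x * of_real (\<phi> n x) \<partial>M) \<longlonglongrightarrow> (\<integral>x. f x * of_real (\<phi>' x) \<partial>M)"
proof (rule integral_dominated_convergence)
  have m': "\<phi>' \<in> borel_measurable M" by (rule borel_measurable_LIMSEQ_real[OF lim m])
  have "(\<lambda>x. complex_of_real (\<phi>' x)) \<in> borel_measurable M" using m' by measurable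
  then show "(\<lambda>x. f x * of_real (\<phi>' x)) \<in> borel_measurable M"
    by (rule borel_measurable_times[OF borel_measurable_integrable[OF f]])
  show "(\<lambda>x. f x * of_real (\<phi> n x)) \<in> borel_measurable M" for n
    by (rule borel_measurable_integrable[OF integrable_mult_bounded[OF f m b]])
  show "integrable M (\<lambda>x. C * norm (f x))" using f by simp
  show "AE x in M. (\<lambda>n. f x * of_real (\<phi> n x)) \<longlonglongrightarrow> f x * of_real (\<phi>' x)"
    by (rule AE_I2) (intro tendsto_intros lim)
  show "AE x in M. norm (f x * of_real (\<phi> n x)) \<le> C * norm (f x)" for n
  proof (rule AE_I2)
    fix x assume "x \<in> space M"
    then have "\<bar>\<phi> n x\<bar> * norm (f x) \<le> C * norm (f x)" by (intro mult_right_mono b) auto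
    then show "norm (f x * of_real (\<phi> n x)) \<le> C * norm (f x)" by (simp add: norm_mult mult.commute)
  qed
qed

text \<open>
  Equality of the moments is equality of the integrals of polynomials in \<open>g\<close>, hence of continuous
  functions by the Weierstrass theorem, and indicators of half-lines are bounded limits of these.
\<close>
lemma moments_determine_halflines:
  fixes g1 :: "'b \<Rightarrow> real" and g2 :: "'c \<Rightarrow> real" and f1 :: "'b \<Rightarrow> complex" and f2 :: "'c \<Rightarrow> complex"
  assumes f: "integrable M1 f1" "integrable M2 f2"
    and g: "g1 \<in> borel_measurable M1" "g2 \<in> borel_measurable M2"
    and r: "\<And>x. x \<in> space M1 \<Longrightarrow> g1 x \<in> {0..1}" "\<And>x. x \<in> space M2 \<Longrightarrow> g2 x \<in> {0..1}"
    and moments: "\<And>k :: nat. (\<integral>x. f1 x * of_real (g1 x ^ k) \<partial>M1) = (\<integral>x. f2 x * of_real (g2 x ^ k) \<partial>M2)"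
  shows "(\<integral>x. f1 x * of_real (indicator {..u} (g1 x)) \<partial>M1) = (\<integral>x. f2 x * of_real (indicator {..u} (g2 x)) \<partial>M2)"
proof -
  have poly: "(\<integral>x. f1 x * of_real (p (g1 x)) \<partial>M1) = (\<integral>x. f2 x * of_real (p (g2 x)) \<partial>M2)"
    if rp: "real_polynomial_function p" for p
  proof -
    obtain c and n :: nat where p: "p = (\<lambda>x. \<Sum>i\<le>n. c i * x ^ i)"
      using rp unfolding real_polynomial_function_iff_sum by blast
    have sum: "(\<integral>x. f x * of_real (p (g x)) \<partial>M) = (\<Sum>i\<le>n. of_real (c i) * (\<integral>x. f x * of_real (g x ^ i) \<partial>M))"
      if "integrable M f" "g \<in> borel_measurable M" "\<And>x. x \<in> space M \<Longrightarrow> g x \<in> {0..1}"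
      for M :: "'d measure" and f :: "'d \<Rightarrow> complex" and g
    proof -
      have i: "integrable M (\<lambda>x. f x * of_real (g x ^ i))" for i
        by (rule integrable_mult_bounded[OF that(1), where C = 1])
           (use that in \<open>auto simp: power_le_one intro: borel_measurable_power\<close>)
      have "(\<integral>x. f x * of_real (p (g x)) \<partial>M) = (\<integral>x. (\<Sum>i\<le>n. of_real (c i) * (f x * of_real (g x ^ i))) \<partial>M)"
        by (simp add: p sum_distrib_left mult_ac)
      also have "\<dots> = (\<Sum>i\<le>n. of_real (c i) * (\<integral>x. f x * of_real (g x ^ i) \<partial>M))"
        using i by (subst Bochner_Integration.integral_sum) auto
      finally show ?thesis .
    qed
    have "(\<integral>x. f1 x * of_real (p (g1 x)) \<partial>M1) = (\<Sum>i\<le>n. of_real (c i) * (\<integral>x. f1 x * of_real (g1 x ^ i) \<partial>M1))"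
      by (rule sum[OF f(1) g(1) r(1)])
    moreover have "(\<integral>x. f2 x * of_real (p (g2 x)) \<partial>M2) = (\<Sum>i\<le>n. of_real (c i) * (\<integral>x. f2 x * of_real (g2 x ^ i) \<partial>M2))"
      by (rule sum[OF f(2) g(2) r(2)])
    ultimately show ?thesis by (simp only: moments)
  qed
  have cont: "(\<integral>x. f1 x * of_real (h (g1 x)) \<partial>M1) = (\<integral>x. f2 x * of_real (h (g2 x)) \<partial>M2)"
    if h: "continuous_on UNIV h" for h :: "real \<Rightarrow> real"
  proof -
    let ?I1 = "\<lambda>h. \<integral>x. f1 x * of_real (h (g1 x)) \<partial>M1" and ?I2 = "\<lambda>h. \<integral>x. f2 x * of_real (h (g2 x)) \<partial>M2"
    define N where "N = (\<integral>x. norm (f1 x) \<partial>M1) + (\<integral>x. norm (f2 x) \<partial>M2)"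
    have N0: "0 \<le> N" unfolding N_def by (intro add_nonneg_nonneg Bochner_Integration.integral_nonneg) auto
    have approx: "norm ((\<integral>x. f x * of_real (h (g x)) \<partial>M) - (\<integral>x. f x * of_real (p (g x)) \<partial>M)) \<le> e * (\<integral>x. norm (f x) \<partial>M)"
      if f: "integrable M f" and g: "g \<in> borel_measurable M" and r: "\<And>x. x \<in> space M \<Longrightarrow> g x \<in> {0..1}"
        and p: "continuous_on UNIV p" and e: "\<And>x. x \<in> {0..1} \<Longrightarrow> \<bar>h x - p x\<bar> < e"
      for M :: "'d measure" and f :: "'d \<Rightarrow> complex" and g p e
    proof -
      have int: "integrable M (\<lambda>x. f x * of_real (q (g x)))" if q: "continuous_on UNIV q" for q :: "real \<Rightarrow> real"
      proof -
        have "bounded (q ` {0..1})"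
          by (intro compact_imp_bounded compact_continuous_image continuous_on_subset[OF q]) auto
        then obtain C where "\<forall>y\<in>q ` {0..1}. norm y \<le> C" unfolding bounded_iff by blast
        then have "\<bar>q x\<bar> \<le> C" if "x \<in> {0..1}" for x using that by auto
        then show ?thesis
          by (intro integrable_mult_bounded[OF f, where C = C]
              measurable_compose[OF g borel_measurable_continuous_onI[OF q]]) (use r in auto)
      qed
      have "(\<integral>x. f x * of_real (h (g x)) \<partial>M) - (\<integral>x. f x * of_real (p (g x)) \<partial>M) =
          (\<integral>x. f x * of_real (h (g x)) - f x * of_real (p (g x)) \<partial>M)"
        by (rule Bochner_Integration.integral_diff[symmetric]) (intro int h p)+
      also have "norm \<dots> \<le> (\<integral>x. norm (f x * of_real (h (g x)) - f x * of_real (p (g x))) \<partial>M)"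
        by (rule integral_norm_bound)
      also have "\<dots> \<le> (\<integral>x. e * norm (f x) \<partial>M)"
      proof (rule integral_mono)
        show "integrable M (\<lambda>x. norm (f x * of_real (h (g x)) - f x * of_real (p (g x))))"
          by (intro integrable_norm Bochner_Integration.integrable_diff int h p)
        show "integrable M (\<lambda>x. e * norm (f x))" using f by simp
        fix x assume "x \<in> space M"
        then have "\<bar>h (g x) - p (g x)\<bar> \<le> e" using e r by (meson less_imp_le)
        moreover have "f x * of_real (h (g x)) - f x * of_real (p (g x)) = f x * of_real (h (g x) - p (g x))"
          by (simp add: algebra_simps)
        moreover from calculation(1) have "norm (f x) * \<bar>h (g x) - p (g x)\<bar> \<le> norm (f x) * e"
          by (intro mult_left_mono) auto
        ultimately show "norm (f x * of_real (h (g x)) - f x * of_real (p (g x))) \<le> e * norm (f x)"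
          by (simp only: norm_mult norm_of_real mult.commute)
      qed
      finally show ?thesis by simp
    qed
    have "norm (?I1 h - ?I2 h) \<le> e * N" if e: "0 < e" for e
    proof -
      obtain p where p: "real_polynomial_function p" "\<And>x. x \<in> {0..1} \<Longrightarrow> \<bar>h x - p x\<bar> < e"
        using Stone_Weierstrass_real_polynomial_function[of "{0..1 :: real}" h e] e continuous_on_subset[OF h]
        by auto
      have pc: "continuous_on UNIV p" using p(1) unfolding real_polynomial_function_iff_sum by (auto intro!: continuous_intros)
      have "?I1 h - ?I2 h = (?I1 h - ?I1 p) - (?I2 h - ?I2 p)" using poly[OF p(1)] by simp
      also have "norm \<dots> \<le> norm (?I1 h - ?I1 p) + norm (?I2 h - ?I2 p)" by (rule norm_triangle_ineq4)
      also have "\<dots> \<le> e * (\<integral>x. norm (f1 x) \<partial>M1) + e * (\<integral>x. norm (f2 x) \<partial>M2)"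
        by (intro add_mono approx[OF f(1) g(1) r(1) pc p(2)] approx[OF f(2) g(2) r(2) pc p(2)])
      finally show ?thesis by (simp add: N_def distrib_left)
    qed
    then have le: "norm (?I1 h - ?I2 h) \<le> e * N" if "0 < e" for e using that by blast
    have "norm (?I1 h - ?I2 h) \<le> 0 + e" if "0 < e" for e
    proof -
      have "0 < e / (N + 1)" using N0 that by simp
      from le[OF this] have "norm (?I1 h - ?I2 h) \<le> (e / (N + 1)) * N" .
      also have "\<dots> \<le> e" using N0 that by (simp add: field_simps)
      finally show ?thesis by simp
    qed
    then have "norm (?I1 h - ?I2 h) \<le> 0" by (rule field_le_epsilon)
    then show ?thesis by simp
  qed
  define h where "h m x = max 0 (min 1 (1 - real m * (x - u)))" for m x
  have h_cont: "continuous_on UNIV (h m)" for m unfolding h_def by (intro continuous_intros)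
  have h_lim: "(\<lambda>m. h m x) \<longlonglongrightarrow> indicator {..u} x" for x
  proof (cases "x \<le> u")
    case True
    then have "h m x = 1" for m by (simp add: h_def mult_nonneg_nonpos)
    then show ?thesis using True by simp
  next
    case False
    then obtain N where N: "1 < real N * (x - u)" using ex_less_of_nat_mult[of "x - u" 1] by auto
    have "\<forall>\<^sub>F m in sequentially. h m x = 0"
      using eventually_ge_at_top[of N]
    proof eventually_elim
      case (elim m)
      then have "real N * (x - u) \<le> real m * (x - u)" using False by (intro mult_right_mono) auto
      then show ?case using N by (simp add: h_def)
    qed
    then show ?thesis using False by (simp add: tendsto_eventually)
  qed
  have lim: "(\<lambda>m. \<integral>x. f x * of_real (h m (g x)) \<partial>M) \<longlonglongrightarrow> (\<integral>x. f x * of_real (indicator {..u} (g x)) \<partial>M)"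
    if "integrable M f" "g \<in> borel_measurable M" for M :: "'d measure" and f :: "'d \<Rightarrow> complex" and g
    by (rule integral_mult_bounded_limit[OF that(1), where C = 1])
       (auto simp: h_lim intro!: measurable_compose[OF that(2) borel_measurable_continuous_onI[OF h_cont]], simp add: h_def)
  show ?thesis
    using LIMSEQ_unique[OF lim[OF f(1) g(1)]] lim[OF f(2) g(2)] cont[OF h_cont] by simp
qed

text \<open>
  One coordinate after the other: the powers of the remaining coordinates, and the indicators already
  obtained, are absorbed into the densities \<open>f1\<close> and \<open>f2\<close>. This is why the densities have to be allowed
  to be arbitrary integrable functions rather than measures.
\<close>
lemma moments_determine_orthants:
  fixes g1 :: "'a \<Rightarrow> 'b \<Rightarrow> real" and g2 :: "'a \<Rightarrow> 'c \<Rightarrow> real" and f1 :: "'b \<Rightarrow> complex" and f2 :: "'c \<Rightarrow> complex"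
  assumes U: "finite U" and f: "integrable M1 f1" "integrable M2 f2"
    and g: "\<And>i. i \<in> U \<Longrightarrow> g1 i \<in> borel_measurable M1" "\<And>i. i \<in> U \<Longrightarrow> g2 i \<in> borel_measurable M2"
    and r: "\<And>i x. i \<in> U \<Longrightarrow> x \<in> space M1 \<Longrightarrow> g1 i x \<in> {0..1}" "\<And>i x. i \<in> U \<Longrightarrow> x \<in> space M2 \<Longrightarrow> g2 i x \<in> {0..1}"
    and moments: "\<And>k :: 'a \<Rightarrow> nat. (\<integral>x. f1 x * of_real (\<Prod>i\<in>U. g1 i x ^ k i) \<partial>M1) = (\<integral>x. f2 x * of_real (\<Prod>i\<in>U. g2 i x ^ k i) \<partial>M2)"
  shows "(\<integral>x. f1 x * of_real (\<Prod>i\<in>U. indicator {..u i} (g1 i x)) \<partial>M1) =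
    (\<integral>x. f2 x * of_real (\<Prod>i\<in>U. indicator {..u i} (g2 i x)) \<partial>M2)"
  using U f g r moments
proof (induction U arbitrary: f1 f2 rule: finite_induct)
  case (insert j U)
  have power: "integrable M (\<lambda>x. f x * of_real (g x ^ k))"
    if "integrable M f" "g \<in> borel_measurable M" "\<And>x. x \<in> space M \<Longrightarrow> g x \<in> {0..1}"
    for M :: "'d measure" and f :: "'d \<Rightarrow> complex" and g and k :: nat
    by (rule integrable_mult_bounded[OF that(1), where C = 1])
       (use that in \<open>auto simp: power_le_one intro: borel_measurable_power\<close>)
  have ind: "integrable M (\<lambda>x. f x * of_real (\<Prod>i\<in>U. indicator {..u i} (g i x)))"
    if "integrable M f" "\<And>i. i \<in> U \<Longrightarrow> g i \<in> borel_measurable M"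
    for M :: "'d measure" and f :: "'d \<Rightarrow> complex" and g :: "'a \<Rightarrow> 'd \<Rightarrow> real"
  proof (rule integrable_mult_bounded[OF that(1), where C = 1])
    show "(\<lambda>x. \<Prod>i\<in>U. indicator {..u i} (g i x) :: real) \<in> borel_measurable M"
      by (intro borel_measurable_prod measurable_compose[OF that(2) borel_measurable_indicator]) auto
    show "\<bar>\<Prod>i\<in>U. indicator {..u i} (g i x)\<bar> \<le> (1 :: real)" for x
      unfolding abs_prod by (rule prod_le_1) (auto simp: indicator_def)
  qed
  note G = insert.prems(3)[OF insertI1] insert.prems(4)[OF insertI1]
  note R = insert.prems(5)[OF insertI1] insert.prems(6)[OF insertI1]
  have swap: "f x * of_real (a ^ k) * of_real p = f x * of_real p * of_real (a ^ k)" for f :: "'d \<Rightarrow> complex" and x a p and k :: nat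
    by (simp add: mult_ac)
  have "(\<integral>x. f1 x * of_real (\<Prod>i\<in>U. indicator {..u i} (g1 i x)) * of_real (g1 j x ^ m) \<partial>M1) =
      (\<integral>x. f2 x * of_real (\<Prod>i\<in>U. indicator {..u i} (g2 i x)) * of_real (g2 j x ^ m) \<partial>M2)" for m :: nat
    unfolding swap[symmetric]
  proof (rule insert.IH)
    show "integrable M1 (\<lambda>x. f1 x * of_real (g1 j x ^ m))" by (rule power[OF insert.prems(1) G(1) R(1)])
    show "integrable M2 (\<lambda>x. f2 x * of_real (g2 j x ^ m))" by (rule power[OF insert.prems(2) G(2) R(2)])
    fix k :: "'a \<Rightarrow> nat"
    have "(\<Prod>i\<in>insert j U. h i ^ (k(j := m)) i) = h j ^ m * (\<Prod>i\<in>U. h i ^ k i)" for h :: "'a \<Rightarrow> real"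
    proof -
      have "(\<Prod>i\<in>U. h i ^ (k(j := m)) i) = (\<Prod>i\<in>U. h i ^ k i)"
        using insert.hyps(2) by (intro prod.cong) auto
      then show ?thesis using insert.hyps by simp
    qed
    note split = this
    show "(\<integral>x. f1 x * of_real (g1 j x ^ m) * of_real (\<Prod>i\<in>U. g1 i x ^ k i) \<partial>M1) =
        (\<integral>x. f2 x * of_real (g2 j x ^ m) * of_real (\<Prod>i\<in>U. g2 i x ^ k i) \<partial>M2)"
      using insert.prems(7)[of "k(j := m)"] unfolding split of_real_mult mult.assoc .
  qed (use insert.prems in auto)
  from moments_determine_halflines[OF ind[OF insert.prems(1,3)] ind[OF insert.prems(2,4)] G R this, of "u j"]
  show ?case using insert.hyps by (simp add: mult_ac)
qed (use moments in simp)

lemma sets_PiM_borel_atLeast: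
  assumes "finite S"
  shows "sets (pi_borel S) =
    sigma_sets (space (pi_borel S)) {Pi\<^sub>E S F | F. \<forall>i\<in>S. F i \<in> range atLeast}"
proof -
  let ?E = "range (atLeast :: real \<Rightarrow> real set)"
  let ?\<Omega> = "\<Pi>\<^sub>E x\<in>S. (UNIV :: real set)"
  have "(\<Union>n. {- real n..}) = (UNIV :: real set)"
  proof -
    have "x \<in> (\<Union>n. {- real n..})" for x
    proof -
      obtain n where "- x \<le> real n" using real_arch_simple by blast
      then show ?thesis by (intro UN_I[of n]) auto
    qed
    then show ?thesis by auto
  qed
  then have cover: "\<exists>T\<subseteq>?E. countable T \<and> UNIV = \<Union>T"
    by (intro exI[of _ "range (\<lambda>n. {- real n..})"]) auto
  have P: "{{f \<in> ?\<Omega>. \<forall>i\<in>j. f i \<in> A i} | A j. j \<in> {S} \<and> A \<in> Pi j (\<lambda>_. ?E)} =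
      {Pi\<^sub>E S F | F. \<forall>i\<in>S. F i \<in> ?E}"
  proof -
    have "{f \<in> ?\<Omega>. \<forall>i\<in>S. f i \<in> A i} = Pi\<^sub>E S A" for A by (auto simp: PiE_def)
    then show ?thesis by (simp add: Pi_def Ball_def)
  qed
  have "sets (pi_borel S) = sets (\<Pi>\<^sub>M x\<in>S. sigma UNIV ?E)"
    unfolding borel_Ici ..
  also have "\<dots> = sets (sigma ?\<Omega> {{f \<in> ?\<Omega>. \<forall>i\<in>j. f i \<in> A i} | A j. j \<in> {S} \<and> A \<in> Pi j (\<lambda>_. ?E)})"
    by (rule sets_PiM_sigma) (use cover assms in auto)
  also have "\<dots> = sigma_sets ?\<Omega> {Pi\<^sub>E S F | F. \<forall>i\<in>S. F i \<in> ?E}"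
    unfolding P by (rule sets_measure_of) auto
  finally show ?thesis by (simp add: space_PiM)
qed

text \<open>
  At integer arguments the Laplace transform consists of the joint moments of the bounded quantities
  \<open>exp (- l\<^sub>x)\<close>. These determine the integrals over products of half-lines, then over measurable sets by
  Dynkin's lemma, then of bounded measurable functions. Working with the pairs \<open>(M1, f1)\<close> and
  \<open>(M2, f2)\<close> allows a density that is not known to be nonnegative.
\<close>
theorem laplace_transforms_determine:
  fixes f1 :: "'b \<Rightarrow> complex" and f2 :: "'c \<Rightarrow> complex" and G1 :: "'b \<Rightarrow> 'a \<Rightarrow> real" and G2 :: "'c \<Rightarrow> 'a \<Rightarrow> real"
  assumes S: "finite S" and f: "integrable M1 f1" "integrable M2 f2"
    and G: "G1 \<in> measurable M1 (pi_borel S)" "G2 \<in> measurable M2 (pi_borel S)"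
    and pos: "\<And>\<omega> x. x \<in> S \<Longrightarrow> \<omega> \<in> space M1 \<Longrightarrow> 0 \<le> G1 \<omega> x" "\<And>\<omega> x. x \<in> S \<Longrightarrow> \<omega> \<in> space M2 \<Longrightarrow> 0 \<le> G2 \<omega> x"
    and laplace: "\<And>V. (\<And>x. 0 \<le> V x) \<Longrightarrow> (\<integral>\<omega>. f1 \<omega> * of_real (exp (- (\<Sum>x\<in>S. V x * G1 \<omega> x))) \<partial>M1) =
        (\<integral>\<omega>. f2 \<omega> * of_real (exp (- (\<Sum>x\<in>S. V x * G2 \<omega> x))) \<partial>M2)"
    and F: "F \<in> borel_measurable (pi_borel S)" "\<And>l. l \<in> space (pi_borel S) \<Longrightarrow> \<bar>F l\<bar> \<le> (C :: real)"
  shows "(\<integral>\<omega>. f1 \<omega> * of_real (F (G1 \<omega>)) \<partial>M1) = (\<integral>\<omega>. f2 \<omega> * of_real (F (G2 \<omega>)) \<partial>M2)"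
proof -
  let ?B = "pi_borel S"
  let ?I1 = "\<lambda>\<phi>. \<integral>\<omega>. f1 \<omega> * of_real (\<phi> (G1 \<omega>)) \<partial>M1" and ?I2 = "\<lambda>\<phi>. \<integral>\<omega>. f2 \<omega> * of_real (\<phi> (G2 \<omega>)) \<partial>M2"
  have comp: "(\<lambda>\<omega>. Gi \<omega> x) \<in> borel_measurable M" if "Gi \<in> measurable M ?B" "x \<in> S"
    for M :: "'d measure" and Gi x
    by (rule measurable_compose[OF that(1) measurable_component_singleton[OF that(2)]])
  have expm: "(\<lambda>\<omega>. exp (- Gi \<omega> x)) \<in> borel_measurable M" if "Gi \<in> measurable M ?B" "x \<in> S"
    for M :: "'d measure" and Gi :: "'d \<Rightarrow> 'a \<Rightarrow> real" and x
    by (intro measurable_compose[OF _ borel_measurable_exp] borel_measurable_uminus comp[OF that])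
  have prod_exp: "(\<Prod>x\<in>S. exp (- l x) ^ k x) = exp (- (\<Sum>x\<in>S. real (k x) * l x))" for l :: "'a \<Rightarrow> real" and k :: "'a \<Rightarrow> nat"
    using S by (simp add: exp_sum exp_of_nat_mult[symmetric] sum_negf[symmetric])
  have orth: "(\<integral>\<omega>. f1 \<omega> * of_real (\<Prod>x\<in>S. indicator {..u x} (exp (- G1 \<omega> x))) \<partial>M1) =
      (\<integral>\<omega>. f2 \<omega> * of_real (\<Prod>x\<in>S. indicator {..u x} (exp (- G2 \<omega> x))) \<partial>M2)" for u
  proof (rule moments_determine_orthants[OF S f, where ?g1.0 = "\<lambda>x \<omega>. exp (- G1 \<omega> x)" and ?g2.0 = "\<lambda>x \<omega>. exp (- G2 \<omega> x)"])
    show "(\<integral>\<omega>. f1 \<omega> * of_real (\<Prod>x\<in>S. exp (- G1 \<omega> x) ^ k x) \<partial>M1) =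
        (\<integral>\<omega>. f2 \<omega> * of_real (\<Prod>x\<in>S. exp (- G2 \<omega> x) ^ k x) \<partial>M2)" for k :: "'a \<Rightarrow> nat"
      unfolding prod_exp by (rule laplace) simp
  qed (use expm[OF G(1)] expm[OF G(2)] pos in auto)
  have lim: "(\<lambda>n. \<integral>\<omega>. f \<omega> * of_real (\<phi> n (Gi \<omega>)) \<partial>M) \<longlonglongrightarrow> (\<integral>\<omega>. f \<omega> * of_real (\<phi>' (Gi \<omega>)) \<partial>M)"
    if "integrable M f" "Gi \<in> measurable M ?B" "\<And>n. \<phi> n \<in> borel_measurable ?B"
      "\<And>n l. l \<in> space ?B \<Longrightarrow> \<bar>\<phi> n l\<bar> \<le> D" "\<And>l. l \<in> space ?B \<Longrightarrow> (\<lambda>n. \<phi> n l) \<longlonglongrightarrow> \<phi>' l"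
    for M :: "'d measure" and f :: "'d \<Rightarrow> complex" and Gi and \<phi> :: "nat \<Rightarrow> ('a \<Rightarrow> real) \<Rightarrow> real" and \<phi>' D
    by (rule integral_mult_bounded_limit[OF that(1) measurable_compose[OF that(2,3)]])
       (use that(4,5) measurable_space[OF that(2)] in blast)+
  have int: "integrable M (\<lambda>\<omega>. f \<omega> * of_real (\<phi> (Gi \<omega>)))"
    if "integrable M f" "Gi \<in> measurable M ?B" "\<phi> \<in> borel_measurable ?B" "\<And>l. l \<in> space ?B \<Longrightarrow> \<bar>\<phi> l\<bar> \<le> D"
    for M :: "'d measure" and f :: "'d \<Rightarrow> complex" and Gi and \<phi> :: "('a \<Rightarrow> real) \<Rightarrow> real" and D
    by (rule integrable_mult_bounded[OF that(1) measurable_compose[OF that(2,3)]])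
       (use that(4) measurable_space[OF that(2)] in blast)
  have sets: "?I1 (indicator A) = ?I2 (indicator A)" if A: "A \<in> sets ?B" for A
  proof -
    let ?E = "{Pi\<^sub>E S F | F. \<forall>i\<in>S. F i \<in> range (atLeast :: real \<Rightarrow> real set)}"
    have stable: "Int_stable ?E"
    proof (rule Int_stableI, clarsimp)
      fix F F' assume F: "\<forall>i\<in>S. F i \<in> range (atLeast :: real \<Rightarrow> real set)" "\<forall>i\<in>S. F' i \<in> range (atLeast :: real \<Rightarrow> real set)"
      have "F i \<inter> F' i \<in> range atLeast" if i: "i \<in> S" for i
      proof -
        obtain a b where "F i = {a..}" "F' i = {b..}" using F i by blast
        then have "F i \<inter> F' i = {max a b..}" by auto
        then show ?thesis by blast
      qed
      then show "\<exists>F''. Pi\<^sub>E S F \<inter> Pi\<^sub>E S F' = Pi\<^sub>E S F'' \<and> (\<forall>i\<in>S. F'' i \<in> range atLeast)"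
        by (intro exI[of _ "\<lambda>i. F i \<inter> F' i"]) (auto simp: PiE_Int)
    qed
    have sub: "?E \<subseteq> Pow (space ?B)" by (auto simp: space_PiM)
    have A': "A \<in> sigma_sets (space ?B) ?E" using A unfolding sets_PiM_borel_atLeast[OF S] .
    from stable sub A' show ?thesis
    proof (induction rule: sigma_sets_induct_disjoint)
      case (basic A)
      then obtain F where A: "A = Pi\<^sub>E S F" and F: "\<forall>i\<in>S. F i \<in> range (atLeast :: real \<Rightarrow> real set)" by blast
      then have "\<exists>c. \<forall>i\<in>S. F i = {c i..}" by (intro bchoice) auto
      then obtain c where c: "\<And>i. i \<in> S \<Longrightarrow> F i = {c i..}" by blast
      \<comment> \<open>The condition \<open>c\<^sub>x \<le> l\<^sub>x\<close> is a half-line condition on \<open>exp (- l\<^sub>x)\<close>.\<close>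
      have ind: "indicator A l = (\<Prod>x\<in>S. indicator {..exp (- c x)} (exp (- l x)) :: real)" if l: "l \<in> space ?B" for l
      proof (cases "l \<in> A")
        case True
        then have "indicator {..exp (- c x)} (exp (- l x)) = (1 :: real)" if "x \<in> S" for x
          using c[OF that] that by (auto simp: A PiE_def Pi_def)
        then show ?thesis using True by simp
      next
        case False
        then obtain x where x: "x \<in> S" "l x \<notin> F x" using l by (auto simp: A PiE_def space_PiM)
        then have "indicator {..exp (- c x)} (exp (- l x)) = (0 :: real)" using c[OF x(1)] by simp
        then have "(\<Prod>x\<in>S. indicator {..exp (- c x)} (exp (- l x)) :: real) = 0" using S x(1) by (intro prod_zero) auto
        then show ?thesis using False by simp
      qed
      have "?I1 (indicator A) = (\<integral>\<omega>. f1 \<omega> * of_real (\<Prod>x\<in>S. indicator {..exp (- c x)} (exp (- G1 \<omega> x))) \<partial>M1)"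
        by (rule Bochner_Integration.integral_cong[OF refl]) (simp only: ind[OF measurable_space[OF G(1)]])
      moreover have "?I2 (indicator A) = (\<integral>\<omega>. f2 \<omega> * of_real (\<Prod>x\<in>S. indicator {..exp (- c x)} (exp (- G2 \<omega> x))) \<partial>M2)"
        by (rule Bochner_Integration.integral_cong[OF refl]) (simp only: ind[OF measurable_space[OF G(2)]])
      ultimately show ?case using orth by simp
    next
      case (compl A)
      then have Am: "A \<in> sets ?B" by (simp only: sets_PiM_borel_atLeast[OF S])
      have split: "(\<integral>\<omega>. f \<omega> * of_real (indicator (space ?B - A) (Gi \<omega>)) \<partial>M) =
          (\<integral>\<omega>. f \<omega> \<partial>M) - (\<integral>\<omega>. f \<omega> * of_real (indicator A (Gi \<omega>)) \<partial>M)"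
        if "integrable M f" "Gi \<in> measurable M ?B" for M :: "'d measure" and f :: "'d \<Rightarrow> complex" and Gi
      proof -
        have "(\<integral>\<omega>. f \<omega> * of_real (indicator (space ?B - A) (Gi \<omega>)) \<partial>M) =
            (\<integral>\<omega>. f \<omega> - f \<omega> * of_real (indicator A (Gi \<omega>)) \<partial>M)"
          by (rule Bochner_Integration.integral_cong[OF refl])
             (use measurable_space[OF that(2)] in \<open>auto simp: indicator_def\<close>)
        also have "\<dots> = (\<integral>\<omega>. f \<omega> \<partial>M) - (\<integral>\<omega>. f \<omega> * of_real (indicator A (Gi \<omega>)) \<partial>M)"
          by (rule Bochner_Integration.integral_diff[OF that(1) int[of _ _ _ _ 1, OF that borel_measurable_indicator[OF Am]]])
             (simp add: indicator_def)
        finally show ?thesis .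
      qed
      have "(\<integral>\<omega>. f1 \<omega> \<partial>M1) = (\<integral>\<omega>. f2 \<omega> \<partial>M2)" using laplace[of "\<lambda>_. 0"] by simp
      then show ?case unfolding split[OF f(1) G(1)] split[OF f(2) G(2)] using compl.IH by (simp only:)
    next
      case (union A)
      then have Am: "A i \<in> sets ?B" for i unfolding sets_PiM_borel_atLeast[OF S] by blast
      let ?\<phi> = "\<lambda>n l. \<Sum>i<n. indicator (A i) l :: real"
      have \<phi>: "?\<phi> n l = indicator (\<Union>i<n. A i) l" for n l
        by (rule indicator_UN_disjoint[symmetric]) (use union.hyps(1) in \<open>auto simp: disjoint_family_on_def\<close>)
      have conv: "(\<lambda>n. ?\<phi> n l) \<longlonglongrightarrow> indicator (\<Union>i. A i) l" for l
        unfolding \<phi> by (rule LIMSEQ_indicator_UN)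
      have \<phi>m: "?\<phi> n \<in> borel_measurable ?B" for n
        by (intro borel_measurable_sum borel_measurable_indicator Am)
      have \<phi>b: "\<bar>?\<phi> n l\<bar> \<le> 1" for n l unfolding \<phi> by (simp add: indicator_def)
      have sum: "(\<integral>\<omega>. f \<omega> * of_real (?\<phi> n (Gi \<omega>)) \<partial>M) = (\<Sum>i<n. \<integral>\<omega>. f \<omega> * of_real (indicator (A i) (Gi \<omega>)) \<partial>M)"
        if "integrable M f" "Gi \<in> measurable M ?B" for M :: "'d measure" and f :: "'d \<Rightarrow> complex" and Gi n
        unfolding of_real_sum sum_distrib_left
        by (rule Bochner_Integration.integral_sum, rule int[of _ _ _ _ 1, OF that borel_measurable_indicator[OF Am]])
           (simp add: indicator_def)
      have "(\<lambda>n. ?I1 (?\<phi> n)) \<longlonglongrightarrow> ?I1 (indicator (\<Union>i. A i))" "(\<lambda>n. ?I2 (?\<phi> n)) \<longlonglongrightarrow> ?I2 (indicator (\<Union>i. A i))"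
        by (rule lim[OF f(1) G(1) \<phi>m \<phi>b conv], rule lim[OF f(2) G(2) \<phi>m \<phi>b conv])
      moreover have "?I1 (?\<phi> n) = ?I2 (?\<phi> n)" for n
        unfolding sum[OF f(1) G(1)] sum[OF f(2) G(2)] using union.IH by simp
      ultimately show ?case using LIMSEQ_unique by simp
    qed simp
  qed
  have nonneg: "(\<exists>C. \<forall>l\<in>space ?B. \<phi> l \<le> C) \<longrightarrow> ?I1 \<phi> = ?I2 \<phi>"
    if "\<phi> \<in> borel_measurable ?B" "\<And>l. 0 \<le> \<phi> l" for \<phi> :: "('a \<Rightarrow> real) \<Rightarrow> real"
    using that
  proof (induction rule: borel_measurable_induct_real)
    case (set A)
    then show ?case using sets by blast
  next
    case (mult u c)
    show ?case
    proof (intro impI, cases "c = 0")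
      case False
      assume "\<exists>C. \<forall>l\<in>space ?B. c * u l \<le> C"
      then obtain C where "\<forall>l\<in>space ?B. c * u l \<le> C" by blast
      then have "\<forall>l\<in>space ?B. u l \<le> C / c" using False mult.hyps by (auto simp: field_simps)
      then have "?I1 u = ?I2 u" using mult.IH by blast
      moreover have scale: "(\<integral>\<omega>. f \<omega> * of_real (c * u (Gi \<omega>)) \<partial>M) = of_real c * (\<integral>\<omega>. f \<omega> * of_real (u (Gi \<omega>)) \<partial>M)"
        for M :: "'d measure" and f :: "'d \<Rightarrow> complex" and Gi
        unfolding integral_mult_right_zero[symmetric] by (simp add: mult_ac)
      ultimately show "?I1 (\<lambda>l. c * u l) = ?I2 (\<lambda>l. c * u l)" unfolding scale by (simp only:)
    qed simp
  next
    case (add u v)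
    show ?case
    proof
      assume "\<exists>C. \<forall>l\<in>space ?B. v l + u l \<le> C"
      then obtain C where C: "\<And>l. l \<in> space ?B \<Longrightarrow> v l + u l \<le> C" by blast
      have bu: "u l \<le> C" and bv: "v l \<le> C" if "l \<in> space ?B" for l
        using C[OF that] add.hyps(2,4) [of l] by linarith+
      have "?I1 u = ?I2 u" "?I1 v = ?I2 v" using add.IH bu bv by blast+
      moreover have split: "(\<integral>\<omega>. f \<omega> * of_real (v (Gi \<omega>) + u (Gi \<omega>)) \<partial>M) =
          (\<integral>\<omega>. f \<omega> * of_real (v (Gi \<omega>)) \<partial>M) + (\<integral>\<omega>. f \<omega> * of_real (u (Gi \<omega>)) \<partial>M)"
        if "integrable M f" "Gi \<in> measurable M ?B" for M :: "'d measure" and f :: "'d \<Rightarrow> complex" and Gi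
        unfolding of_real_add distrib_left
        by (rule Bochner_Integration.integral_add; rule int[of _ _ _ _ C, OF that])
           (use add.hyps bu bv in auto)
      ultimately show "?I1 (\<lambda>l. v l + u l) = ?I2 (\<lambda>l. v l + u l)"
        unfolding split[OF f(1) G(1)] split[OF f(2) G(2)] by (simp only:)
    qed
  next
    case (seq U)
    show ?case
    proof
      assume "\<exists>C. \<forall>l\<in>space ?B. \<phi> l \<le> C"
      then obtain C where C: "\<And>l. l \<in> space ?B \<Longrightarrow> \<phi> l \<le> C" by blast
      have le: "U i l \<le> C" if l: "l \<in> space ?B" for i l
      proof -
        have "U i l \<le> \<phi> l"
          by (rule incseq_le[OF _ seq.hyps(4)[OF l]]) (use seq.hyps(3) in \<open>auto simp: incseq_def le_fun_def\<close>)
        then show ?thesis using C[OF l] by simp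
      qed
      have ab: "\<bar>U i l\<bar> \<le> C" if "l \<in> space ?B" for i l using le[OF that, of i] seq.hyps(2)[of i l] by simp
      have "?I1 (U i) = ?I2 (U i)" for i using seq.IH le by blast
      moreover have "(\<lambda>i. ?I1 (U i)) \<longlonglongrightarrow> ?I1 \<phi>" "(\<lambda>i. ?I2 (U i)) \<longlonglongrightarrow> ?I2 \<phi>"
        by (rule lim[OF f(1) G(1) seq.hyps(1) ab seq.hyps(4)], assumption+,
            rule lim[OF f(2) G(2) seq.hyps(1) ab seq.hyps(4)], assumption+)
      ultimately show "?I1 \<phi> = ?I2 \<phi>" using LIMSEQ_unique by simp
    qed
  qed
  let ?p = "\<lambda>l. max 0 (F l)" and ?n = "\<lambda>l. max 0 (- F l)"
  have pm: "?p \<in> borel_measurable ?B" "?n \<in> borel_measurable ?B"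
    by (intro borel_measurable_max borel_measurable_const borel_measurable_uminus F(1))+
  have pb: "?p l \<le> max 0 C" "?n l \<le> max 0 C" if "l \<in> space ?B" for l using F(2)[OF that] by auto
  have "?I1 ?p = ?I2 ?p" by (rule nonneg[OF pm(1), THEN mp]) (simp, use pb(1) in blast)
  moreover have "?I1 ?n = ?I2 ?n" by (rule nonneg[OF pm(2), THEN mp]) (simp, use pb(2) in blast)
  moreover have split: "(\<integral>\<omega>. f \<omega> * of_real (F (Gi \<omega>)) \<partial>M) =
      (\<integral>\<omega>. f \<omega> * of_real (?p (Gi \<omega>)) \<partial>M) - (\<integral>\<omega>. f \<omega> * of_real (?n (Gi \<omega>)) \<partial>M)"
    if "integrable M f" "Gi \<in> measurable M ?B" for M :: "'d measure" and f :: "'d \<Rightarrow> complex" and Gi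
  proof -
    have "(\<integral>\<omega>. f \<omega> * of_real (F (Gi \<omega>)) \<partial>M) =
        (\<integral>\<omega>. f \<omega> * of_real (?p (Gi \<omega>)) - f \<omega> * of_real (?n (Gi \<omega>)) \<partial>M)"
      by (rule Bochner_Integration.integral_cong[OF refl]) (simp add: max_def algebra_simps)
    also have "\<dots> = (\<integral>\<omega>. f \<omega> * of_real (?p (Gi \<omega>)) \<partial>M) - (\<integral>\<omega>. f \<omega> * of_real (?n (Gi \<omega>)) \<partial>M)"
      by (rule Bochner_Integration.integral_diff; rule int[of _ _ _ _ "max 0 C", OF that])
         (use pm pb in auto)
    finally show ?thesis .
  qed
  ultimately show ?thesis unfolding split[OF f(1) G(1)] split[OF f(2) G(2)] by (simp only:)
qed

section \<open>The joint density of the local times\<close>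

context continuous_time_markov_chain
begin

lemma rate_killed_generator:
  assumes "finite S" "x \<in> S" "z x \<noteq> 0"
  shows "rate S (killed_generator V) z x = rate S A z x - of_real (V x)"
proof -
  have "rate S (killed_generator V) z x =
      (\<Sum>y\<in>S. of_real (A x y) * (z y / z x)) - (\<Sum>y\<in>S. if x = y then of_real (V x) else 0)"
    unfolding rate_def sum_subtractf[symmetric] killed_generator_def
    by (rule sum.cong[OF refl]) (use assms(3) in \<open>auto simp: algebra_simps\<close>)
  then show ?thesis using assms(1,2) by (simp add: rate_def sum.delta)
qed

text \<open>
  Subtracting \<open>V\<close> from the diagonal lowers the rate of \<open>x\<close> by \<open>V\<^sub>x\<close>, since \<open>z\<^sub>x / z\<^sub>x = 1\<close>. In the rate matrix the
  two changes cancel; in the exponent they produce the Laplace weight.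
\<close>
lemma cofactor_mean_killed_generator:
  assumes "finite S"
  shows "cofactor_mean (killed_generator V) S a b l =
    cofactor_mean A S a b l * of_real (exp (- (\<Sum>x\<in>S. V x * l x)))"
proof -
  have "cofactor_mean (killed_generator V) S a b l = torus_mean S (\<lambda>z.
      of_real (exp (- (\<Sum>x\<in>S. V x * l x))) * (cofactor S a b (rate_matrix S A z) * exp (\<Sum>x\<in>S. of_real (l x) * rate S A z x)))"
    unfolding cofactor_mean_def exp_mean_def
  proof (rule torus_mean_cong)
    fix \<theta> :: "'a \<Rightarrow> real"
    let ?z = "phase \<theta>"
    have "cofactor S a b (rate_matrix S (killed_generator V) ?z) = cofactor S a b (rate_matrix S A ?z)"
      by (rule cofactor_cong[OF assms])
         (use rate_killed_generator[where V = V and z = ?z, OF assms _ phase_nonzero] in \<open>auto simp: rate_matrix_def killed_generator_def\<close>)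
    moreover have "(\<Sum>x\<in>S. of_real (l x) * rate S (killed_generator V) ?z x) =
        (\<Sum>x\<in>S. of_real (l x) * rate S A ?z x) + of_real (- (\<Sum>x\<in>S. V x * l x))"
      by (simp add: rate_killed_generator[OF assms _ phase_nonzero] algebra_simps sum_subtractf)
    ultimately show "cofactor S a b (rate_matrix S (killed_generator V) ?z) *
        exp (\<Sum>x\<in>S. of_real (l x) * rate S (killed_generator V) ?z x) =
        of_real (exp (- (\<Sum>x\<in>S. V x * l x))) * (cofactor S a b (rate_matrix S A ?z) * exp (\<Sum>x\<in>S. of_real (l x) * rate S A ?z x))"
      by (simp only: exp_add exp_of_real mult_ac)
  qed
  then show ?thesis
    unfolding torus_mean_mult by (simp only: cofactor_mean_def exp_mean_def mult.commute)
qed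

lemma range_mass_density:
  assumes R: "finite R" "a \<in> R" "b \<in> R" "x0 \<in> R" and V: "\<And>x. 0 \<le> V x" and T: "0 < T"
  shows "complex_of_real (range_mass V R a b T) =
    (\<integral>l. cofactor_mean A R a b l * of_real (exp (- (\<Sum>x\<in>R. V x * l x))) \<partial>simplex_measure R x0 T)"
  unfolding range_mass_eq[OF R(1-3) V T] range_weight_chart[OF R(1,3,4), symmetric]
    cofactor_mean_killed_generator[OF R(1)] ..

lemma local_time_in_simplex:
  assumes \<omega>: "\<omega> \<in> space (P a)" and R: "finite R" "local_time_range X T \<omega> = R" "X T \<omega> \<in> R" and T: "0 < T"
  shows "restrict (local_time X T \<omega>) R \<in> mass_simplex R T"
proof -
  have "X s \<omega> \<in> R" if "0 \<le> s" "s \<le> T" for s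
    using local_time_range_subset_iff[OF \<omega> R(3)] R(2) that by blast
  then have "(\<Sum>x\<in>R. local_time X T \<omega> x) = T" by (rule local_time_sum[OF \<omega> T R(1)])
  moreover have "0 < local_time X T \<omega> x" if "x \<in> R" for x
  proof -
    have "local_time X T \<omega> x \<noteq> 0" using that R(2) by (auto simp: local_time_range_def)
    then show ?thesis using local_time_nonneg[of T \<omega> x] by simp
  qed
  ultimately show ?thesis by (simp add: mass_simplex_def)
qed

text \<open>
  The function \<open>F\<close> is extended by \<open>0\<close> from the simplex to all coordinates, which changes neither side:
  on the event in question the local times lie in the simplex.
\<close>
theorem local_time_law:
  assumes R: "finite R" "a \<in> R" "b \<in> R" "x0 \<in> R" and T: "0 < T"
    and F: "F \<in> borel_measurable (mass_simplex_borel R T)" and C: "\<And>l. l \<in> mass_simplex R T \<Longrightarrow> \<bar>F l\<bar> \<le> C"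
  shows "integrable (P a) (\<lambda>\<omega>. F (restrict (local_time X T \<omega>) R) *
      (of_bool (local_time_range X T \<omega> = R) * of_bool (X T \<omega> = b)))" (is "integrable _ ?f")
    and "integrable (simplex_measure R x0 T) (\<lambda>l. complex_of_real (F l) * cofactor_mean A R a b l)"
    and "complex_of_real (\<integral>\<omega>. F (restrict (local_time X T \<omega>) R) *
      (of_bool (local_time_range X T \<omega> = R) * of_bool (X T \<omega> = b)) \<partial>P a) =
      (\<integral>l. complex_of_real (F l) * cofactor_mean A R a b l \<partial>simplex_measure R x0 T)"
proof -
  interpret prob_space "P a" by (rule prob_space_P)
  let ?B = "pi_borel R"
  let ?\<sigma> = "simplex_measure R x0 T"
  define e where "e \<omega> = (of_bool (local_time_range X T \<omega> = R) * of_bool (X T \<omega> = b) :: real)" for \<omega>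
  define L where "L \<omega> = restrict (local_time X T \<omega>) R" for \<omega>
  define F' where "F' l = indicator (mass_simplex R T) l * F l" for l
  have simplex_sets: "mass_simplex R T \<inter> space ?B \<in> sets ?B"
  proof -
    have comp: "(\<lambda>l. l x) \<in> borel_measurable ?B" if "x \<in> R" for x
      by (rule measurable_component_singleton[OF that])
    have "{l \<in> space ?B. 0 < l x} \<in> sets ?B" if "x \<in> R" for x
      by (rule borel_measurable_less[OF borel_measurable_const comp[OF that]])
    then have "{l \<in> space ?B. \<forall>x\<in>R. 0 < l x} \<in> sets ?B"
      by (intro sets.sets_Collect_finite_All R(1))
    moreover have "{l \<in> space ?B. (\<Sum>x\<in>R. l x) = T} \<in> sets ?B"
      by (rule borel_measurable_eq[OF borel_measurable_sum[OF comp] borel_measurable_const])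
    ultimately have "{l \<in> space ?B. (\<forall>x\<in>R. 0 < l x) \<and> (\<Sum>x\<in>R. l x) = T} \<in> sets ?B"
      by (rule sets.sets_Collect_conj[rotated])
    moreover have "mass_simplex R T \<inter> space ?B = {l \<in> space ?B. (\<forall>x\<in>R. 0 < l x) \<and> (\<Sum>x\<in>R. l x) = T}"
      by (auto simp: mass_simplex_def space_PiM PiE_def)
    ultimately show ?thesis by simp
  qed
  have F'm: "F' \<in> borel_measurable ?B"
    using F unfolding mass_simplex_borel_def borel_measurable_restrict_space_iff[OF simplex_sets] F'_def[abs_def] by simp
  have F'b: "\<bar>F' l\<bar> \<le> \<bar>C\<bar>" for l
    using C[of l] by (auto simp: F'_def indicator_def)
  have em: "e \<in> borel_measurable (P a)" unfolding e_def[abs_def] by (rule range_event_measurable[OF T])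
  have eb: "\<bar>e \<omega>\<bar> \<le> 1" for \<omega> by (simp add: e_def)
  have Lm: "L \<in> measurable (P a) ?B"
    unfolding L_def[abs_def]
    by (rule measurable_restrict[where X = "\<lambda>i \<omega>. local_time X T \<omega> i"]) (rule local_time_measurable[OF T])
  have F_eq: "F (L \<omega>) * e \<omega> = F' (L \<omega>) * e \<omega>" if "\<omega> \<in> space (P a)" for \<omega>
  proof (cases "local_time_range X T \<omega> = R \<and> X T \<omega> = b")
    case True
    then have "L \<omega> \<in> mass_simplex R T" unfolding L_def by (intro local_time_in_simplex[OF that R(1)]) (use R T in auto)
    then show ?thesis by (simp add: F'_def)
  qed (auto simp: e_def)
  have f1: "integrable (P a) (\<lambda>\<omega>. complex_of_real (e \<omega>))"
    by (rule integrable_const_bound[where B = 1]) (use eb em in auto)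
  have f2: "integrable ?\<sigma> (cofactor_mean A R a b)"
    by (rule bm_integrable[OF finite_measure_simplex[OF R(1,4)] bm_simplex[OF R(1) orthant_bounded_cofactor_mean[OF R(1)]]])
  have G2: "(\<lambda>l. l) \<in> measurable ?\<sigma> ?B"
    unfolding measurable_cong_sets[OF sets_simplex_measure refl] mass_simplex_borel_def
    by (rule measurable_restrict_space1) simp
  have key: "(\<integral>\<omega>. complex_of_real (e \<omega>) * of_real (F' (L \<omega>)) \<partial>P a) =
      (\<integral>l. cofactor_mean A R a b l * of_real (F' l) \<partial>?\<sigma>)"
  proof (rule laplace_transforms_determine[OF R(1) f1 f2 Lm G2 _ _ _ F'm F'b])
    show "0 \<le> L \<omega> x" if "x \<in> R" for \<omega> x using local_time_nonneg that by (simp add: L_def)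
    show "0 \<le> l x" if "x \<in> R" "l \<in> space ?\<sigma>" for l x
      using mass_simplex_le[OF R(1) _ that(1)] that(2) by (simp add: space_simplex_measure)
    fix V :: "'a \<Rightarrow> real" assume V: "\<And>x. 0 \<le> V x"
    have "(\<integral>\<omega>. complex_of_real (e \<omega>) * of_real (exp (- (\<Sum>x\<in>R. V x * L \<omega> x))) \<partial>P a) =
        (\<integral>\<omega>. complex_of_real (laplace_weight R V T \<omega> * (of_bool (local_time_range X T \<omega> = R) * of_bool (X T \<omega> = b))) \<partial>P a)"
      by (rule Bochner_Integration.integral_cong[OF refl])
         (simp add: e_def laplace_weight_def L_def mult.commute)
    also have "\<dots> = complex_of_real (range_mass V R a b T)"
      unfolding range_mass_def by (rule integral_complex_of_real)
    also have "\<dots> = (\<integral>l. cofactor_mean A R a b l * of_real (exp (- (\<Sum>x\<in>R. V x * l x))) \<partial>?\<sigma>)"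
      by (rule range_mass_density[OF R V T])
    finally show "(\<integral>\<omega>. complex_of_real (e \<omega>) * of_real (exp (- (\<Sum>x\<in>R. V x * L \<omega> x))) \<partial>P a) =
        (\<integral>l. cofactor_mean A R a b l * of_real (exp (- (\<Sum>x\<in>R. V x * l x))) \<partial>?\<sigma>)" .
  qed
  have F'L: "(\<lambda>\<omega>. F' (L \<omega>)) \<in> borel_measurable (P a)" by (rule measurable_compose[OF Lm F'm])
  have "integrable (P a) (\<lambda>\<omega>. F' (L \<omega>) * e \<omega>)"
  proof (rule integrable_const_bound[where B = "\<bar>C\<bar>"])
    show "AE \<omega> in P a. norm (F' (L \<omega>) * e \<omega>) \<le> \<bar>C\<bar>"
    proof (rule AE_I2)
      fix \<omega>
      have "\<bar>F' (L \<omega>)\<bar> * \<bar>e \<omega>\<bar> \<le> \<bar>C\<bar> * 1" by (intro mult_mono F'b eb) auto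
      then show "norm (F' (L \<omega>) * e \<omega>) \<le> \<bar>C\<bar>" by (simp add: abs_mult)
    qed
  qed (rule borel_measurable_times[OF F'L em])
  also have "?this \<longleftrightarrow> integrable (P a) (\<lambda>\<omega>. F (L \<omega>) * e \<omega>)"
    by (rule Bochner_Integration.integrable_cong[OF refl]) (rule F_eq[symmetric])
  finally show "integrable (P a) ?f" unfolding L_def e_def .
  have F2: "complex_of_real (F l) * cofactor_mean A R a b l = cofactor_mean A R a b l * of_real (F' l)" if "l \<in> space ?\<sigma>" for l
    using that by (simp add: F'_def space_simplex_measure)
  have "integrable ?\<sigma> (\<lambda>l. cofactor_mean A R a b l * of_real (F' l))"
    by (rule integrable_mult_bounded[OF f2 measurable_compose[OF G2 F'm] F'b])
  also have "?this \<longleftrightarrow> integrable ?\<sigma> (\<lambda>l. complex_of_real (F l) * cofactor_mean A R a b l)"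
    by (rule Bochner_Integration.integrable_cong[OF refl]) (rule F2[symmetric])
  finally show "integrable ?\<sigma> (\<lambda>l. complex_of_real (F l) * cofactor_mean A R a b l)" .
  have "complex_of_real (\<integral>\<omega>. F (L \<omega>) * e \<omega> \<partial>P a) = complex_of_real (\<integral>\<omega>. F' (L \<omega>) * e \<omega> \<partial>P a)"
    by (rule arg_cong[where f = complex_of_real], rule Bochner_Integration.integral_cong[OF refl]) (rule F_eq)
  also have "\<dots> = (\<integral>\<omega>. complex_of_real (F' (L \<omega>) * e \<omega>) \<partial>P a)" by (rule integral_complex_of_real[symmetric])
  also have "\<dots> = (\<integral>\<omega>. complex_of_real (e \<omega>) * of_real (F' (L \<omega>)) \<partial>P a)"
    by (rule Bochner_Integration.integral_cong[OF refl]) (simp add: mult.commute)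
  also have "\<dots> = (\<integral>l. complex_of_real (F l) * cofactor_mean A R a b l \<partial>?\<sigma>)"
    unfolding key by (rule Bochner_Integration.integral_cong[OF refl]) (rule F2[symmetric])
  finally show "complex_of_real (\<integral>\<omega>. F (restrict (local_time X T \<omega>) R) *
      (of_bool (local_time_range X T \<omega> = R) * of_bool (X T \<omega> = b)) \<partial>P a) =
      (\<integral>l. complex_of_real (F l) * cofactor_mean A R a b l \<partial>?\<sigma>)"
    unfolding L_def e_def .
qed

end

theorem theorem2p1:
  fixes A :: "'a :: countable \<Rightarrow> 'a \<Rightarrow> real"
    and P :: "'a \<Rightarrow> 'w measure"
    and X :: "real \<Rightarrow> 'w \<Rightarrow> 'a"
    and R :: "'a set"
    and a b x0 :: 'a
    and T :: real
    and F :: "('a \<Rightarrow> real) \<Rightarrow> real"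
  assumes "\<exists>x y :: 'a. x \<noteq> y"
    and "conservative_generator A"
    and "continuous_time_markov_chain A P X"
    and "finite R" and "a \<in> R" and "b \<in> R" and "x0 \<in> R"
    and "0 < T"
    and "F \<in> borel_measurable (mass_simplex_borel R T)"
    and "\<exists>C. \<forall>l\<in>mass_simplex R T. \<bar>F l\<bar> \<le> C"
  shows "integrable (P a)
           (\<lambda>\<omega>. F (restrict (local_time X T \<omega>) R) *
                indicator {\<omega>. X T \<omega> = b} \<omega> * indicator {\<omega>. local_time_range X T \<omega> = R} \<omega>) \<and>
         integrable (simplex_measure R x0 T)
           (\<lambda>l. complex_of_real (F l) * local_time_density A R a b l) \<and>
         complex_of_real
           (LINT \<omega>|P a. F (restrict (local_time X T \<omega>) R) *
                indicator {\<omega>. X T \<omega> = b} \<omega> * indicator {\<omega>. local_time_range X T \<omega> = R} \<omega>) =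
         (LINT l|simplex_measure R x0 T.
            complex_of_real (F l) * local_time_density A R a b l)"
proof -
  interpret continuous_time_markov_chain A P X by fact
  obtain C where C: "\<And>l. l \<in> mass_simplex R T \<Longrightarrow> \<bar>F l\<bar> \<le> C" using assms(10) by blast
  have left: "F (restrict (local_time X T \<omega>) R) * indicator {\<omega>. X T \<omega> = b} \<omega> *
      indicator {\<omega>. local_time_range X T \<omega> = R} \<omega> = F (restrict (local_time X T \<omega>) R) *
      (of_bool (local_time_range X T \<omega> = R) * of_bool (X T \<omega> = b))" for \<omega>
    by (simp add: indicator_def)
  have right: "complex_of_real (F l) * local_time_density A R a b l = complex_of_real (F l) * cofactor_mean A R a b l"
    if "l \<in> space (simplex_measure R x0 T)" for l
  proof -
    have "0 < l x" if "x \<in> R" for x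
      using \<open>l \<in> space (simplex_measure R x0 T)\<close> that by (auto simp: space_simplex_measure mass_simplex_def)
    then show ?thesis using local_time_density_eq[OF assms(4,6)] by simp
  qed
  have integrable_iff: "integrable (simplex_measure R x0 T) (\<lambda>l. complex_of_real (F l) * local_time_density A R a b l) \<longleftrightarrow>
      integrable (simplex_measure R x0 T) (\<lambda>l. complex_of_real (F l) * cofactor_mean A R a b l)"
    by (rule Bochner_Integration.integrable_cong[OF refl]) (rule right)
  have integral_eq: "(LINT l|simplex_measure R x0 T. complex_of_real (F l) * local_time_density A R a b l) =
      (LINT l|simplex_measure R x0 T. complex_of_real (F l) * cofactor_mean A R a b l)"
    by (rule Bochner_Integration.integral_cong[OF refl]) (rule right)
  show ?thesis
    unfolding left integrable_iff integral_eq
    by (intro conjI; rule local_time_law[OF assms(4-9) C])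
qed

end
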